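(* Let $S$ and $T : \mathcal A \to \mathcal B$ be 2-functors between finitely complete 2-categories and let $\phi : S \to T$ be a 2-natural transformation. If (1) $T$ is opfamilial, (2) $T1$ is groupoidal, and (3) the naturality squares of $\phi$ are pullbacks, then the naturality squares of $\phi$ are also bipullbacks, and $\phi$ is diexact.
   Context: $1$ denotes the terminal object of $\mathcal A$. An object $X$ of a 2-category $\mathcal B$ is groupoidal if $\mathcal B(Y,X)$ is a groupoid for all $Y$. **Opfamilial.** A 2-functor $T : \mathcal A \to \mathcal B$ is a local right adjoint if the 2-functor $T_1 : \mathcal A \to \mathcal B/T1$, sending $X$ to $Tt_X : TX \to T1$ (with $t_X : X \to 1$), has a left adjoint. An opfamilial 2-functor is a local right adjoint $T$ together with a lifting of $T_1 : \mathcal A \to \mathcal B/T1$ through the forgetful 2-functor to $\mathcal B/T1$ from the 2-category of split opfibrations over $T1$ in $\mathcal B$ and morphisms preserving the chosen opcartesian 2-cells (i.e. the strict algebras and strict morphisms of the 2-monad on $\mathcal B/T1$ for split opfibrations). **Bipullbacks.** A square commuting (up to isomorphism) over $f : A \to C$ and $g : B \to C$ is a bipullback if the induced arrow to the isocomma object $f\downarrow_{\cong}g$ (with the universal property of the comma object, restricted to squares containing an invertible 2-cell) is an equivalence. **Exactness.** In a 2-category with comma objects, a 2-cell $\psi : g \to hf$ (with $f : X \to Y$, $g : X \to A$, $h : Y \to A$) exhibits $h$ as a left Kan extension of $g$ along $f$ if for every $k : Y \to A$, pasting with $\psi$ is a bijection between 2-cells $h \to k$ and 2-cells $g \to kf$.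 It is pointwise if for every $k : Z \to Y$, with comma square $p : f\downarrow k \to X$, $q : f \downarrow k \to Z$, $\lambda : fp \to kq$, the 2-cell $(h\lambda)(\psi p) : gp \to hkq$ exhibits $hk$ as a left Kan extension of $gp$ along $q$. A lax square $p : P \to A$, $q : P \to B$, $f : A \to C$, $g : B \to C$, $\phi : fp \to gq$ is exact if for every $\psi : h \to lf$ exhibiting $l$ as a pointwise left Kan extension of $h$ along $f$, $(l\phi)(\psi p) : hp \to lgq$ exhibits $lg$ as a pointwise left Kan extension of $hp$ along $q$. A 2-natural transformation $\phi : S \to T$ is diexact if for every $f : A \to B$ in $\mathcal A$ the naturality square $T(f)\phi_A = \phi_BS(f)$ is exact in both senses: both the lax square with 2-cell $\mathrm{id} : T(f)\phi_A \to \phi_BS(f)$ (bottom arrow $Tf$, right arrow $\phi_B$) and the lax square with 2-cell $\mathrm{id} : \phi_BS(f) \to T(f)\phi_A$ (bottom arrow $\phi_B$, right arrow $Tf$) are exact. *)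

theory Defs
  imports Main
begin

section \<open>2-categories\<close>

text \<open>
  A (strict) 2-category is given by carrier sets of objects, 1-cells and 2-cells; all axioms are
  relativised to these carriers. Both compositions are written in the applicative order:
  \<open>g \<cdot> f\<close> is \<open>f\<close> followed by \<open>g\<close>, and \<open>\<beta> \<bullet> \<alpha>\<close> (vertical) is \<open>\<alpha>\<close> followed by \<open>\<beta>\<close>.
\<close>

record ('o, 'a, 'c) two_cat =
  Obj :: "'o set"
  Arr :: "'a set"
  Cell :: "'c set"
  dom1 :: "'a \<Rightarrow> 'o"
  cod1 :: "'a \<Rightarrow> 'o"
  src :: "'c \<Rightarrow> 'a"
  tgt :: "'c \<Rightarrow> 'a"
  id1 :: "'o \<Rightarrow> 'a"
  id2 :: "'a \<Rightarrow> 'c"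
  comp1 :: "'a \<Rightarrow> 'a \<Rightarrow> 'a"  (infixr "\<cdot>\<index>" 70)
  vcomp :: "'c \<Rightarrow> 'c \<Rightarrow> 'c"  (infixr "\<bullet>\<index>" 65)
  hcomp :: "'c \<Rightarrow> 'c \<Rightarrow> 'c"  (infixr "\<star>\<index>" 70)

definition hom1 :: "('o, 'a, 'c) two_cat \<Rightarrow> 'o \<Rightarrow> 'o \<Rightarrow> 'a set" where
  "hom1 C X Y = {f \<in> Arr C. dom1 C f = X \<and> cod1 C f = Y}"

definition hom2 :: "('o, 'a, 'c) two_cat \<Rightarrow> 'a \<Rightarrow> 'a \<Rightarrow> 'c set" where
  "hom2 C f g = {\<alpha> \<in> Cell C. src C \<alpha> = f \<and> tgt C \<alpha> = g}"

abbreviation lwhisker :: "('o, 'a, 'c) two_cat \<Rightarrow> 'a \<Rightarrow> 'c \<Rightarrow> 'c"  (infixr "\<rhd>\<index>" 70) where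
  "h \<rhd>\<^bsub>C\<^esub> \<alpha> \<equiv> id2 C h \<star>\<^bsub>C\<^esub> \<alpha>"

abbreviation rwhisker :: "('o, 'a, 'c) two_cat \<Rightarrow> 'c \<Rightarrow> 'a \<Rightarrow> 'c"  (infixl "\<lhd>\<index>" 70) where
  "\<alpha> \<lhd>\<^bsub>C\<^esub> k \<equiv> \<alpha> \<star>\<^bsub>C\<^esub> id2 C k"

locale two_category =
  fixes C :: "('o, 'a, 'c) two_cat" (structure)
  assumes dom1_cod1: "f \<in> Arr C \<Longrightarrow> dom1 C f \<in> Obj C \<and> cod1 C f \<in> Obj C"
    and src_tgt: "\<alpha> \<in> Cell C \<Longrightarrow> src C \<alpha> \<in> Arr C \<and> tgt C \<alpha> \<in> Arr C"
    and parallel: "\<alpha> \<in> Cell C \<Longrightarrow>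
      dom1 C (src C \<alpha>) = dom1 C (tgt C \<alpha>) \<and> cod1 C (src C \<alpha>) = cod1 C (tgt C \<alpha>)"
    and id1_hom: "X \<in> Obj C \<Longrightarrow> id1 C X \<in> hom1 C X X"
    and comp1_hom: "\<lbrakk>f \<in> hom1 C X Y; g \<in> hom1 C Y Z\<rbrakk> \<Longrightarrow> g \<cdot> f \<in> hom1 C X Z"
    and comp1_id_left: "f \<in> hom1 C X Y \<Longrightarrow> id1 C Y \<cdot> f = f"
    and comp1_id_right: "f \<in> hom1 C X Y \<Longrightarrow> f \<cdot> id1 C X = f"
    and comp1_assoc: "\<lbrakk>f \<in> hom1 C W X; g \<in> hom1 C X Y; h \<in> hom1 C Y Z\<rbrakk>
      \<Longrightarrow> (h \<cdot> g) \<cdot> f = h \<cdot> (g \<cdot> f)"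
    and id2_hom: "f \<in> Arr C \<Longrightarrow> id2 C f \<in> hom2 C f f"
    and vcomp_hom: "\<lbrakk>\<alpha> \<in> hom2 C f g; \<beta> \<in> hom2 C g h\<rbrakk> \<Longrightarrow> \<beta> \<bullet> \<alpha> \<in> hom2 C f h"
    and vcomp_id_left: "\<alpha> \<in> hom2 C f g \<Longrightarrow> id2 C g \<bullet> \<alpha> = \<alpha>"
    and vcomp_id_right: "\<alpha> \<in> hom2 C f g \<Longrightarrow> \<alpha> \<bullet> id2 C f = \<alpha>"
    and vcomp_assoc: "\<lbrakk>\<alpha> \<in> hom2 C f g; \<beta> \<in> hom2 C g h; \<gamma> \<in> hom2 C h k\<rbrakk>
      \<Longrightarrow> (\<gamma> \<bullet> \<beta>) \<bullet> \<alpha> = \<gamma> \<bullet> (\<beta> \<bullet> \<alpha>)"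
    and hcomp_hom: "\<lbrakk>f \<in> hom1 C X Y; g \<in> hom1 C Y Z; \<alpha> \<in> hom2 C f f'; \<beta> \<in> hom2 C g g'\<rbrakk>
      \<Longrightarrow> \<beta> \<star> \<alpha> \<in> hom2 C (g \<cdot> f) (g' \<cdot> f')"
    and hcomp_id2: "\<lbrakk>f \<in> hom1 C X Y; g \<in> hom1 C Y Z\<rbrakk> \<Longrightarrow> id2 C g \<star> id2 C f = id2 C (g \<cdot> f)"
    and interchange: "\<lbrakk>f \<in> hom1 C X Y; g \<in> hom1 C Y Z; \<alpha> \<in> hom2 C f f'; \<alpha>' \<in> hom2 C f' f'';
        \<beta> \<in> hom2 C g g'; \<beta>' \<in> hom2 C g' g''\<rbrakk>
      \<Longrightarrow> (\<beta>' \<bullet> \<beta>) \<star> (\<alpha>' \<bullet> \<alpha>) = (\<beta>' \<star> \<alpha>') \<bullet> (\<beta> \<star> \<alpha>)"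
    and hcomp_id_left: "\<lbrakk>f \<in> hom1 C X Y; \<alpha> \<in> hom2 C f f'\<rbrakk> \<Longrightarrow> id2 C (id1 C Y) \<star> \<alpha> = \<alpha>"
    and hcomp_id_right: "\<lbrakk>f \<in> hom1 C X Y; \<alpha> \<in> hom2 C f f'\<rbrakk> \<Longrightarrow> \<alpha> \<star> id2 C (id1 C X) = \<alpha>"
    and hcomp_assoc: "\<lbrakk>f \<in> hom1 C W X; g \<in> hom1 C X Y; h \<in> hom1 C Y Z;
        \<alpha> \<in> hom2 C f f'; \<beta> \<in> hom2 C g g'; \<gamma> \<in> hom2 C h h'\<rbrakk>
      \<Longrightarrow> (\<gamma> \<star> \<beta>) \<star> \<alpha> = \<gamma> \<star> (\<beta> \<star> \<alpha>)"

definition invertible2 :: "('o, 'a, 'c) two_cat \<Rightarrow> 'c \<Rightarrow> bool" where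
  "invertible2 C \<alpha> \<longleftrightarrow> \<alpha> \<in> Cell C \<and>
     (\<exists>\<beta> \<in> hom2 C (tgt C \<alpha>) (src C \<alpha>).
        \<beta> \<bullet>\<^bsub>C\<^esub> \<alpha> = id2 C (src C \<alpha>) \<and> \<alpha> \<bullet>\<^bsub>C\<^esub> \<beta> = id2 C (tgt C \<alpha>))"

definition isomorphic1 :: "('o, 'a, 'c) two_cat \<Rightarrow> 'a \<Rightarrow> 'a \<Rightarrow> bool" where
  "isomorphic1 C f g \<longleftrightarrow> (\<exists>\<alpha> \<in> hom2 C f g. invertible2 C \<alpha>)"

definition equivalence1 :: "('o, 'a, 'c) two_cat \<Rightarrow> 'a \<Rightarrow> bool" where
  "equivalence1 C u \<longleftrightarrow> u \<in> Arr C \<and>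
     (\<exists>v \<in> hom1 C (cod1 C u) (dom1 C u).
        isomorphic1 C (v \<cdot>\<^bsub>C\<^esub> u) (id1 C (dom1 C u)) \<and>
        isomorphic1 C (u \<cdot>\<^bsub>C\<^esub> v) (id1 C (cod1 C u)))"

definition groupoidal :: "('o, 'a, 'c) two_cat \<Rightarrow> 'o \<Rightarrow> bool" where
  "groupoidal C X \<longleftrightarrow> X \<in> Obj C \<and>
     (\<forall>Y \<in> Obj C. \<forall>f \<in> hom1 C Y X. \<forall>g \<in> hom1 C Y X. \<forall>\<alpha> \<in> hom2 C f g. invertible2 C \<alpha>)"


section \<open>2-functors, 2-natural transformations, 2-adjunctions\<close>

record ('o, 'a, 'c, 'p, 'b, 'd) two_fun =
  map0 :: "'o \<Rightarrow> 'p"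
  map1 :: "'a \<Rightarrow> 'b"
  map2 :: "'c \<Rightarrow> 'd"

locale two_functor = A: two_category A + B: two_category B
  for A :: "('o, 'a, 'c) two_cat" and B :: "('p, 'b, 'd) two_cat" +
  fixes F :: "('o, 'a, 'c, 'p, 'b, 'd) two_fun"
  assumes map0_obj: "X \<in> Obj A \<Longrightarrow> map0 F X \<in> Obj B"
    and map1_hom: "f \<in> hom1 A X Y \<Longrightarrow> map1 F f \<in> hom1 B (map0 F X) (map0 F Y)"
    and map2_hom: "\<alpha> \<in> hom2 A f g \<Longrightarrow> map2 F \<alpha> \<in> hom2 B (map1 F f) (map1 F g)"
    and map1_id: "X \<in> Obj A \<Longrightarrow> map1 F (id1 A X) = id1 B (map0 F X)"
    and map1_comp: "\<lbrakk>f \<in> hom1 A X Y; g \<in> hom1 A Y Z\<rbrakk>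
      \<Longrightarrow> map1 F (g \<cdot>\<^bsub>A\<^esub> f) = map1 F g \<cdot>\<^bsub>B\<^esub> map1 F f"
    and map2_id: "f \<in> Arr A \<Longrightarrow> map2 F (id2 A f) = id2 B (map1 F f)"
    and map2_vcomp: "\<lbrakk>\<alpha> \<in> hom2 A f g; \<beta> \<in> hom2 A g h\<rbrakk>
      \<Longrightarrow> map2 F (\<beta> \<bullet>\<^bsub>A\<^esub> \<alpha>) = map2 F \<beta> \<bullet>\<^bsub>B\<^esub> map2 F \<alpha>"
    and map2_hcomp: "\<lbrakk>f \<in> hom1 A X Y; g \<in> hom1 A Y Z; \<alpha> \<in> hom2 A f f'; \<beta> \<in> hom2 A g g'\<rbrakk>
      \<Longrightarrow> map2 F (\<beta> \<star>\<^bsub>A\<^esub> \<alpha>) = map2 F \<beta> \<star>\<^bsub>B\<^esub> map2 F \<alpha>"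

definition id_two_fun :: "('o, 'a, 'c, 'o, 'a, 'c) two_fun" where
  "id_two_fun = \<lparr>map0 = \<lambda>X. X, map1 = \<lambda>f. f, map2 = \<lambda>\<alpha>. \<alpha>\<rparr>"

definition comp_two_fun ::
  "('p, 'b, 'd, 'q, 'e, 'f) two_fun \<Rightarrow> ('o, 'a, 'c, 'p, 'b, 'd) two_fun
    \<Rightarrow> ('o, 'a, 'c, 'q, 'e, 'f) two_fun" where
  "comp_two_fun G F =
     \<lparr>map0 = \<lambda>X. map0 G (map0 F X), map1 = \<lambda>f. map1 G (map1 F f), map2 = \<lambda>\<alpha>. map2 G (map2 F \<alpha>)\<rparr>"

definition two_fun_eq ::
  "('o, 'a, 'c) two_cat \<Rightarrow> ('o, 'a, 'c, 'p, 'b, 'd) two_fun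
    \<Rightarrow> ('o, 'a, 'c, 'p, 'b, 'd) two_fun \<Rightarrow> bool" where
  "two_fun_eq A F G \<longleftrightarrow>
     (\<forall>X \<in> Obj A. map0 F X = map0 G X) \<and>
     (\<forall>f \<in> Arr A. map1 F f = map1 G f) \<and>
     (\<forall>\<alpha> \<in> Cell A. map2 F \<alpha> = map2 G \<alpha>)"

locale two_natural = F: two_functor A B F + G: two_functor A B G
  for A :: "('o, 'a, 'c) two_cat" and B :: "('p, 'b, 'd) two_cat"
    and F :: "('o, 'a, 'c, 'p, 'b, 'd) two_fun" and G :: "('o, 'a, 'c, 'p, 'b, 'd) two_fun" +
  fixes \<phi> :: "'o \<Rightarrow> 'b"
  assumes component_hom: "X \<in> Obj A \<Longrightarrow> \<phi> X \<in> hom1 B (map0 F X) (map0 G X)"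
    and naturality1: "f \<in> hom1 A X Y \<Longrightarrow> map1 G f \<cdot>\<^bsub>B\<^esub> \<phi> X = \<phi> Y \<cdot>\<^bsub>B\<^esub> map1 F f"
    and naturality2: "\<lbrakk>f \<in> hom1 A X Y; \<alpha> \<in> hom2 A f g\<rbrakk>
      \<Longrightarrow> map2 G \<alpha> \<lhd>\<^bsub>B\<^esub> \<phi> X = \<phi> Y \<rhd>\<^bsub>B\<^esub> map2 F \<alpha>"

locale two_adjunction = L: two_functor C D L + R: two_functor D C R +
  unit: two_natural C C id_two_fun "comp_two_fun R L" \<eta> +
  counit: two_natural D D "comp_two_fun L R" id_two_fun \<epsilon>
  for C :: "('o, 'a, 'c) two_cat" and D :: "('p, 'b, 'd) two_cat"
    and L :: "('o, 'a, 'c, 'p, 'b, 'd) two_fun" and R :: "('p, 'b, 'd, 'o, 'a, 'c) two_fun"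
    and \<eta> :: "'o \<Rightarrow> 'a" and \<epsilon> :: "'p \<Rightarrow> 'b" +
  assumes triangle_left: "X \<in> Obj C \<Longrightarrow> \<epsilon> (map0 L X) \<cdot>\<^bsub>D\<^esub> map1 L (\<eta> X) = id1 D (map0 L X)"
    and triangle_right: "Y \<in> Obj D \<Longrightarrow> map1 R (\<epsilon> Y) \<cdot>\<^bsub>C\<^esub> \<eta> (map0 R Y) = id1 C (map0 R Y)"

definition has_left_adjoint ::
  "('p, 'b, 'd) two_cat \<Rightarrow> ('o, 'a, 'c) two_cat \<Rightarrow> ('p, 'b, 'd, 'o, 'a, 'c) two_fun \<Rightarrow> bool" where
  "has_left_adjoint D C R \<longleftrightarrow> (\<exists>L \<eta> \<epsilon>. two_adjunction C D L R \<eta> \<epsilon>)"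


section \<open>2-dimensional limits\<close>

text \<open>All universal properties below include their 2-dimensional part.\<close>

definition terminal :: "('o, 'a, 'c) two_cat \<Rightarrow> 'o \<Rightarrow> bool" where
  "terminal C I \<longleftrightarrow> I \<in> Obj C \<and>
     (\<forall>X \<in> Obj C. (\<exists>!t. t \<in> hom1 C X I) \<and>
        (\<forall>s \<in> hom1 C X I. \<forall>t \<in> hom1 C X I. \<exists>!\<alpha>. \<alpha> \<in> hom2 C s t))"

definition pullback :: "('o, 'a, 'c) two_cat \<Rightarrow> 'a \<Rightarrow> 'a \<Rightarrow> 'a \<Rightarrow> 'a \<Rightarrow> bool" where
  "pullback C p q f g \<longleftrightarrow>
     (\<exists>P X Y Z. p \<in> hom1 C P X \<and> q \<in> hom1 C P Y \<and> f \<in> hom1 C X Z \<and> g \<in> hom1 C Y Z \<and>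
        f \<cdot>\<^bsub>C\<^esub> p = g \<cdot>\<^bsub>C\<^esub> q \<and>
        (\<forall>W \<in> Obj C. \<forall>x \<in> hom1 C W X. \<forall>y \<in> hom1 C W Y. f \<cdot>\<^bsub>C\<^esub> x = g \<cdot>\<^bsub>C\<^esub> y \<longrightarrow>
           (\<exists>!u. u \<in> hom1 C W P \<and> p \<cdot>\<^bsub>C\<^esub> u = x \<and> q \<cdot>\<^bsub>C\<^esub> u = y)) \<and>
        (\<forall>W \<in> Obj C. \<forall>u \<in> hom1 C W P. \<forall>v \<in> hom1 C W P.
           \<forall>\<alpha> \<in> hom2 C (p \<cdot>\<^bsub>C\<^esub> u) (p \<cdot>\<^bsub>C\<^esub> v). \<forall>\<beta> \<in> hom2 C (q \<cdot>\<^bsub>C\<^esub> u) (q \<cdot>\<^bsub>C\<^esub> v).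
           f \<rhd>\<^bsub>C\<^esub> \<alpha> = g \<rhd>\<^bsub>C\<^esub> \<beta> \<longrightarrow>
           (\<exists>!\<gamma>. \<gamma> \<in> hom2 C u v \<and> p \<rhd>\<^bsub>C\<^esub> \<gamma> = \<alpha> \<and> q \<rhd>\<^bsub>C\<^esub> \<gamma> = \<beta>)))"

text \<open>
  A lax square \<open>lax_square C p q f g \<phi>\<close> is a 2-cell \<open>\<phi> : f \<cdot> p \<Rightarrow> g \<cdot> q\<close>.
\<close>

definition lax_square :: "('o, 'a, 'c) two_cat \<Rightarrow> 'a \<Rightarrow> 'a \<Rightarrow> 'a \<Rightarrow> 'a \<Rightarrow> 'c \<Rightarrow> bool" where
  "lax_square C p q f g \<phi> \<longleftrightarrow>
     (\<exists>P X Y Z. p \<in> hom1 C P X \<and> q \<in> hom1 C P Y \<and> f \<in> hom1 C X Z \<and> g \<in> hom1 C Y Z \<and>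
        \<phi> \<in> hom2 C (f \<cdot>\<^bsub>C\<^esub> p) (g \<cdot>\<^bsub>C\<^esub> q))"

text \<open>
  The universal property of the comma object among those lax squares whose 2-cell satisfies
  \<open>Q\<close>: with \<open>Q\<close> always true it is the comma object, with \<open>Q\<close> invertibility it is the isocomma
  object.
\<close>

definition universal_square ::
  "('c \<Rightarrow> bool) \<Rightarrow> ('o, 'a, 'c) two_cat \<Rightarrow> 'a \<Rightarrow> 'a \<Rightarrow> 'a \<Rightarrow> 'a \<Rightarrow> 'c \<Rightarrow> bool" where
  "universal_square Q C p q f g \<theta> \<longleftrightarrow>
     lax_square C p q f g \<theta> \<and> Q \<theta> \<and>
     (\<forall>x y \<psi>. lax_square C x y f g \<psi> \<and> Q \<psi> \<longrightarrow>
        (\<exists>!u. u \<in> hom1 C (dom1 C x) (dom1 C p) \<and>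
           p \<cdot>\<^bsub>C\<^esub> u = x \<and> q \<cdot>\<^bsub>C\<^esub> u = y \<and> \<theta> \<lhd>\<^bsub>C\<^esub> u = \<psi>)) \<and>
     (\<forall>W \<in> Obj C. \<forall>u \<in> hom1 C W (dom1 C p). \<forall>v \<in> hom1 C W (dom1 C p).
        \<forall>\<alpha> \<in> hom2 C (p \<cdot>\<^bsub>C\<^esub> u) (p \<cdot>\<^bsub>C\<^esub> v). \<forall>\<beta> \<in> hom2 C (q \<cdot>\<^bsub>C\<^esub> u) (q \<cdot>\<^bsub>C\<^esub> v).
        (g \<rhd>\<^bsub>C\<^esub> \<beta>) \<bullet>\<^bsub>C\<^esub> (\<theta> \<lhd>\<^bsub>C\<^esub> u) = (\<theta> \<lhd>\<^bsub>C\<^esub> v) \<bullet>\<^bsub>C\<^esub> (f \<rhd>\<^bsub>C\<^esub> \<alpha>) \<longrightarrow>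
        (\<exists>!\<gamma>. \<gamma> \<in> hom2 C u v \<and> p \<rhd>\<^bsub>C\<^esub> \<gamma> = \<alpha> \<and> q \<rhd>\<^bsub>C\<^esub> \<gamma> = \<beta>))"

definition comma_square ::
  "('o, 'a, 'c) two_cat \<Rightarrow> 'a \<Rightarrow> 'a \<Rightarrow> 'a \<Rightarrow> 'a \<Rightarrow> 'c \<Rightarrow> bool" where
  "comma_square C = universal_square (\<lambda>\<theta>. True) C"

definition isocomma_square ::
  "('o, 'a, 'c) two_cat \<Rightarrow> 'a \<Rightarrow> 'a \<Rightarrow> 'a \<Rightarrow> 'a \<Rightarrow> 'c \<Rightarrow> bool" where
  "isocomma_square C = universal_square (invertible2 C) C"

definition bipullback :: "('o, 'a, 'c) two_cat \<Rightarrow> 'a \<Rightarrow> 'a \<Rightarrow> 'a \<Rightarrow> 'a \<Rightarrow> 'c \<Rightarrow> bool" where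
  "bipullback C p q f g \<theta> \<longleftrightarrow>
     lax_square C p q f g \<theta> \<and> invertible2 C \<theta> \<and>
     (\<exists>p' q' \<theta>'. isocomma_square C p' q' f g \<theta>' \<and>
        (\<exists>u \<in> hom1 C (dom1 C p) (dom1 C p').
           p' \<cdot>\<^bsub>C\<^esub> u = p \<and> q' \<cdot>\<^bsub>C\<^esub> u = q \<and> \<theta>' \<lhd>\<^bsub>C\<^esub> u = \<theta> \<and> equivalence1 C u))"

text \<open>
  Finite completeness in the 2-categorical sense: finite conical limits and cotensors with the
  arrow category \<open>[1]\<close>. These generate all finite weighted limits, in particular comma and isocomma
  objects. A finite diagram consists of finitely many vertices \<open>V\<close>, labelled by objects \<open>D i\<close>, and
  finitely many edges \<open>(i, f, j)\<close> labelled by 1-cells \<open>f : D i \<rightarrow> D j\<close>.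
\<close>

definition finite_diagram ::
  "('o, 'a, 'c) two_cat \<Rightarrow> nat set \<Rightarrow> (nat \<Rightarrow> 'o) \<Rightarrow> (nat \<times> 'a \<times> nat) set \<Rightarrow> bool" where
  "finite_diagram C V D E \<longleftrightarrow> finite V \<and> finite E \<and> (\<forall>i \<in> V. D i \<in> Obj C) \<and>
     (\<forall>(i, f, j) \<in> E. i \<in> V \<and> j \<in> V \<and> f \<in> hom1 C (D i) (D j))"

definition cone ::
  "('o, 'a, 'c) two_cat \<Rightarrow> nat set \<Rightarrow> (nat \<Rightarrow> 'o) \<Rightarrow> (nat \<times> 'a \<times> nat) set
    \<Rightarrow> 'o \<Rightarrow> (nat \<Rightarrow> 'a) \<Rightarrow> bool" where
  "cone C V D E X x \<longleftrightarrow> X \<in> Obj C \<and> (\<forall>i \<in> V. x i \<in> hom1 C X (D i)) \<and>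
     (\<forall>(i, f, j) \<in> E. f \<cdot>\<^bsub>C\<^esub> x i = x j)"

definition conical_limit ::
  "('o, 'a, 'c) two_cat \<Rightarrow> nat set \<Rightarrow> (nat \<Rightarrow> 'o) \<Rightarrow> (nat \<times> 'a \<times> nat) set
    \<Rightarrow> 'o \<Rightarrow> (nat \<Rightarrow> 'a) \<Rightarrow> bool" where
  "conical_limit C V D E P \<pi> \<longleftrightarrow> cone C V D E P \<pi> \<and>
     (\<forall>X x. cone C V D E X x \<longrightarrow>
        (\<exists>!u. u \<in> hom1 C X P \<and> (\<forall>i \<in> V. \<pi> i \<cdot>\<^bsub>C\<^esub> u = x i))) \<and>
     (\<forall>X \<in> Obj C. \<forall>u \<in> hom1 C X P. \<forall>v \<in> hom1 C X P. \<forall>\<theta>.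
        (\<forall>i \<in> V. \<theta> i \<in> hom2 C (\<pi> i \<cdot>\<^bsub>C\<^esub> u) (\<pi> i \<cdot>\<^bsub>C\<^esub> v)) \<and>
        (\<forall>(i, f, j) \<in> E. f \<rhd>\<^bsub>C\<^esub> \<theta> i = \<theta> j) \<longrightarrow>
        (\<exists>!\<gamma>. \<gamma> \<in> hom2 C u v \<and> (\<forall>i \<in> V. \<pi> i \<rhd>\<^bsub>C\<^esub> \<gamma> = \<theta> i)))"

definition arrow_cotensor ::
  "('o, 'a, 'c) two_cat \<Rightarrow> 'o \<Rightarrow> 'o \<Rightarrow> 'a \<Rightarrow> 'a \<Rightarrow> 'c \<Rightarrow> bool" where
  "arrow_cotensor C X P p q \<theta> \<longleftrightarrow>
     p \<in> hom1 C P X \<and> q \<in> hom1 C P X \<and> \<theta> \<in> hom2 C p q \<and>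
     (\<forall>W \<in> Obj C. \<forall>x \<in> hom1 C W X. \<forall>y \<in> hom1 C W X. \<forall>\<psi> \<in> hom2 C x y.
        (\<exists>!u. u \<in> hom1 C W P \<and> p \<cdot>\<^bsub>C\<^esub> u = x \<and> q \<cdot>\<^bsub>C\<^esub> u = y \<and> \<theta> \<lhd>\<^bsub>C\<^esub> u = \<psi>)) \<and>
     (\<forall>W \<in> Obj C. \<forall>u \<in> hom1 C W P. \<forall>v \<in> hom1 C W P.
        \<forall>\<alpha> \<in> hom2 C (p \<cdot>\<^bsub>C\<^esub> u) (p \<cdot>\<^bsub>C\<^esub> v). \<forall>\<beta> \<in> hom2 C (q \<cdot>\<^bsub>C\<^esub> u) (q \<cdot>\<^bsub>C\<^esub> v).
        \<beta> \<bullet>\<^bsub>C\<^esub> (\<theta> \<lhd>\<^bsub>C\<^esub> u) = (\<theta> \<lhd>\<^bsub>C\<^esub> v) \<bullet>\<^bsub>C\<^esub> \<alpha> \<longrightarrow>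
        (\<exists>!\<gamma>. \<gamma> \<in> hom2 C u v \<and> p \<rhd>\<^bsub>C\<^esub> \<gamma> = \<alpha> \<and> q \<rhd>\<^bsub>C\<^esub> \<gamma> = \<beta>))"

definition finitely_complete :: "('o, 'a, 'c) two_cat \<Rightarrow> bool" where
  "finitely_complete C \<longleftrightarrow>
     (\<forall>V D E. finite_diagram C V D E \<longrightarrow> (\<exists>P \<pi>. conical_limit C V D E P \<pi>)) \<and>
     (\<forall>X \<in> Obj C. \<exists>P p q \<theta>. arrow_cotensor C X P p q \<theta>)"


section \<open>Slices and split opfibrations\<close>

text \<open>
  A 1-cell or 2-cell of the slice over \<open>Z\<close> carries its source and target objects as tags, since
  these are not determined by the underlying 1-cell or 2-cell.
\<close>

definition slice ::
  "('o, 'a, 'c) two_cat \<Rightarrow> 'o \<Rightarrow> ('a, 'a \<times> 'a \<times> 'a, 'a \<times> 'c \<times> 'a) two_cat" where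
  "slice C Z =
     (let Ob = {p \<in> Arr C. cod1 C p = Z};
          Ar = {(p, f, q). p \<in> Ob \<and> q \<in> Ob \<and> f \<in> hom1 C (dom1 C p) (dom1 C q) \<and> q \<cdot>\<^bsub>C\<^esub> f = p}
      in \<lparr>Obj = Ob,
          Arr = Ar,
          Cell = {(p, \<alpha>, q). \<alpha> \<in> Cell C \<and> (p, src C \<alpha>, q) \<in> Ar \<and> (p, tgt C \<alpha>, q) \<in> Ar \<and>
                             q \<rhd>\<^bsub>C\<^esub> \<alpha> = id2 C p},
          dom1 = \<lambda>(p, f, q). p,
          cod1 = \<lambda>(p, f, q). q,
          src = \<lambda>(p, \<alpha>, q). (p, src C \<alpha>, q),
          tgt = \<lambda>(p, \<alpha>, q). (p, tgt C \<alpha>, q),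
          id1 = \<lambda>p. (p, id1 C (dom1 C p), p),
          id2 = \<lambda>(p, f, q). (p, id2 C f, q),
          comp1 = \<lambda>(q, g, r) (p, f, q'). (p, g \<cdot>\<^bsub>C\<^esub> f, r),
          vcomp = \<lambda>(p', \<beta>, q') (p, \<alpha>, q). (p, \<beta> \<bullet>\<^bsub>C\<^esub> \<alpha>, q),
          hcomp = \<lambda>(q, \<beta>, r) (p, \<alpha>, q'). (p, \<beta> \<star>\<^bsub>C\<^esub> \<alpha>, r)\<rparr>)"

definition opcartesian :: "('o, 'a, 'c) two_cat \<Rightarrow> 'a \<Rightarrow> 'c \<Rightarrow> bool" where
  "opcartesian C p \<chi> \<longleftrightarrow> \<chi> \<in> Cell C \<and> cod1 C (src C \<chi>) = dom1 C p \<and>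
     (\<forall>a. \<forall>\<gamma> \<in> hom2 C (src C \<chi>) a. \<forall>\<beta> \<in> hom2 C (p \<cdot>\<^bsub>C\<^esub> tgt C \<chi>) (p \<cdot>\<^bsub>C\<^esub> a).
        \<beta> \<bullet>\<^bsub>C\<^esub> (p \<rhd>\<^bsub>C\<^esub> \<chi>) = p \<rhd>\<^bsub>C\<^esub> \<gamma> \<longrightarrow>
        (\<exists>!\<delta>. \<delta> \<in> hom2 C (tgt C \<chi>) a \<and> p \<rhd>\<^bsub>C\<^esub> \<delta> = \<beta> \<and> \<delta> \<bullet>\<^bsub>C\<^esub> \<chi> = \<gamma>))"

definition opliftable :: "('o, 'a, 'c) two_cat \<Rightarrow> 'a \<Rightarrow> 'a \<Rightarrow> 'c \<Rightarrow> bool" where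
  "opliftable C p a \<beta> \<longleftrightarrow>
     a \<in> Arr C \<and> cod1 C a = dom1 C p \<and> \<beta> \<in> Cell C \<and> src C \<beta> = p \<cdot>\<^bsub>C\<^esub> a"

text \<open>
  \<open>\<kappa> a \<beta>\<close> is the chosen opcartesian lift at \<open>a\<close> of the 2-cell \<open>\<beta> : p \<cdot> a \<Rightarrow> b\<close>. The choice is strictly
  functorial in \<open>\<beta>\<close> and stable under precomposition with 1-cells, so that it amounts to a strict
  algebra structure on \<open>p\<close> for the split opfibration 2-monad on the slice. The function is extensional
  in order that two split opfibrations are equal precisely if their chosen lifts agree.
\<close>

definition split_opfibration :: "('o, 'a, 'c) two_cat \<Rightarrow> 'a \<Rightarrow> ('a \<Rightarrow> 'c \<Rightarrow> 'c) \<Rightarrow> bool" where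
  "split_opfibration C p \<kappa> \<longleftrightarrow> p \<in> Arr C \<and>
     (\<forall>a \<beta>. opliftable C p a \<beta> \<longrightarrow>
        src C (\<kappa> a \<beta>) = a \<and> p \<rhd>\<^bsub>C\<^esub> \<kappa> a \<beta> = \<beta> \<and> opcartesian C p (\<kappa> a \<beta>)) \<and>
     (\<forall>a \<in> Arr C. cod1 C a = dom1 C p \<longrightarrow> \<kappa> a (id2 C (p \<cdot>\<^bsub>C\<^esub> a)) = id2 C a) \<and>
     (\<forall>a \<beta> \<beta>'. opliftable C p a \<beta> \<and> \<beta>' \<in> Cell C \<and> src C \<beta>' = tgt C \<beta> \<longrightarrow>
        \<kappa> a (\<beta>' \<bullet>\<^bsub>C\<^esub> \<beta>) = \<kappa> (tgt C (\<kappa> a \<beta>)) \<beta>' \<bullet>\<^bsub>C\<^esub> \<kappa> a \<beta>) \<and>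
     (\<forall>a \<beta> h. opliftable C p a \<beta> \<and> h \<in> Arr C \<and> cod1 C h = dom1 C a \<longrightarrow>
        \<kappa> (a \<cdot>\<^bsub>C\<^esub> h) (\<beta> \<lhd>\<^bsub>C\<^esub> h) = \<kappa> a \<beta> \<lhd>\<^bsub>C\<^esub> h) \<and>
     (\<forall>a \<beta>. \<not> opliftable C p a \<beta> \<longrightarrow> \<kappa> a \<beta> = undefined)"

text \<open>
  The 2-category of split opfibrations over \<open>Z\<close>: 1-cells preserve chosen opcartesian 2-cells
  strictly, and 2-cells are all 2-cells of the slice. (These are the algebra 2-cells, because the
  2-monad is lax-idempotent.)
\<close>

definition split_opfibrations ::
  "('o, 'a, 'c) two_cat \<Rightarrow> 'o \<Rightarrow>
    ('a \<times> ('a \<Rightarrow> 'c \<Rightarrow> 'c),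
     ('a \<times> ('a \<Rightarrow> 'c \<Rightarrow> 'c)) \<times> 'a \<times> ('a \<times> ('a \<Rightarrow> 'c \<Rightarrow> 'c)),
     ('a \<times> ('a \<Rightarrow> 'c \<Rightarrow> 'c)) \<times> 'c \<times> ('a \<times> ('a \<Rightarrow> 'c \<Rightarrow> 'c))) two_cat" where
  "split_opfibrations C Z =
     (let Ob = {(p, \<kappa>). p \<in> Obj (slice C Z) \<and> split_opfibration C p \<kappa>};
          Ar = {((p, \<kappa>), f, (q, \<kappa>')). (p, \<kappa>) \<in> Ob \<and> (q, \<kappa>') \<in> Ob \<and> (p, f, q) \<in> Arr (slice C Z) \<and>
                 (\<forall>a \<beta>. opliftable C p a \<beta> \<longrightarrow> f \<rhd>\<^bsub>C\<^esub> \<kappa> a \<beta> = \<kappa>' (f \<cdot>\<^bsub>C\<^esub> a) \<beta>)}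
      in \<lparr>Obj = Ob,
          Arr = Ar,
          Cell = {(P, \<alpha>, Q). (P, src C \<alpha>, Q) \<in> Ar \<and> (P, tgt C \<alpha>, Q) \<in> Ar \<and>
                             (fst P, \<alpha>, fst Q) \<in> Cell (slice C Z)},
          dom1 = \<lambda>(P, f, Q). P,
          cod1 = \<lambda>(P, f, Q). Q,
          src = \<lambda>(P, \<alpha>, Q). (P, src C \<alpha>, Q),
          tgt = \<lambda>(P, \<alpha>, Q). (P, tgt C \<alpha>, Q),
          id1 = \<lambda>P. (P, id1 C (dom1 C (fst P)), P),
          id2 = \<lambda>(P, f, Q). (P, id2 C f, Q),
          comp1 = \<lambda>(Q, g, R) (P, f, Q'). (P, g \<cdot>\<^bsub>C\<^esub> f, R),
          vcomp = \<lambda>(P', \<beta>, Q') (P, \<alpha>, Q). (P, \<beta> \<bullet>\<^bsub>C\<^esub> \<alpha>, Q),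
          hcomp = \<lambda>(Q, \<beta>, R) (P, \<alpha>, Q'). (P, \<beta> \<star>\<^bsub>C\<^esub> \<alpha>, R)\<rparr>)"

definition forget_splitting ::
  "('a \<times> ('a \<Rightarrow> 'c \<Rightarrow> 'c),
    ('a \<times> ('a \<Rightarrow> 'c \<Rightarrow> 'c)) \<times> 'a \<times> ('a \<times> ('a \<Rightarrow> 'c \<Rightarrow> 'c)),
    ('a \<times> ('a \<Rightarrow> 'c \<Rightarrow> 'c)) \<times> 'c \<times> ('a \<times> ('a \<Rightarrow> 'c \<Rightarrow> 'c)),
    'a, 'a \<times> 'a \<times> 'a, 'a \<times> 'c \<times> 'a) two_fun" where
  "forget_splitting =
     \<lparr>map0 = fst,
      map1 = \<lambda>(P, f, Q). (fst P, f, fst Q),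
      map2 = \<lambda>(P, \<alpha>, Q). (fst P, \<alpha>, fst Q)\<rparr>"


section \<open>Opfamilial 2-functors\<close>

text \<open>In the following, \<open>I\<close> is the terminal object of the domain \<open>A\<close> of the 2-functor.\<close>

definition to_terminal :: "('o, 'a, 'c) two_cat \<Rightarrow> 'o \<Rightarrow> 'o \<Rightarrow> 'a" where
  "to_terminal A I X = (THE t. t \<in> hom1 A X I)"

definition slice_at_terminal ::
  "('o, 'a, 'c) two_cat \<Rightarrow> 'o \<Rightarrow> ('o, 'a, 'c, 'p, 'b, 'd) two_fun
    \<Rightarrow> ('o, 'a, 'c, 'b, 'b \<times> 'b \<times> 'b, 'b \<times> 'd \<times> 'b) two_fun" where
  "slice_at_terminal A I T =
     (let Tt = (\<lambda>X. map1 T (to_terminal A I X))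
      in \<lparr>map0 = Tt,
          map1 = \<lambda>f. (Tt (dom1 A f), map1 T f, Tt (cod1 A f)),
          map2 = \<lambda>\<alpha>. (Tt (dom1 A (src A \<alpha>)), map2 T \<alpha>, Tt (cod1 A (src A \<alpha>)))\<rparr>)"

definition local_right_adjoint ::
  "('o, 'a, 'c) two_cat \<Rightarrow> 'o \<Rightarrow> ('p, 'b, 'd) two_cat \<Rightarrow> ('o, 'a, 'c, 'p, 'b, 'd) two_fun \<Rightarrow> bool"
  where
  "local_right_adjoint A I B T \<longleftrightarrow>
     has_left_adjoint A (slice B (map0 T I)) (slice_at_terminal A I T)"

definition opfamilial ::
  "('o, 'a, 'c) two_cat \<Rightarrow> 'o \<Rightarrow> ('p, 'b, 'd) two_cat \<Rightarrow> ('o, 'a, 'c, 'p, 'b, 'd) two_fun \<Rightarrow> bool"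
  where
  "opfamilial A I B T \<longleftrightarrow> local_right_adjoint A I B T \<and>
     (\<exists>L. two_functor A (split_opfibrations B (map0 T I)) L \<and>
          two_fun_eq A (comp_two_fun forget_splitting L) (slice_at_terminal A I T))"


section \<open>Kan extensions and exactness\<close>

text \<open>
  \<open>left_kan C f g h \<psi>\<close>: the 2-cell \<open>\<psi> : g \<Rightarrow> h \<cdot> f\<close> exhibits \<open>h\<close> as a left Kan extension of \<open>g\<close>
  along \<open>f\<close>.
\<close>

definition left_kan :: "('o, 'a, 'c) two_cat \<Rightarrow> 'a \<Rightarrow> 'a \<Rightarrow> 'a \<Rightarrow> 'c \<Rightarrow> bool" where
  "left_kan C f g h \<psi> \<longleftrightarrow>
     (\<exists>X Y Z. f \<in> hom1 C X Y \<and> g \<in> hom1 C X Z \<and> h \<in> hom1 C Y Z \<and> \<psi> \<in> hom2 C g (h \<cdot>\<^bsub>C\<^esub> f) \<and>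
        (\<forall>k \<in> hom1 C Y Z.
           bij_betw (\<lambda>\<delta>. (\<delta> \<lhd>\<^bsub>C\<^esub> f) \<bullet>\<^bsub>C\<^esub> \<psi>) (hom2 C h k) (hom2 C g (k \<cdot>\<^bsub>C\<^esub> f))))"

definition pointwise_left_kan :: "('o, 'a, 'c) two_cat \<Rightarrow> 'a \<Rightarrow> 'a \<Rightarrow> 'a \<Rightarrow> 'c \<Rightarrow> bool" where
  "pointwise_left_kan C f g h \<psi> \<longleftrightarrow> left_kan C f g h \<psi> \<and>
     (\<forall>k p q \<theta>. comma_square C p q f k \<theta> \<longrightarrow>
        left_kan C q (g \<cdot>\<^bsub>C\<^esub> p) (h \<cdot>\<^bsub>C\<^esub> k) ((h \<rhd>\<^bsub>C\<^esub> \<theta>) \<bullet>\<^bsub>C\<^esub> (\<psi> \<lhd>\<^bsub>C\<^esub> p)))"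

definition exact_square :: "('o, 'a, 'c) two_cat \<Rightarrow> 'a \<Rightarrow> 'a \<Rightarrow> 'a \<Rightarrow> 'a \<Rightarrow> 'c \<Rightarrow> bool" where
  "exact_square C p q f g \<phi> \<longleftrightarrow> lax_square C p q f g \<phi> \<and>
     (\<forall>h l \<psi>. pointwise_left_kan C f h l \<psi> \<longrightarrow>
        pointwise_left_kan C q (h \<cdot>\<^bsub>C\<^esub> p) (l \<cdot>\<^bsub>C\<^esub> g) ((l \<rhd>\<^bsub>C\<^esub> \<phi>) \<bullet>\<^bsub>C\<^esub> (\<psi> \<lhd>\<^bsub>C\<^esub> p)))"

definition diexact ::
  "('o, 'a, 'c) two_cat \<Rightarrow> ('p, 'b, 'd) two_cat \<Rightarrow> ('o, 'a, 'c, 'p, 'b, 'd) two_fun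
    \<Rightarrow> ('o, 'a, 'c, 'p, 'b, 'd) two_fun \<Rightarrow> ('o \<Rightarrow> 'b) \<Rightarrow> bool" where
  "diexact A B S T \<phi> \<longleftrightarrow>
     (\<forall>X \<in> Obj A. \<forall>Y \<in> Obj A. \<forall>f \<in> hom1 A X Y.
        exact_square B (\<phi> X) (map1 S f) (map1 T f) (\<phi> Y) (id2 B (map1 T f \<cdot>\<^bsub>B\<^esub> \<phi> X)) \<and>
        exact_square B (map1 S f) (\<phi> X) (\<phi> Y) (map1 T f) (id2 B (\<phi> Y \<cdot>\<^bsub>B\<^esub> map1 S f)))"

end

theory Submission
  imports Defs
begin

text \<open>
  Two facts drive the proof: each \<open>T t\<^sub>X : T X \<rightarrow> T 1\<close> is an isofibration (a
  chosen opcartesian lift of an invertible 2-cell is invertible), and a 2-cell into the groupoidal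
  object \<open>T 1\<close> is invertible, hence can be lifted. By the pullback hypothesis for \<open>t\<^sub>X\<close> a 1-cell into
  \<open>S X\<close> is a pair of 1-cells into \<open>T X\<close> and \<open>S 1\<close> agreeing over \<open>T 1\<close>. So a 2-cell
  \<open>\<theta> : T f \<cdot> x \<Rightarrow> \<phi>\<^sub>Y \<cdot> y\<close>, in either direction, can be replaced by an isomorphism \<open>x \<cong> \<phi>\<^sub>X \<cdot> w\<close> and a 2-cell
  between \<open>S f \<cdot> w\<close> and \<open>y\<close>. For the universal invertible \<open>\<theta>\<close> this gives a pseudo-inverse of the
  comparison from \<open>S X\<close> to the isocomma object. For the universal \<open>\<theta>\<close> on a comma object of \<open>T f\<close> and
  \<open>\<phi>\<^sub>Y \<cdot> k\<close> (or of \<open>\<phi>\<^sub>Y\<close> and \<open>T f \<cdot> k\<close>) it gives a 1-cell back to the comma object of \<open>S f\<close> and \<open>k\<close> (of \<open>\<phi>\<^sub>X\<close> and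
  \<open>k\<close>), compatible with the projections to the domain of \<open>k\<close>, and pointwise left Kan extensions
  transfer along the comparison of comma objects.
\<close>

section \<open>Calculus of 2-cells\<close>

text \<open>Pushing \<open>\<theta>\<close> into the pullback leaves a 2-cell
  \<open>\<sigma>\<close> that need not be invertible, so the comparison \<open>v\<close> of comma
  objects need not be an equivalence. The 1-cell \<open>r\<close> back comes with
  \<open>n : 1 \<Rightarrow> v \<cdot> r\<close> and \<open>b : 1 \<Rightarrow> r \<cdot> v\<close>,
  both starting at an identity. If \<open>\<theta>\<close> starts at \<open>T f \<cdot> x\<close>,
  then \<open>n\<close> has components \<open>\<chi>\<close> and an identity, hence is invertible;
  if it ends there, \<open>n\<close> has \<open>\<sigma>\<close> as a component and offers no
  counit. What the two directions share is \<open>v \<rhd> b = n \<lhd> v\<close> and that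
  \<open>n\<close> becomes an identity over the domain of \<open>k\<close>. Restricting a left
  extension along \<open>v\<close> is therefore based on these two equations instead of an
  adjunction.

  A pointwise extension also contains a plain one, while the transfer speaks of extensions out of
  comma objects. The plain one is recovered from the comma object with an identity 1-cell, in which
  the original domain is coreflective.

  Completeness is given by conical limits and cotensors, so comma and isocomma objects have to be
  constructed.\<close>

context two_category
begin

text \<open>The axioms mention intermediate objects and 1-cells through \<open>hom1\<close> and
  \<open>hom2\<close>, which rewriting cannot guess. With carrier membership and equations between
  \<open>dom1\<close>, \<open>cod1\<close>, \<open>src\<close> and \<open>tgt\<close> as premises
  they become rewrite rules, whose conditions close from the typing facts that later proofs collect
  under \<open>ty\<close>.\<close>

lemma Arr_typing [simp]:
  "f \<in> Arr C \<Longrightarrow> dom1 C f \<in> Obj C" "f \<in> Arr C \<Longrightarrow> cod1 C f \<in> Obj C"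
  using dom1_cod1 by auto

lemma Cell_typing [simp]:
  "\<alpha> \<in> Cell C \<Longrightarrow> src C \<alpha> \<in> Arr C" "\<alpha> \<in> Cell C \<Longrightarrow> tgt C \<alpha> \<in> Arr C"
  "\<alpha> \<in> Cell C \<Longrightarrow> dom1 C (tgt C \<alpha>) = dom1 C (src C \<alpha>)"
  "\<alpha> \<in> Cell C \<Longrightarrow> cod1 C (tgt C \<alpha>) = cod1 C (src C \<alpha>)"
  using src_tgt parallel by auto

lemma id1_typing [simp]:
  assumes "X \<in> Obj C"
  shows "id1 C X \<in> Arr C" "dom1 C (id1 C X) = X" "cod1 C (id1 C X) = X"
  using id1_hom [OF assms] by (auto simp: hom1_def)

lemma comp1_typing [simp]:
  assumes "f \<in> Arr C" "g \<in> Arr C" "cod1 C f = dom1 C g"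
  shows "g \<cdot> f \<in> Arr C" "dom1 C (g \<cdot> f) = dom1 C f" "cod1 C (g \<cdot> f) = cod1 C g"
  using comp1_hom [of f "dom1 C f" "cod1 C f" g "cod1 C g"] assms by (auto simp: hom1_def)

lemma comp1_simps [simp]:
  "\<lbrakk>f \<in> Arr C; cod1 C f = Y\<rbrakk> \<Longrightarrow> id1 C Y \<cdot> f = f"
  "\<lbrakk>f \<in> Arr C; dom1 C f = X\<rbrakk> \<Longrightarrow> f \<cdot> id1 C X = f"
  "\<lbrakk>f \<in> Arr C; g \<in> Arr C; h \<in> Arr C; cod1 C f = dom1 C g; cod1 C g = dom1 C h\<rbrakk>
    \<Longrightarrow> (h \<cdot> g) \<cdot> f = h \<cdot> (g \<cdot> f)"
  using comp1_id_left comp1_id_right comp1_assoc by (auto simp: hom1_def)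

lemma id2_typing [simp]:
  assumes "f \<in> Arr C"
  shows "id2 C f \<in> Cell C" "src C (id2 C f) = f" "tgt C (id2 C f) = f"
  using id2_hom [OF assms] by (auto simp: hom2_def)

lemma vcomp_typing [simp]:
  assumes "\<alpha> \<in> Cell C" "\<beta> \<in> Cell C" "tgt C \<alpha> = src C \<beta>"
  shows "\<beta> \<bullet> \<alpha> \<in> Cell C" "src C (\<beta> \<bullet> \<alpha>) = src C \<alpha>" "tgt C (\<beta> \<bullet> \<alpha>) = tgt C \<beta>"
  using vcomp_hom [of \<alpha> "src C \<alpha>" "tgt C \<alpha>" \<beta> "tgt C \<beta>"] assms by (auto simp: hom2_def)

lemma vcomp_simps [simp]:
  "\<lbrakk>\<alpha> \<in> Cell C; tgt C \<alpha> = g\<rbrakk> \<Longrightarrow> id2 C g \<bullet> \<alpha> = \<alpha>"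
  "\<lbrakk>\<alpha> \<in> Cell C; src C \<alpha> = f\<rbrakk> \<Longrightarrow> \<alpha> \<bullet> id2 C f = \<alpha>"
  "\<lbrakk>\<alpha> \<in> Cell C; \<beta> \<in> Cell C; \<gamma> \<in> Cell C; tgt C \<alpha> = src C \<beta>; tgt C \<beta> = src C \<gamma>\<rbrakk>
    \<Longrightarrow> (\<gamma> \<bullet> \<beta>) \<bullet> \<alpha> = \<gamma> \<bullet> (\<beta> \<bullet> \<alpha>)"
  using vcomp_id_left vcomp_id_right vcomp_assoc by (auto simp: hom2_def)

lemma hcomp_typing [simp]:
  assumes "\<alpha> \<in> Cell C" "\<beta> \<in> Cell C" "cod1 C (src C \<alpha>) = dom1 C (src C \<beta>)"
  shows "\<beta> \<star> \<alpha> \<in> Cell C" "src C (\<beta> \<star> \<alpha>) = src C \<beta> \<cdot> src C \<alpha>" "tgt C (\<beta> \<star> \<alpha>) = tgt C \<beta> \<cdot> tgt C \<alpha>"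
  using hcomp_hom [of "src C \<alpha>" "dom1 C (src C \<alpha>)" "cod1 C (src C \<alpha>)" "src C \<beta>" "cod1 C (src C \<beta>)"
      \<alpha> "tgt C \<alpha>" \<beta> "tgt C \<beta>"] assms
  by (auto simp: hom1_def hom2_def)

lemma hcomp_assoc':
  "\<lbrakk>\<alpha> \<in> Cell C; \<beta> \<in> Cell C; \<gamma> \<in> Cell C; cod1 C (src C \<alpha>) = dom1 C (src C \<beta>);
    cod1 C (src C \<beta>) = dom1 C (src C \<gamma>)\<rbrakk> \<Longrightarrow> (\<gamma> \<star> \<beta>) \<star> \<alpha> = \<gamma> \<star> (\<beta> \<star> \<alpha>)"
  by (rule hcomp_assoc [of "src C \<alpha>" "dom1 C (src C \<alpha>)" _ "src C \<beta>" _ "src C \<gamma>"])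
    (auto simp: hom1_def hom2_def)

text \<open>
  The following rules rewrite a 2-cell to a vertical composite of cells of the form
  \<open>h\<^sub>1 \<rhd> \<dots> \<rhd> h\<^sub>n \<rhd> (\<alpha> \<lhd> k)\<close>.
\<close>

lemma whisker_simps [simp]:
  "\<lbrakk>f \<in> Arr C; g \<in> Arr C; cod1 C f = dom1 C g\<rbrakk> \<Longrightarrow> id2 C g \<star> id2 C f = id2 C (g \<cdot> f)"
  "\<lbrakk>\<alpha> \<in> Cell C; cod1 C (src C \<alpha>) = Y\<rbrakk> \<Longrightarrow> id1 C Y \<rhd> \<alpha> = \<alpha>"
  "\<lbrakk>\<alpha> \<in> Cell C; dom1 C (src C \<alpha>) = X\<rbrakk> \<Longrightarrow> \<alpha> \<lhd> id1 C X = \<alpha>"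
  "\<lbrakk>\<alpha> \<in> Cell C; g \<in> Arr C; h \<in> Arr C; cod1 C (src C \<alpha>) = dom1 C g; cod1 C g = dom1 C h\<rbrakk>
    \<Longrightarrow> (h \<cdot> g) \<rhd> \<alpha> = h \<rhd> (g \<rhd> \<alpha>)"
  "\<lbrakk>\<alpha> \<in> Cell C; f \<in> Arr C; g \<in> Arr C; cod1 C f = dom1 C g; cod1 C g = dom1 C (src C \<alpha>)\<rbrakk>
    \<Longrightarrow> (\<alpha> \<lhd> g) \<lhd> f = \<alpha> \<lhd> (g \<cdot> f)"
  "\<lbrakk>\<alpha> \<in> Cell C; f \<in> Arr C; g \<in> Arr C; cod1 C f = dom1 C (src C \<alpha>); cod1 C (src C \<alpha>) = dom1 C g\<rbrakk>
    \<Longrightarrow> (g \<rhd> \<alpha>) \<lhd> f = g \<rhd> (\<alpha> \<lhd> f)"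
  using hcomp_id2 hcomp_id_left [of "src C \<alpha>" "dom1 C (src C \<alpha>)" "cod1 C (src C \<alpha>)" \<alpha> "tgt C \<alpha>"]
    hcomp_id_right [of "src C \<alpha>" "dom1 C (src C \<alpha>)" "cod1 C (src C \<alpha>)" \<alpha> "tgt C \<alpha>"]
    hcomp_assoc' [of \<alpha> "id2 C g" "id2 C h"] hcomp_assoc' [of "id2 C f" "id2 C g" \<alpha>]
    hcomp_assoc' [of "id2 C f" \<alpha> "id2 C g"]
  by (auto simp: hom1_def hom2_def)

lemma interchange':
  "\<lbrakk>\<alpha> \<in> Cell C; \<alpha>' \<in> Cell C; \<beta> \<in> Cell C; \<beta>' \<in> Cell C; tgt C \<alpha> = src C \<alpha>'; tgt C \<beta> = src C \<beta>';
    cod1 C (src C \<alpha>) = dom1 C (src C \<beta>)\<rbrakk>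
    \<Longrightarrow> (\<beta>' \<bullet> \<beta>) \<star> (\<alpha>' \<bullet> \<alpha>) = (\<beta>' \<star> \<alpha>') \<bullet> (\<beta> \<star> \<alpha>)"
  by (rule interchange [of "src C \<alpha>" "dom1 C (src C \<alpha>)" _ "src C \<beta>"]) (auto simp: hom1_def hom2_def)

lemma whisker_vcomp [simp]:
  "\<lbrakk>\<alpha> \<in> Cell C; \<beta> \<in> Cell C; g \<in> Arr C; tgt C \<alpha> = src C \<beta>; cod1 C (src C \<alpha>) = dom1 C g\<rbrakk>
    \<Longrightarrow> g \<rhd> (\<beta> \<bullet> \<alpha>) = (g \<rhd> \<beta>) \<bullet> (g \<rhd> \<alpha>)"
  "\<lbrakk>\<alpha> \<in> Cell C; \<beta> \<in> Cell C; f \<in> Arr C; tgt C \<alpha> = src C \<beta>; cod1 C f = dom1 C (src C \<alpha>)\<rbrakk>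
    \<Longrightarrow> (\<beta> \<bullet> \<alpha>) \<lhd> f = (\<beta> \<lhd> f) \<bullet> (\<alpha> \<lhd> f)"
  using interchange' [of \<alpha> \<beta> "id2 C g" "id2 C g"] interchange' [of "id2 C f" "id2 C f" \<alpha> \<beta>] by auto

text \<open>Both sides are the horizontal composite \<open>\<beta> \<star> \<alpha>\<close>,
  expanded by interchange with identities. Later it serves as naturality of \<open>\<beta>\<close>
  with respect to \<open>\<alpha>\<close>.\<close>

lemma whisker_exchange:
  assumes "\<alpha> \<in> Cell C" "\<beta> \<in> Cell C" "cod1 C (src C \<alpha>) = dom1 C (src C \<beta>)"
  shows "(\<beta> \<lhd> tgt C \<alpha>) \<bullet> (src C \<beta> \<rhd> \<alpha>) = (tgt C \<beta> \<rhd> \<alpha>) \<bullet> (\<beta> \<lhd> src C \<alpha>)"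
  using interchange' [of \<alpha> "id2 C (tgt C \<alpha>)" "id2 C (src C \<beta>)" \<beta>]
    interchange' [of "id2 C (src C \<alpha>)" \<alpha> \<beta> "id2 C (tgt C \<beta>)"] assms
  by auto

lemma hom1D: assumes "f \<in> hom1 C X Y"
  shows "f \<in> Arr C" "dom1 C f = X" "cod1 C f = Y" "X \<in> Obj C" "Y \<in> Obj C"
  using assms dom1_cod1 by (auto simp: hom1_def)

lemma hom2D: assumes "\<alpha> \<in> hom2 C f g"
  shows "\<alpha> \<in> Cell C" "src C \<alpha> = f" "tgt C \<alpha> = g"
  using assms by (auto simp: hom2_def)


lemma hom2_iff: "\<alpha> \<in> hom2 C f g \<longleftrightarrow> \<alpha> \<in> Cell C \<and> src C \<alpha> = f \<and> tgt C \<alpha> = g"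
  by (auto simp: hom2_def)

lemma hom1_iff: "f \<in> hom1 C X Y \<longleftrightarrow> f \<in> Arr C \<and> dom1 C f = X \<and> cod1 C f = Y"
  by (auto simp: hom1_def)

text \<open>Composites are normalised to the right, where an equation
  \<open>h \<cdot> g = h' \<cdot> g'\<close> no longer matches. The extra factor \<open>f\<close>
  restores its use; that \<open>g\<close> and \<open>g'\<close> have the same domain is read off
  from the equation itself.\<close>

lemma comp1_eq_assoc:
  assumes "h \<cdot> g = h' \<cdot> g'" "h \<in> Arr C" "g \<in> Arr C" "cod1 C g = dom1 C h"
    "h' \<in> Arr C" "g' \<in> Arr C" "cod1 C g' = dom1 C h'" "f \<in> Arr C" "cod1 C f = dom1 C g"
  shows "h \<cdot> (g \<cdot> f) = h' \<cdot> (g' \<cdot> f)"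
proof -
  have "dom1 C g = dom1 C (h \<cdot> g)" using assms(2-4) by simp
  also have "\<dots> = dom1 C g'" unfolding assms(1) using assms(5-7) by simp
  finally have "dom1 C g = dom1 C g'" .
  then have "(h' \<cdot> g') \<cdot> f = h' \<cdot> (g' \<cdot> f)"
    using assms(2-) by simp
  moreover have "(h \<cdot> g) \<cdot> f = h \<cdot> (g \<cdot> f)"
    using assms(2-) by simp
  ultimately show ?thesis by (simp only: assms(1))
qed

lemma whisker_eq_assoc:
  assumes "h \<cdot> g = h' \<cdot> g'" "h \<in> Arr C" "g \<in> Arr C" "cod1 C g = dom1 C h"
    "h' \<in> Arr C" "g' \<in> Arr C" "cod1 C g' = dom1 C h'" "\<alpha> \<in> Cell C" "cod1 C (src C \<alpha>) = dom1 C g"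
  shows "h \<rhd> (g \<rhd> \<alpha>) = h' \<rhd> (g' \<rhd> \<alpha>)"
proof -
  have "dom1 C g = dom1 C (h \<cdot> g)" using assms(2-4) by simp
  also have "\<dots> = dom1 C g'" unfolding assms(1) using assms(5-7) by simp
  finally have "dom1 C g = dom1 C g'" .
  then have "(h' \<cdot> g') \<rhd> \<alpha> = h' \<rhd> (g' \<rhd> \<alpha>)"
    using assms(2-) by simp
  moreover have "(h \<cdot> g) \<rhd> \<alpha> = h \<rhd> (g \<rhd> \<alpha>)"
    using assms(2-) by simp
  ultimately show ?thesis by (simp only: assms(1))
qed

lemma comp1_eqD:
  assumes "h \<cdot> g = k" "h \<in> Arr C" "g \<in> Arr C" "cod1 C g = dom1 C h"
  shows "\<lbrakk>f \<in> Arr C; cod1 C f = dom1 C g\<rbrakk> \<Longrightarrow> h \<cdot> (g \<cdot> f) = k \<cdot> f"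
    and "\<lbrakk>\<alpha> \<in> Cell C; cod1 C (src C \<alpha>) = dom1 C g\<rbrakk> \<Longrightarrow> h \<rhd> (g \<rhd> \<alpha>) = k \<rhd> \<alpha>"
  using assms(2-) by (simp_all flip: assms(1))

lemma whisker_right_eqD:
  assumes "\<alpha> \<lhd> g = \<beta>" "\<alpha> \<in> Cell C" "g \<in> Arr C" "cod1 C g = dom1 C (src C \<alpha>)"
  shows "\<lbrakk>f \<in> Arr C; cod1 C f = dom1 C g\<rbrakk> \<Longrightarrow> \<alpha> \<lhd> (g \<cdot> f) = \<beta> \<lhd> f"
  using assms(2-) by (simp flip: assms(1))

text \<open>Compose \<open>\<beta> \<bullet> a = b \<bullet> \<alpha>\<close> with \<open>b'\<close>
  on the left and \<open>a'\<close> on the right. This carries the compatibility conditions of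
  universal squares over to inverse cells.\<close>

lemma inverse_square:
  assumes "a \<in> hom2 C s t" "a' \<in> hom2 C t s" "b \<in> hom2 C s' t'" "b' \<in> hom2 C t' s'"
    "\<alpha> \<in> hom2 C s s'" "\<beta> \<in> hom2 C t t'" "a \<bullet> a' = id2 C t" "b' \<bullet> b = id2 C s'"
    and eq: "\<beta> \<bullet> a = b \<bullet> \<alpha>"
  shows "\<alpha> \<bullet> a' = b' \<bullet> \<beta>"
proof -
  note ty = assms(1-6) [THEN hom2D(1)] assms(1-6) [THEN hom2D(2)] assms(1-6) [THEN hom2D(3)]
  have "\<alpha> \<bullet> a' = (b' \<bullet> b) \<bullet> (\<alpha> \<bullet> a')" using ty assms(8) by simp
  also have "\<dots> = b' \<bullet> ((b \<bullet> \<alpha>) \<bullet> a')" using ty by simp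
  also have "\<dots> = b' \<bullet> (\<beta> \<bullet> (a \<bullet> a'))" unfolding eq [symmetric] using ty by simp
  also have "\<dots> = b' \<bullet> \<beta>" using ty assms(7) by simp
  finally show ?thesis .
qed

section \<open>Invertible 2-cells\<close>

lemma invertible2I:
  assumes "\<alpha> \<in> hom2 C f g" "\<alpha>' \<in> hom2 C g f" "\<alpha>' \<bullet> \<alpha> = id2 C f" "\<alpha> \<bullet> \<alpha>' = id2 C g"
  shows "invertible2 C \<alpha>"
  unfolding invertible2_def using assms by (auto simp: hom2_def)

lemma invertible2E:
  assumes "invertible2 C \<alpha>" "\<alpha> \<in> hom2 C f g"
  obtains \<alpha>' where "\<alpha>' \<in> hom2 C g f" "\<alpha>' \<bullet> \<alpha> = id2 C f" "\<alpha> \<bullet> \<alpha>' = id2 C g"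
  using assms unfolding invertible2_def by (auto simp: hom2_def)

lemma invertible2_id2: "f \<in> Arr C \<Longrightarrow> invertible2 C (id2 C f)"
  by (rule invertible2I [of _ f f "id2 C f"]) (simp_all add: hom2_iff)

lemma invertible2_vcomp:
  assumes \<alpha>: "\<alpha> \<in> hom2 C f g" "invertible2 C \<alpha>" and \<beta>: "\<beta> \<in> hom2 C g h" "invertible2 C \<beta>"
  shows "invertible2 C (\<beta> \<bullet> \<alpha>)"
proof -
  obtain \<alpha>' where \<alpha>': "\<alpha>' \<in> hom2 C g f" "\<alpha>' \<bullet> \<alpha> = id2 C f" "\<alpha> \<bullet> \<alpha>' = id2 C g"
    using invertible2E [OF \<alpha>(2,1)] .
  obtain \<beta>' where \<beta>': "\<beta>' \<in> hom2 C h g" "\<beta>' \<bullet> \<beta> = id2 C g" "\<beta> \<bullet> \<beta>' = id2 C h"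
    using invertible2E [OF \<beta>(2,1)] .
  note ty = hom2D [OF \<alpha>(1)] hom2D [OF \<beta>(1)] hom2D [OF \<alpha>'(1)] hom2D [OF \<beta>'(1)]
  have "(\<alpha>' \<bullet> \<beta>') \<bullet> (\<beta> \<bullet> \<alpha>) = \<alpha>' \<bullet> ((\<beta>' \<bullet> \<beta>) \<bullet> \<alpha>)" using ty by simp
  moreover have "(\<beta> \<bullet> \<alpha>) \<bullet> (\<alpha>' \<bullet> \<beta>') = \<beta> \<bullet> ((\<alpha> \<bullet> \<alpha>') \<bullet> \<beta>')" using ty by simp
  ultimately show ?thesis
    by (intro invertible2I [of "\<beta> \<bullet> \<alpha>" f h "\<alpha>' \<bullet> \<beta>'"]) (simp_all add: hom2_iff ty \<alpha>' \<beta>')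
qed

lemma invertible2_whisker_left:
  assumes \<alpha>: "\<alpha> \<in> hom2 C f f'" "invertible2 C \<alpha>" and f: "f \<in> hom1 C X Y" and h: "h \<in> hom1 C Y Z"
  shows "invertible2 C (h \<rhd> \<alpha>)"
proof -
  obtain \<alpha>' where \<alpha>': "\<alpha>' \<in> hom2 C f' f" "\<alpha>' \<bullet> \<alpha> = id2 C f" "\<alpha> \<bullet> \<alpha>' = id2 C f'"
    using invertible2E [OF \<alpha>(2,1)] .
  note ty = hom2D [OF \<alpha>(1)] hom2D [OF \<alpha>'(1)] hom1D [OF f] hom1D [OF h] Cell_typing [OF hom2D(1) [OF \<alpha>(1)]]
  show ?thesis
    \<comment> \<open>Reversing \<open>whisker_vcomp\<close> collects two whiskerings into a
      whiskering of one vertical composite, which the inverse equations then reduce.\<close>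
    by (rule invertible2I [of _ "h \<cdot> f" "h \<cdot> f'" "h \<rhd> \<alpha>'"])
      (use ty in \<open>simp_all add: hom2_iff \<alpha>' flip: whisker_vcomp\<close>)
qed

lemma invertible2_whisker_right:
  assumes \<alpha>: "\<alpha> \<in> hom2 C f f'" "invertible2 C \<alpha>" and f: "f \<in> hom1 C X Y" and k: "k \<in> hom1 C W X"
  shows "invertible2 C (\<alpha> \<lhd> k)"
proof -
  obtain \<alpha>' where \<alpha>': "\<alpha>' \<in> hom2 C f' f" "\<alpha>' \<bullet> \<alpha> = id2 C f" "\<alpha> \<bullet> \<alpha>' = id2 C f'"
    using invertible2E [OF \<alpha>(2,1)] .
  note ty = hom2D [OF \<alpha>(1)] hom2D [OF \<alpha>'(1)] hom1D [OF f] hom1D [OF k] Cell_typing [OF hom2D(1) [OF \<alpha>(1)]]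
  show ?thesis
    by (rule invertible2I [of _ "f \<cdot> k" "f' \<cdot> k" "\<alpha>' \<lhd> k"])
      (use ty in \<open>simp_all add: hom2_iff \<alpha>' flip: whisker_vcomp\<close>)
qed


section \<open>Comma and isocomma objects, pullbacks\<close>

text \<open>The objects bound in \<open>lax_square\<close> are determined by \<open>f\<close> and
  \<open>g\<close>, except for the apex. Fixing them once avoids identifying hidden objects in every
  use.\<close>

lemma lax_square_iff:
  assumes "f \<in> hom1 C X Z" "g \<in> hom1 C Y Z"
  shows "lax_square C p q f g \<phi> \<longleftrightarrow>
    (\<exists>P. p \<in> hom1 C P X \<and> q \<in> hom1 C P Y \<and> \<phi> \<in> hom2 C (f \<cdot> p) (g \<cdot> q))"
proof
  assume "lax_square C p q f g \<phi>"
  then obtain P X' Y' Z' where "p \<in> hom1 C P X'" "q \<in> hom1 C P Y'" "f \<in> hom1 C X' Z'"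
    "g \<in> hom1 C Y' Z'" "\<phi> \<in> hom2 C (f \<cdot> p) (g \<cdot> q)"
    unfolding lax_square_def by blast
  moreover from this have "X' = X" "Y' = Y" using assms by (simp_all add: hom1_iff)
  ultimately show "\<exists>P. p \<in> hom1 C P X \<and> q \<in> hom1 C P Y \<and> \<phi> \<in> hom2 C (f \<cdot> p) (g \<cdot> q)"
    by blast
next
  assume "\<exists>P. p \<in> hom1 C P X \<and> q \<in> hom1 C P Y \<and> \<phi> \<in> hom2 C (f \<cdot> p) (g \<cdot> q)"
  then show "lax_square C p q f g \<phi>"
    unfolding lax_square_def using assms by blast
qed

text \<open>The two unique existence clauses are split: uniqueness becomes joint cancellability of
  the projections and \<open>\<theta>\<close> on 1-cells, and joint faithfulness of the projections
  on 2-cells.\<close>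

lemma universal_squareI:
  assumes f: "f \<in> hom1 C X Z" and g: "g \<in> hom1 C Y Z"
    and p: "p \<in> hom1 C P X" and q: "q \<in> hom1 C P Y" and \<theta>: "\<theta> \<in> hom2 C (f \<cdot> p) (g \<cdot> q)" and Q: "Q \<theta>"
    and factor: "\<And>W x y \<psi>. \<lbrakk>x \<in> hom1 C W X; y \<in> hom1 C W Y; \<psi> \<in> hom2 C (f \<cdot> x) (g \<cdot> y); Q \<psi>\<rbrakk>
      \<Longrightarrow> \<exists>u. u \<in> hom1 C W P \<and> p \<cdot> u = x \<and> q \<cdot> u = y \<and> \<theta> \<lhd> u = \<psi>"
    and factor_unique: "\<And>W u v. \<lbrakk>u \<in> hom1 C W P; v \<in> hom1 C W P; p \<cdot> u = p \<cdot> v; q \<cdot> u = q \<cdot> v;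
        \<theta> \<lhd> u = \<theta> \<lhd> v\<rbrakk> \<Longrightarrow> u = v"
    and cell: "\<And>W u v \<alpha> \<beta>. \<lbrakk>u \<in> hom1 C W P; v \<in> hom1 C W P; \<alpha> \<in> hom2 C (p \<cdot> u) (p \<cdot> v);
        \<beta> \<in> hom2 C (q \<cdot> u) (q \<cdot> v); (g \<rhd> \<beta>) \<bullet> (\<theta> \<lhd> u) = (\<theta> \<lhd> v) \<bullet> (f \<rhd> \<alpha>)\<rbrakk>
      \<Longrightarrow> \<exists>\<gamma>. \<gamma> \<in> hom2 C u v \<and> p \<rhd> \<gamma> = \<alpha> \<and> q \<rhd> \<gamma> = \<beta>"
    and cell_unique: "\<And>W u v \<gamma> \<delta>. \<lbrakk>u \<in> hom1 C W P; v \<in> hom1 C W P; \<gamma> \<in> hom2 C u v; \<delta> \<in> hom2 C u v;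
        p \<rhd> \<gamma> = p \<rhd> \<delta>; q \<rhd> \<gamma> = q \<rhd> \<delta>\<rbrakk> \<Longrightarrow> \<gamma> = \<delta>"
  shows "universal_square Q C p q f g \<theta>"
proof -
  have P: "dom1 C p = P" using p by (simp add: hom1_def)
  show ?thesis
    unfolding universal_square_def lax_square_iff [OF f g] P
  proof (intro conjI allI impI ballI)
    show "\<exists>P. p \<in> hom1 C P X \<and> q \<in> hom1 C P Y \<and> \<theta> \<in> hom2 C (f \<cdot> p) (g \<cdot> q)" "Q \<theta>"
      using p q \<theta> Q by auto
  next
    fix x y \<psi>
    assume "(\<exists>P. x \<in> hom1 C P X \<and> y \<in> hom1 C P Y \<and> \<psi> \<in> hom2 C (f \<cdot> x) (g \<cdot> y)) \<and> Q \<psi>"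
    then obtain W where W: "x \<in> hom1 C W X" "y \<in> hom1 C W Y" "\<psi> \<in> hom2 C (f \<cdot> x) (g \<cdot> y)" "Q \<psi>"
      by blast
    then have "dom1 C x = W" by (simp add: hom1_def)
    then show "\<exists>!u. u \<in> hom1 C (dom1 C x) P \<and> p \<cdot> u = x \<and> q \<cdot> u = y \<and> \<theta> \<lhd> u = \<psi>"
      using factor [OF W] by (auto intro: factor_unique)
  next
    fix W u v \<alpha> \<beta>
    assume "u \<in> hom1 C W P" "v \<in> hom1 C W P" "\<alpha> \<in> hom2 C (p \<cdot> u) (p \<cdot> v)"
        "\<beta> \<in> hom2 C (q \<cdot> u) (q \<cdot> v)" "(g \<rhd> \<beta>) \<bullet> (\<theta> \<lhd> u) = (\<theta> \<lhd> v) \<bullet> (f \<rhd> \<alpha>)"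
    then show "\<exists>!\<gamma>. \<gamma> \<in> hom2 C u v \<and> p \<rhd> \<gamma> = \<alpha> \<and> q \<rhd> \<gamma> = \<beta>"
      using cell [of u W v \<alpha> \<beta>] by (auto intro: cell_unique)
  qed
qed

text \<open>The premise \<open>Q (\<theta> \<lhd> v)\<close> of the cancellation rule is there
  because the universal property only speaks of lax squares satisfying \<open>Q\<close>, and the one
  it is applied to is the square presented by \<open>v\<close>.\<close>

lemma
  assumes us: "universal_square Q C p q f g \<theta>"
    and f: "f \<in> hom1 C X Z" and g: "g \<in> hom1 C Y Z" and p: "p \<in> hom1 C P X"
  shows universal_square_q: "q \<in> hom1 C P Y"
    and universal_square_cell: "\<theta> \<in> hom2 C (f \<cdot> p) (g \<cdot> q)"
    and universal_square_Q: "Q \<theta>"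
    and universal_square_factor: "\<And>W x y \<psi>. \<lbrakk>x \<in> hom1 C W X; y \<in> hom1 C W Y;
        \<psi> \<in> hom2 C (f \<cdot> x) (g \<cdot> y); Q \<psi>\<rbrakk>
      \<Longrightarrow> \<exists>u \<in> hom1 C W P. p \<cdot> u = x \<and> q \<cdot> u = y \<and> \<theta> \<lhd> u = \<psi>"
    and universal_square_factor_unique: "\<And>W u v. \<lbrakk>u \<in> hom1 C W P; v \<in> hom1 C W P;
        p \<cdot> u = p \<cdot> v; q \<cdot> u = q \<cdot> v; \<theta> \<lhd> u = \<theta> \<lhd> v; Q (\<theta> \<lhd> v)\<rbrakk> \<Longrightarrow> u = v"
    and universal_square_lift2: "\<And>W u v \<alpha> \<beta>. \<lbrakk>u \<in> hom1 C W P; v \<in> hom1 C W P;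
        \<alpha> \<in> hom2 C (p \<cdot> u) (p \<cdot> v); \<beta> \<in> hom2 C (q \<cdot> u) (q \<cdot> v);
        (g \<rhd> \<beta>) \<bullet> (\<theta> \<lhd> u) = (\<theta> \<lhd> v) \<bullet> (f \<rhd> \<alpha>)\<rbrakk>
      \<Longrightarrow> \<exists>\<gamma> \<in> hom2 C u v. p \<rhd> \<gamma> = \<alpha> \<and> q \<rhd> \<gamma> = \<beta>"
    and universal_square_cell_eq: "\<And>W u v \<gamma> \<delta>. \<lbrakk>u \<in> hom1 C W P; v \<in> hom1 C W P;
        \<gamma> \<in> hom2 C u v; \<delta> \<in> hom2 C u v; p \<rhd> \<gamma> = p \<rhd> \<delta>; q \<rhd> \<gamma> = q \<rhd> \<delta>\<rbrakk> \<Longrightarrow> \<gamma> = \<delta>"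
proof -
  have P: "dom1 C p = P" using p by (simp add: hom1_def)
  from us obtain P' where "p \<in> hom1 C P' X" and q': "q \<in> hom1 C P' Y" and \<theta>: "\<theta> \<in> hom2 C (f \<cdot> p) (g \<cdot> q)"
    and Q: "Q \<theta>"
    unfolding universal_square_def lax_square_iff [OF f g] by blast
  with P have q: "q \<in> hom1 C P Y" by (auto simp: hom1_def)
  have fac: "\<And>x y \<psi>. lax_square C x y f g \<psi> \<Longrightarrow> Q \<psi> \<Longrightarrow>
        (\<exists>!u. u \<in> hom1 C (dom1 C x) P \<and> p \<cdot> u = x \<and> q \<cdot> u = y \<and> \<theta> \<lhd> u = \<psi>)"
    and two: "\<And>W u v \<alpha> \<beta>. \<lbrakk>u \<in> hom1 C W P; v \<in> hom1 C W P;
        \<alpha> \<in> hom2 C (p \<cdot> u) (p \<cdot> v); \<beta> \<in> hom2 C (q \<cdot> u) (q \<cdot> v);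
        (g \<rhd> \<beta>) \<bullet> (\<theta> \<lhd> u) = (\<theta> \<lhd> v) \<bullet> (f \<rhd> \<alpha>)\<rbrakk>
      \<Longrightarrow> \<exists>!\<gamma>. \<gamma> \<in> hom2 C u v \<and> p \<rhd> \<gamma> = \<alpha> \<and> q \<rhd> \<gamma> = \<beta>"
    using us hom1D(4) unfolding universal_square_def P by blast+
  show "q \<in> hom1 C P Y" "\<theta> \<in> hom2 C (f \<cdot> p) (g \<cdot> q)" "Q \<theta>" by fact+
  show "\<exists>u \<in> hom1 C W P. p \<cdot> u = x \<and> q \<cdot> u = y \<and> \<theta> \<lhd> u = \<psi>"
    if "x \<in> hom1 C W X" "y \<in> hom1 C W Y" "\<psi> \<in> hom2 C (f \<cdot> x) (g \<cdot> y)" "Q \<psi>" for W x y \<psi>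
  proof -
    have "lax_square C x y f g \<psi>" using that lax_square_iff [OF f g] by blast
    from fac [OF this that(4)] show ?thesis using hom1D(2) [OF that(1)] by auto
  qed
  note ty = hom1D [OF f] hom1D [OF g] hom1D [OF p] hom1D [OF q] hom2D [OF \<theta>]
  show "u = v" if "u \<in> hom1 C W P" "v \<in> hom1 C W P"
        "p \<cdot> u = p \<cdot> v" "q \<cdot> u = q \<cdot> v" "\<theta> \<lhd> u = \<theta> \<lhd> v" "Q (\<theta> \<lhd> v)" for W u v
  proof -
    note ty' = ty hom1D [OF that(1)] hom1D [OF that(2)]
    have "lax_square C (p \<cdot> v) (q \<cdot> v) f g (\<theta> \<lhd> v)"
      unfolding lax_square_iff [OF f g]
      by (intro exI [of _ W]) (auto simp: hom1_iff hom2_iff ty')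
    from fac [OF this that(6)] show ?thesis using that by (auto simp: ty')
  qed
  show "\<exists>\<gamma> \<in> hom2 C u v. p \<rhd> \<gamma> = \<alpha> \<and> q \<rhd> \<gamma> = \<beta>"
    if "u \<in> hom1 C W P" "v \<in> hom1 C W P"
        "\<alpha> \<in> hom2 C (p \<cdot> u) (p \<cdot> v)" "\<beta> \<in> hom2 C (q \<cdot> u) (q \<cdot> v)"
        "(g \<rhd> \<beta>) \<bullet> (\<theta> \<lhd> u) = (\<theta> \<lhd> v) \<bullet> (f \<rhd> \<alpha>)" for W u v \<alpha> \<beta>
    using two [OF that] by blast
  show "\<gamma> = \<delta>" if "u \<in> hom1 C W P" "v \<in> hom1 C W P"
        "\<gamma> \<in> hom2 C u v" "\<delta> \<in> hom2 C u v" "p \<rhd> \<gamma> = p \<rhd> \<delta>" "q \<rhd> \<gamma> = q \<rhd> \<delta>" for W u v \<gamma> \<delta>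
  proof -
    note ty' = ty hom1D [OF that(1)] hom1D [OF that(2)] hom2D [OF that(4)]
    have "\<exists>!\<gamma>. \<gamma> \<in> hom2 C u v \<and> p \<rhd> \<gamma> = p \<rhd> \<delta> \<and> q \<rhd> \<gamma> = q \<rhd> \<delta>"
    proof (rule two [OF that(1,2)])
      \<comment> \<open>The exchange law makes the whiskerings of \<open>\<delta>\<close> a
        compatible pair, so their unique lift is both \<open>\<gamma>\<close> and
        \<open>\<delta>\<close>.\<close>
      show "(g \<rhd> (q \<rhd> \<delta>)) \<bullet> (\<theta> \<lhd> u) = (\<theta> \<lhd> v) \<bullet> (f \<rhd> (p \<rhd> \<delta>))"
        using whisker_exchange [of \<delta> \<theta>] by (simp add: ty')
    qed (auto simp: hom2_iff ty')
    then show ?thesis using that by blast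
  qed
qed

section \<open>Cotensors with the arrow category and conical limits\<close>

lemma
  assumes ac: "arrow_cotensor C X P p q \<theta>"
  shows arrow_cotensor_typing: "p \<in> hom1 C P X" "q \<in> hom1 C P X" "\<theta> \<in> hom2 C p q"
    and arrow_cotensor_factor: "\<And>W x y \<psi>. \<lbrakk>x \<in> hom1 C W X; y \<in> hom1 C W X; \<psi> \<in> hom2 C x y\<rbrakk>
      \<Longrightarrow> \<exists>u \<in> hom1 C W P. p \<cdot> u = x \<and> q \<cdot> u = y \<and> \<theta> \<lhd> u = \<psi>"
    and arrow_cotensor_factor_unique: "\<And>W u v. \<lbrakk>u \<in> hom1 C W P; v \<in> hom1 C W P;
        p \<cdot> u = p \<cdot> v; q \<cdot> u = q \<cdot> v; \<theta> \<lhd> u = \<theta> \<lhd> v\<rbrakk> \<Longrightarrow> u = v"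
    and arrow_cotensor_lift2: "\<And>W u v \<alpha> \<beta>. \<lbrakk>u \<in> hom1 C W P; v \<in> hom1 C W P;
        \<alpha> \<in> hom2 C (p \<cdot> u) (p \<cdot> v); \<beta> \<in> hom2 C (q \<cdot> u) (q \<cdot> v);
        \<beta> \<bullet> (\<theta> \<lhd> u) = (\<theta> \<lhd> v) \<bullet> \<alpha>\<rbrakk>
      \<Longrightarrow> \<exists>\<gamma> \<in> hom2 C u v. p \<rhd> \<gamma> = \<alpha> \<and> q \<rhd> \<gamma> = \<beta>"
    and arrow_cotensor_cell_eq: "\<And>W u v \<gamma> \<delta>. \<lbrakk>u \<in> hom1 C W P; v \<in> hom1 C W P;
        \<gamma> \<in> hom2 C u v; \<delta> \<in> hom2 C u v; p \<rhd> \<gamma> = p \<rhd> \<delta>; q \<rhd> \<gamma> = q \<rhd> \<delta>\<rbrakk> \<Longrightarrow> \<gamma> = \<delta>"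
proof -
  show p: "p \<in> hom1 C P X" and q: "q \<in> hom1 C P X" and \<theta>: "\<theta> \<in> hom2 C p q"
    using ac unfolding arrow_cotensor_def by auto
  note ty = hom1D [OF p] hom1D [OF q] hom2D [OF \<theta>]
  have fac: "\<exists>!u. u \<in> hom1 C W P \<and> p \<cdot> u = x \<and> q \<cdot> u = y \<and> \<theta> \<lhd> u = \<psi>"
    if "x \<in> hom1 C W X" "y \<in> hom1 C W X" "\<psi> \<in> hom2 C x y" for W x y \<psi>
    using ac that hom1D(4) [OF that(1)] unfolding arrow_cotensor_def by blast
  have two: "\<exists>!\<gamma>. \<gamma> \<in> hom2 C u v \<and> p \<rhd> \<gamma> = \<alpha> \<and> q \<rhd> \<gamma> = \<beta>"
    if "u \<in> hom1 C W P" "v \<in> hom1 C W P" "\<alpha> \<in> hom2 C (p \<cdot> u) (p \<cdot> v)"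
      "\<beta> \<in> hom2 C (q \<cdot> u) (q \<cdot> v)" "\<beta> \<bullet> (\<theta> \<lhd> u) = (\<theta> \<lhd> v) \<bullet> \<alpha>" for W u v \<alpha> \<beta>
    using ac that hom1D(4) [OF that(1)] unfolding arrow_cotensor_def by blast
  show "\<exists>u \<in> hom1 C W P. p \<cdot> u = x \<and> q \<cdot> u = y \<and> \<theta> \<lhd> u = \<psi>"
    if "x \<in> hom1 C W X" "y \<in> hom1 C W X" "\<psi> \<in> hom2 C x y" for W x y \<psi>
    using fac [OF that] by blast
  show "\<exists>\<gamma> \<in> hom2 C u v. p \<rhd> \<gamma> = \<alpha> \<and> q \<rhd> \<gamma> = \<beta>"
    if "u \<in> hom1 C W P" "v \<in> hom1 C W P" "\<alpha> \<in> hom2 C (p \<cdot> u) (p \<cdot> v)"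
      "\<beta> \<in> hom2 C (q \<cdot> u) (q \<cdot> v)" "\<beta> \<bullet> (\<theta> \<lhd> u) = (\<theta> \<lhd> v) \<bullet> \<alpha>" for W u v \<alpha> \<beta>
    using two [OF that] by blast
  show "u = v" if "u \<in> hom1 C W P" "v \<in> hom1 C W P" "p \<cdot> u = p \<cdot> v" "q \<cdot> u = q \<cdot> v"
    "\<theta> \<lhd> u = \<theta> \<lhd> v" for W u v
  proof -
    have "\<exists>!w. w \<in> hom1 C W P \<and> p \<cdot> w = p \<cdot> v \<and> q \<cdot> w = q \<cdot> v \<and> \<theta> \<lhd> w = \<theta> \<lhd> v"
      by (rule fac) (auto simp: hom1_iff hom2_iff ty hom1D [OF that(2)])
    then show ?thesis using that by blast
  qed
  show "\<gamma> = \<delta>" if "u \<in> hom1 C W P" "v \<in> hom1 C W P" "\<gamma> \<in> hom2 C u v" "\<delta> \<in> hom2 C u v"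
      "p \<rhd> \<gamma> = p \<rhd> \<delta>" "q \<rhd> \<gamma> = q \<rhd> \<delta>" for W u v \<gamma> \<delta>
  proof -
    note ty' = ty hom1D [OF that(1)] hom1D [OF that(2)] hom2D [OF that(4)]
    have "\<exists>!\<gamma>. \<gamma> \<in> hom2 C u v \<and> p \<rhd> \<gamma> = p \<rhd> \<delta> \<and> q \<rhd> \<gamma> = q \<rhd> \<delta>"
    proof (rule two [OF that(1,2)])
      show "(q \<rhd> \<delta>) \<bullet> (\<theta> \<lhd> u) = (\<theta> \<lhd> v) \<bullet> (p \<rhd> \<delta>)"
        using whisker_exchange [of \<delta> \<theta>] by (simp add: ty')
    qed (auto simp: hom2_iff ty')
    then show ?thesis using that by blast
  qed
qed

lemma
  assumes lim: "conical_limit C V D E P \<pi>"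
  shows conical_limit_cone: "cone C V D E P \<pi>"
    and conical_limit_factor: "\<And>W x. cone C V D E W x \<Longrightarrow> \<exists>u \<in> hom1 C W P. \<forall>i \<in> V. \<pi> i \<cdot> u = x i"
    and conical_limit_factor_unique: "\<And>W u v. \<lbrakk>u \<in> hom1 C W P; v \<in> hom1 C W P;
        cone C V D E W (\<lambda>i. \<pi> i \<cdot> v); \<forall>i \<in> V. \<pi> i \<cdot> u = \<pi> i \<cdot> v\<rbrakk> \<Longrightarrow> u = v"
    and conical_limit_lift2: "\<And>W u v \<Theta>. \<lbrakk>u \<in> hom1 C W P; v \<in> hom1 C W P;
        \<forall>i \<in> V. \<Theta> i \<in> hom2 C (\<pi> i \<cdot> u) (\<pi> i \<cdot> v); \<forall>(i, f, j) \<in> E. f \<rhd> \<Theta> i = \<Theta> j\<rbrakk>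
      \<Longrightarrow> \<exists>\<gamma> \<in> hom2 C u v. \<forall>i \<in> V. \<pi> i \<rhd> \<gamma> = \<Theta> i"
    and conical_limit_cell_eq: "\<And>W u v \<gamma> \<delta>. \<lbrakk>u \<in> hom1 C W P; v \<in> hom1 C W P;
        \<gamma> \<in> hom2 C u v; \<delta> \<in> hom2 C u v;
        \<forall>(i, f, j) \<in> E. f \<rhd> (\<pi> i \<rhd> \<delta>) = \<pi> j \<rhd> \<delta>; \<forall>i \<in> V. \<pi> i \<rhd> \<gamma> = \<pi> i \<rhd> \<delta>\<rbrakk> \<Longrightarrow> \<gamma> = \<delta>"
proof -
  show cone: "cone C V D E P \<pi>" using lim unfolding conical_limit_def by blast
  have fac: "\<exists>!u. u \<in> hom1 C W P \<and> (\<forall>i \<in> V. \<pi> i \<cdot> u = x i)" if "cone C V D E W x" for W x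
    using lim that unfolding conical_limit_def by blast
  have two: "\<exists>!\<gamma>. \<gamma> \<in> hom2 C u v \<and> (\<forall>i \<in> V. \<pi> i \<rhd> \<gamma> = \<Theta> i)"
    if u: "u \<in> hom1 C W P" and v: "v \<in> hom1 C W P"
      and \<Theta>: "(\<forall>i \<in> V. \<Theta> i \<in> hom2 C (\<pi> i \<cdot> u) (\<pi> i \<cdot> v)) \<and> (\<forall>(i, f, j) \<in> E. f \<rhd> \<Theta> i = \<Theta> j)" for W u v \<Theta>
    using lim [unfolded conical_limit_def, THEN conjunct2, THEN conjunct2, rule_format, OF hom1D(4) [OF u] u v \<Theta>] .
  show "\<exists>u \<in> hom1 C W P. \<forall>i \<in> V. \<pi> i \<cdot> u = x i" if "cone C V D E W x" for W x
    using fac [OF that] by blast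
  show "\<exists>\<gamma> \<in> hom2 C u v. \<forall>i \<in> V. \<pi> i \<rhd> \<gamma> = \<Theta> i"
    if "u \<in> hom1 C W P" "v \<in> hom1 C W P"
      "\<forall>i \<in> V. \<Theta> i \<in> hom2 C (\<pi> i \<cdot> u) (\<pi> i \<cdot> v)" "\<forall>(i, f, j) \<in> E. f \<rhd> \<Theta> i = \<Theta> j" for W u v \<Theta>
    using two [OF that(1,2) conjI [OF that(3,4)]] by blast
  show "u = v" if "u \<in> hom1 C W P" "v \<in> hom1 C W P" "cone C V D E W (\<lambda>i. \<pi> i \<cdot> v)"
    "\<forall>i \<in> V. \<pi> i \<cdot> u = \<pi> i \<cdot> v" for W u v
    using fac [OF that(3)] that by blast
  show "\<gamma> = \<delta>" if uv: "u \<in> hom1 C W P" "v \<in> hom1 C W P" and "\<gamma> \<in> hom2 C u v" and \<delta>: "\<delta> \<in> hom2 C u v"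
     and E: "\<forall>(i, f, j) \<in> E. f \<rhd> (\<pi> i \<rhd> \<delta>) = \<pi> j \<rhd> \<delta>" and "\<forall>i \<in> V. \<pi> i \<rhd> \<gamma> = \<pi> i \<rhd> \<delta>" for W u v \<gamma> \<delta>
  proof -
    have "\<pi> i \<rhd> \<delta> \<in> hom2 C (\<pi> i \<cdot> u) (\<pi> i \<cdot> v)" if "i \<in> V" for i
    proof -
      have "\<pi> i \<in> hom1 C P (D i)" using cone that unfolding cone_def by blast
      from hom1D [OF this] show ?thesis
        by (simp add: hom2_iff hom1D [OF uv(1)] hom1D [OF uv(2)] hom2D [OF \<delta>])
    qed
    then have "\<exists>!\<gamma>. \<gamma> \<in> hom2 C u v \<and> (\<forall>i \<in> V. \<pi> i \<rhd> \<gamma> = \<pi> i \<rhd> \<delta>)"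
      using E by (intro two [OF uv]) auto
    then show ?thesis using that by blast
  qed
qed

text \<open>The comma object is the limit of \<open>X \<rightarrow> Z \<leftarrow> R \<rightarrow> Z
  \<leftarrow> Y\<close>, where \<open>R\<close> is the cotensor of \<open>Z\<close> with the arrow
  category: a generic 2-cell in \<open>Z\<close> whose source comes from \<open>X\<close> and whose
  target comes from \<open>Y\<close>.\<close>

lemma comma_square_exists:
  assumes fc: "finitely_complete C" and f: "f \<in> hom1 C X Z" and g: "g \<in> hom1 C Y Z"
  shows "\<exists>P p q \<theta>. p \<in> hom1 C P X \<and> q \<in> hom1 C P Y \<and> comma_square C p q f g \<theta>"
proof -
  obtain R p0 q0 \<theta>0 where ac: "arrow_cotensor C Z R p0 q0 \<theta>0"
    using fc hom1D(5) [OF f] unfolding finitely_complete_def by blast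
  have p0: "p0 \<in> hom1 C R Z" and q0: "q0 \<in> hom1 C R Z" and \<theta>0: "\<theta>0 \<in> hom2 C p0 q0"
    using arrow_cotensor_typing [OF ac] by auto
  note ty0 = hom1D [OF f] hom1D [OF g] hom1D [OF p0] hom1D [OF q0] hom2D [OF \<theta>0]
  define V :: "nat set" where "V = {0,1,2,3,4}"
  \<comment> \<open>\<open>Z\<close> occurs twice, at vertex 3 for the source and at vertex 4 for
    the target of the generic 2-cell. A single vertex would force
    \<open>f \<cdot> p = g \<cdot> q\<close>.\<close>
  define D where "D = (!) [X,Y,R,Z,Z]"
  define E :: "(nat \<times> 'a \<times> nat) set" where "E = {(0,f,3),(2,p0,3),(1,g,4),(2,q0,4)}"
  have "finite_diagram C V D E"
    unfolding finite_diagram_def V_def D_def E_def by (auto simp: hom1_iff ty0)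
  then obtain P \<pi> where lim: "conical_limit C V D E P \<pi>"
    using fc unfolding finitely_complete_def by blast
  note cone = conical_limit_cone [OF lim]
  have pi: "\<pi> 0 \<in> hom1 C P X" "\<pi> 1 \<in> hom1 C P Y" "\<pi> 2 \<in> hom1 C P R"
    and edge: "f \<cdot> \<pi> 0 = \<pi> 3" "p0 \<cdot> \<pi> 2 = \<pi> 3" "g \<cdot> \<pi> 1 = \<pi> 4" "q0 \<cdot> \<pi> 2 = \<pi> 4"
    using cone unfolding cone_def V_def D_def E_def by auto
  define p where "p = \<pi> 0"
  define q where "q = \<pi> 1"
  define r where "r = \<pi> 2"
  have \<pi>: "\<pi> 0 = p" "\<pi> 1 = q" "\<pi> (Suc 0) = q" "\<pi> 2 = r" "\<pi> 3 = f \<cdot> p" "\<pi> 4 = g \<cdot> q"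
    using edge by (simp_all add: p_def q_def r_def)
  have p: "p \<in> hom1 C P X" and q: "q \<in> hom1 C P Y" and r: "r \<in> hom1 C P R"
    using pi by (simp_all add: p_def q_def r_def)
  have pr: "p0 \<cdot> r = f \<cdot> p" and qr: "q0 \<cdot> r = g \<cdot> q"
    using edge by (simp_all add: p_def q_def r_def)
  note ty1 = ty0 hom1D [OF p] hom1D [OF q] hom1D [OF r] pr qr
  have r1 [simp]: "p0 \<cdot> r \<cdot> u = f \<cdot> p \<cdot> u" "q0 \<cdot> r \<cdot> u = g \<cdot> q \<cdot> u"
    if "u \<in> Arr C" "cod1 C u = P" for u
    using comp1_eq_assoc [OF pr] comp1_eq_assoc [OF qr] that by (auto simp: ty1)
  have r2 [simp]: "p0 \<rhd> (r \<rhd> \<alpha>) = f \<rhd> (p \<rhd> \<alpha>)" "q0 \<rhd> (r \<rhd> \<alpha>) = g \<rhd> (q \<rhd> \<alpha>)"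
    if "\<alpha> \<in> Cell C" "cod1 C (src C \<alpha>) = P" for \<alpha>
    using whisker_eq_assoc [OF pr] whisker_eq_assoc [OF qr] that by (auto simp: ty1)
  have "universal_square (\<lambda>\<theta>. True) C p q f g (\<theta>0 \<lhd> r)"
  proof (rule universal_squareI [OF f g p q])
    show "\<theta>0 \<lhd> r \<in> hom2 C (f \<cdot> p) (g \<cdot> q)" by (simp add: hom2_iff ty1)
  next
    fix W x y \<psi>
    assume x: "x \<in> hom1 C W X" and y: "y \<in> hom1 C W Y" and \<psi>: "\<psi> \<in> hom2 C (f \<cdot> x) (g \<cdot> y)"
    note ty = ty1 hom1D [OF x] hom1D [OF y] hom2D [OF \<psi>]
    have "f \<cdot> x \<in> hom1 C W Z" "g \<cdot> y \<in> hom1 C W Z" by (auto simp: hom1_iff ty)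
    then obtain u0 where u0: "u0 \<in> hom1 C W R" "p0 \<cdot> u0 = f \<cdot> x" "q0 \<cdot> u0 = g \<cdot> y" "\<theta>0 \<lhd> u0 = \<psi>"
      using arrow_cotensor_factor [OF ac _ _ \<psi>] by blast
    have "cone C V D E W ((!) [x, y, u0, f \<cdot> x, g \<cdot> y])"
      unfolding cone_def V_def D_def E_def using u0 x y by (auto simp: hom1_iff ty)
    then obtain u where "u \<in> hom1 C W P" "\<forall>i\<in>V. \<pi> i \<cdot> u = [x, y, u0, f \<cdot> x, g \<cdot> y] ! i"
      using conical_limit_factor [OF lim] by blast
    then have "u \<in> hom1 C W P" "p \<cdot> u = x" "q \<cdot> u = y" "r \<cdot> u = u0"
      by (auto simp: V_def \<pi>)
    then show "\<exists>u. u \<in> hom1 C W P \<and> p \<cdot> u = x \<and> q \<cdot> u = y \<and> (\<theta>0 \<lhd> r) \<lhd> u = \<psi>"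
      using u0(4) by (auto simp: ty hom1_iff intro!: exI [of _ u])
  next
    fix W u v
    assume u: "u \<in> hom1 C W P" and v: "v \<in> hom1 C W P"
      and eq: "p \<cdot> u = p \<cdot> v" "q \<cdot> u = q \<cdot> v" "(\<theta>0 \<lhd> r) \<lhd> u = (\<theta>0 \<lhd> r) \<lhd> v"
    note ty = ty1 hom1D [OF u] hom1D [OF v]
    have ru: "r \<cdot> u = r \<cdot> v"
      by (rule arrow_cotensor_factor_unique [OF ac]) (use eq in \<open>auto simp: ty hom1_iff\<close>)
    have "cone C V D E W (\<lambda>i. \<pi> i \<cdot> v)"
      unfolding cone_def V_def D_def E_def by (auto simp: hom1_iff ty \<pi>)
    moreover have "\<forall>i \<in> V. \<pi> i \<cdot> u = \<pi> i \<cdot> v"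
      using ru eq by (auto simp: V_def \<pi> ty)
    ultimately show "u = v" by (rule conical_limit_factor_unique [OF lim u v])
  next
    fix W u v \<alpha> \<beta>
    assume u: "u \<in> hom1 C W P" and v: "v \<in> hom1 C W P"
      and \<alpha>: "\<alpha> \<in> hom2 C (p \<cdot> u) (p \<cdot> v)" and \<beta>: "\<beta> \<in> hom2 C (q \<cdot> u) (q \<cdot> v)"
      and eq: "(g \<rhd> \<beta>) \<bullet> (\<theta>0 \<lhd> r) \<lhd> u = ((\<theta>0 \<lhd> r) \<lhd> v) \<bullet> (f \<rhd> \<alpha>)"
    note ty = ty1 hom1D [OF u] hom1D [OF v] hom2D [OF \<alpha>] hom2D [OF \<beta>]
    have "\<exists>\<gamma>0 \<in> hom2 C (r \<cdot> u) (r \<cdot> v). p0 \<rhd> \<gamma>0 = f \<rhd> \<alpha> \<and> q0 \<rhd> \<gamma>0 = g \<rhd> \<beta>"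
      by (rule arrow_cotensor_lift2 [OF ac]) (use eq in \<open>auto simp: hom1_iff hom2_iff ty\<close>)
    then obtain \<gamma>0 where \<gamma>0: "\<gamma>0 \<in> hom2 C (r \<cdot> u) (r \<cdot> v)" "p0 \<rhd> \<gamma>0 = f \<rhd> \<alpha>" "q0 \<rhd> \<gamma>0 = g \<rhd> \<beta>"
      by blast
    define \<Theta> where "\<Theta> = (!) [\<alpha>, \<beta>, \<gamma>0, f \<rhd> \<alpha>, g \<rhd> \<beta>]"
    have "\<forall>i \<in> V. \<Theta> i \<in> hom2 C (\<pi> i \<cdot> u) (\<pi> i \<cdot> v)" "\<forall>(i, f, j) \<in> E. f \<rhd> \<Theta> i = \<Theta> j"
      using \<gamma>0 by (auto simp: \<Theta>_def V_def E_def \<pi> hom2_iff ty)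
    then obtain \<gamma> where "\<gamma> \<in> hom2 C u v" "\<forall>i \<in> V. \<pi> i \<rhd> \<gamma> = \<Theta> i"
      using conical_limit_lift2 [OF lim u v] by blast
    then show "\<exists>\<gamma>. \<gamma> \<in> hom2 C u v \<and> p \<rhd> \<gamma> = \<alpha> \<and> q \<rhd> \<gamma> = \<beta>"
      by (auto simp: V_def \<pi> \<Theta>_def)
  next
    fix W u v \<gamma> \<delta>
    assume u: "u \<in> hom1 C W P" and v: "v \<in> hom1 C W P"
      and \<gamma>: "\<gamma> \<in> hom2 C u v" and \<delta>: "\<delta> \<in> hom2 C u v"
      and eq: "p \<rhd> \<gamma> = p \<rhd> \<delta>" "q \<rhd> \<gamma> = q \<rhd> \<delta>"
    note ty = ty1 hom1D [OF u] hom1D [OF v] hom2D [OF \<gamma>] hom2D [OF \<delta>]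
    have "r \<cdot> u \<in> hom1 C W R" "r \<cdot> v \<in> hom1 C W R" "r \<rhd> \<gamma> \<in> hom2 C (r \<cdot> u) (r \<cdot> v)"
      "r \<rhd> \<delta> \<in> hom2 C (r \<cdot> u) (r \<cdot> v)" "p0 \<rhd> (r \<rhd> \<gamma>) = p0 \<rhd> (r \<rhd> \<delta>)" "q0 \<rhd> (r \<rhd> \<gamma>) = q0 \<rhd> (r \<rhd> \<delta>)"
      using eq by (auto simp: hom1_iff hom2_iff ty)
    then have r: "r \<rhd> \<gamma> = r \<rhd> \<delta>" by (rule arrow_cotensor_cell_eq [OF ac])
    show "\<gamma> = \<delta>"
      by (rule conical_limit_cell_eq [OF lim u v \<gamma> \<delta>]) (use eq r in \<open>auto simp: V_def E_def \<pi> ty\<close>)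
  qed simp
  then show ?thesis using p q unfolding comma_square_def by blast
qed

text \<open>The 2-cells \<open>\<alpha>\<close> and \<open>\<beta>\<close> correspond to 1-cells
  \<open>m\<close> and \<open>m'\<close> from \<open>W\<close> into the cotensor \<open>R\<close>,
  and a 1-cell equifies the former precisely if it equalises the latter. The equifier is thus a
  conical limit, the equaliser of \<open>m\<close> and \<open>m'\<close>.\<close>

lemma equifier_exists:
  assumes fc: "finitely_complete C" and a: "a \<in> hom1 C W Z" and b: "b \<in> hom1 C W Z"
    and \<alpha>: "\<alpha> \<in> hom2 C a b" and \<beta>: "\<beta> \<in> hom2 C a b"
  obtains E e where "e \<in> hom1 C E W" "\<alpha> \<lhd> e = \<beta> \<lhd> e"
    "\<And>V x. \<lbrakk>x \<in> hom1 C V W; \<alpha> \<lhd> x = \<beta> \<lhd> x\<rbrakk> \<Longrightarrow> \<exists>u \<in> hom1 C V E. e \<cdot> u = x"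
    "\<And>V u v. \<lbrakk>u \<in> hom1 C V E; v \<in> hom1 C V E; e \<cdot> u = e \<cdot> v\<rbrakk> \<Longrightarrow> u = v"
    "\<And>V u v \<gamma>. \<lbrakk>u \<in> hom1 C V E; v \<in> hom1 C V E; \<gamma> \<in> hom2 C (e \<cdot> u) (e \<cdot> v)\<rbrakk>
      \<Longrightarrow> \<exists>\<delta> \<in> hom2 C u v. e \<rhd> \<delta> = \<gamma>"
    "\<And>V u v \<gamma> \<delta>. \<lbrakk>u \<in> hom1 C V E; v \<in> hom1 C V E; \<gamma> \<in> hom2 C u v; \<delta> \<in> hom2 C u v;
      e \<rhd> \<gamma> = e \<rhd> \<delta>\<rbrakk> \<Longrightarrow> \<gamma> = \<delta>"
proof -
  obtain R p q \<theta> where ac: "arrow_cotensor C Z R p q \<theta>"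
    using fc hom1D(5) [OF a] unfolding finitely_complete_def by blast
  note p = arrow_cotensor_typing(1) [OF ac] and q = arrow_cotensor_typing(2) [OF ac]
    and \<theta> = arrow_cotensor_typing(3) [OF ac]
  obtain m where m: "m \<in> hom1 C W R" and pm: "p \<cdot> m = a" "q \<cdot> m = b" "\<theta> \<lhd> m = \<alpha>"
    using arrow_cotensor_factor [OF ac a b \<alpha>] by blast
  obtain m' where m': "m' \<in> hom1 C W R" and pm': "p \<cdot> m' = a" "q \<cdot> m' = b" "\<theta> \<lhd> m' = \<beta>"
    using arrow_cotensor_factor [OF ac a b \<beta>] by blast
  note ty0 = hom1D [OF a] hom1D [OF b] hom2D [OF \<alpha>] hom2D [OF \<beta>] hom1D [OF p] hom1D [OF q] hom2D [OF \<theta>]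
    hom1D [OF m] hom1D [OF m'] pm pm'
  have pmx: "p \<cdot> (m \<cdot> x) = a \<cdot> x" "q \<cdot> (m \<cdot> x) = b \<cdot> x" "p \<cdot> (m' \<cdot> x) = a \<cdot> x" "q \<cdot> (m' \<cdot> x) = b \<cdot> x"
    "\<theta> \<lhd> (m \<cdot> x) = \<alpha> \<lhd> x" "\<theta> \<lhd> (m' \<cdot> x) = \<beta> \<lhd> x"
    if "x \<in> Arr C" "cod1 C x = W" for x
    unfolding pm(1,2,3) [symmetric] pm'(3) [symmetric]
    using that arg_cong [OF pm(1), of "\<lambda>f. f \<cdot> x"] arg_cong [OF pm(2), of "\<lambda>f. f \<cdot> x"]
      arg_cong [OF pm'(1), of "\<lambda>f. f \<cdot> x"] arg_cong [OF pm'(2), of "\<lambda>f. f \<cdot> x"]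
      hom1D [OF p] hom1D [OF q] hom2D [OF \<theta>] hom1D [OF m] hom1D [OF m'] by simp_all
  have pmg: "p \<rhd> (m \<rhd> \<gamma>) = a \<rhd> \<gamma>" "q \<rhd> (m \<rhd> \<gamma>) = b \<rhd> \<gamma>" "p \<rhd> (m' \<rhd> \<gamma>) = a \<rhd> \<gamma>" "q \<rhd> (m' \<rhd> \<gamma>) = b \<rhd> \<gamma>"
    if "\<gamma> \<in> Cell C" "cod1 C (src C \<gamma>) = W" for \<gamma>
    using that arg_cong [OF pm(1), of "\<lambda>f. f \<rhd> \<gamma>"] arg_cong [OF pm(2), of "\<lambda>f. f \<rhd> \<gamma>"]
      arg_cong [OF pm'(1), of "\<lambda>f. f \<rhd> \<gamma>"] arg_cong [OF pm'(2), of "\<lambda>f. f \<rhd> \<gamma>"]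
      hom1D [OF p] hom1D [OF q] hom2D [OF \<theta>] hom1D [OF m] hom1D [OF m'] by simp_all
  have mm': "m \<cdot> x = m' \<cdot> x" if x: "x \<in> hom1 C V W" and eq: "\<alpha> \<lhd> x = \<beta> \<lhd> x" for V x
    by (rule arrow_cotensor_factor_unique [OF ac])
      (use eq in \<open>auto simp: hom1_iff ty0 hom1D [OF x] pmx\<close>)
  define I :: "nat set" where "I = {0,1}"
  define D where "D = (!) [W,R]"
  define E :: "(nat \<times> 'a \<times> nat) set" where "E = {(0,m,1),(0,m',1)}"
  have "finite_diagram C I D E"
    unfolding finite_diagram_def I_def D_def E_def by (auto simp: hom1_iff ty0)
  then obtain L \<pi> where lim: "conical_limit C I D E L \<pi>"
    using fc unfolding finitely_complete_def by blast
  define e where "e = \<pi> 0"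
  have e: "e \<in> hom1 C L W" and \<pi>: "\<pi> 0 = e" "\<pi> (Suc 0) = m \<cdot> e" and me: "m' \<cdot> e = m \<cdot> e"
    using conical_limit_cone [OF lim] unfolding cone_def I_def D_def E_def by (auto simp: e_def)
  note ty1 = ty0 hom1D [OF e]
  have \<alpha>\<beta>: "\<alpha> \<lhd> e = \<beta> \<lhd> e"
    using pmx(5,6) [of e] me by (simp add: ty1)
  have me_u: "m' \<cdot> e \<cdot> u = m \<cdot> e \<cdot> u" if "u \<in> Arr C" "cod1 C u = L" for u
    using comp1_eq_assoc [OF me] that by (auto simp: ty1)
  have me_\<gamma>: "m' \<rhd> (e \<rhd> \<gamma>) = m \<rhd> (e \<rhd> \<gamma>)" if "\<gamma> \<in> Cell C" "cod1 C (src C \<gamma>) = L" for \<gamma>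
    using whisker_eq_assoc [OF me] that by (auto simp: ty1)
  show ?thesis
  proof (rule that [OF e \<alpha>\<beta>])
    fix V x assume x: "x \<in> hom1 C V W" and eq: "\<alpha> \<lhd> x = \<beta> \<lhd> x"
    have "cone C I D E V ((!) [x, m \<cdot> x])"
      unfolding cone_def I_def D_def E_def
      using mm' [OF x eq] by (auto simp: hom1_iff ty1 hom1D [OF x])
    then show "\<exists>u \<in> hom1 C V L. e \<cdot> u = x"
      using conical_limit_factor [OF lim] by (fastforce simp: I_def \<pi>)
  next
    fix V u v assume u: "u \<in> hom1 C V L" and v: "v \<in> hom1 C V L" and eq: "e \<cdot> u = e \<cdot> v"
    show "u = v"
    proof (rule conical_limit_factor_unique [OF lim u v])
      show "cone C I D E V (\<lambda>i. \<pi> i \<cdot> v)"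
        unfolding cone_def I_def D_def E_def by (auto simp: hom1_iff ty1 hom1D [OF v] \<pi> me_u)
      show "\<forall>i \<in> I. \<pi> i \<cdot> u = \<pi> i \<cdot> v"
        using eq by (auto simp: I_def \<pi> ty1 hom1D [OF u] hom1D [OF v])
    qed
  next
    fix V u v \<gamma> assume u: "u \<in> hom1 C V L" and v: "v \<in> hom1 C V L" and \<gamma>: "\<gamma> \<in> hom2 C (e \<cdot> u) (e \<cdot> v)"
    note ty = ty1 hom1D [OF u] hom1D [OF v] hom2D [OF \<gamma>]
    \<comment> \<open>Both sides have the same projections \<open>a \<rhd> \<gamma>\<close> and
      \<open>b \<rhd> \<gamma>\<close>. Hence the edge condition on 2-cells holds for every
      \<open>\<gamma>\<close>, which gives fullness of \<open>e\<close>.\<close>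
    have "m' \<rhd> \<gamma> = m \<rhd> \<gamma>"
      by (rule arrow_cotensor_cell_eq [OF ac, of "m \<cdot> (e \<cdot> u)" V "m \<cdot> (e \<cdot> v)"])
        (auto simp: ty hom1_iff hom2_iff me_u pmg)
    then have "\<exists>\<delta> \<in> hom2 C u v. \<forall>i \<in> I. \<pi> i \<rhd> \<delta> = [\<gamma>, m \<rhd> \<gamma>] ! i"
      by (intro conical_limit_lift2 [OF lim u v]) (auto simp: I_def E_def \<pi> hom2_iff ty)
    then show "\<exists>\<delta> \<in> hom2 C u v. e \<rhd> \<delta> = \<gamma>" by (auto simp: I_def \<pi>)
  next
    fix V u v \<gamma> \<delta> assume u: "u \<in> hom1 C V L" and v: "v \<in> hom1 C V L"
      and \<gamma>: "\<gamma> \<in> hom2 C u v" and \<delta>: "\<delta> \<in> hom2 C u v" and eq: "e \<rhd> \<gamma> = e \<rhd> \<delta>"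
    show "\<gamma> = \<delta>"
      by (rule conical_limit_cell_eq [OF lim u v \<gamma> \<delta>])
        (use eq in \<open>auto simp: I_def E_def \<pi> me_\<gamma> ty1 hom1D [OF u] hom1D [OF v] hom2D [OF \<gamma>] hom2D [OF \<delta>]\<close>)
  qed
qed

text \<open>Equify the first pair, then the restriction of the second pair to the result. Two
  equations at once are what the two halves of invertibility require.\<close>

lemma double_equifier_exists:
  assumes fc: "finitely_complete C"
    and a: "a \<in> hom1 C W Z" and b: "b \<in> hom1 C W Z" and \<alpha>: "\<alpha> \<in> hom2 C a b" and \<beta>: "\<beta> \<in> hom2 C a b"
    and a': "a' \<in> hom1 C W Z'" and b': "b' \<in> hom1 C W Z'" and \<alpha>': "\<alpha>' \<in> hom2 C a' b'"
    and \<beta>': "\<beta>' \<in> hom2 C a' b'"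
  obtains E e where "e \<in> hom1 C E W" "\<alpha> \<lhd> e = \<beta> \<lhd> e" "\<alpha>' \<lhd> e = \<beta>' \<lhd> e"
    "\<And>V x. \<lbrakk>x \<in> hom1 C V W; \<alpha> \<lhd> x = \<beta> \<lhd> x; \<alpha>' \<lhd> x = \<beta>' \<lhd> x\<rbrakk> \<Longrightarrow> \<exists>u \<in> hom1 C V E. e \<cdot> u = x"
    "\<And>V u v. \<lbrakk>u \<in> hom1 C V E; v \<in> hom1 C V E; e \<cdot> u = e \<cdot> v\<rbrakk> \<Longrightarrow> u = v"
    "\<And>V u v \<gamma>. \<lbrakk>u \<in> hom1 C V E; v \<in> hom1 C V E; \<gamma> \<in> hom2 C (e \<cdot> u) (e \<cdot> v)\<rbrakk>
      \<Longrightarrow> \<exists>\<delta> \<in> hom2 C u v. e \<rhd> \<delta> = \<gamma>"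
    "\<And>V u v \<gamma> \<delta>. \<lbrakk>u \<in> hom1 C V E; v \<in> hom1 C V E; \<gamma> \<in> hom2 C u v; \<delta> \<in> hom2 C u v;
      e \<rhd> \<gamma> = e \<rhd> \<delta>\<rbrakk> \<Longrightarrow> \<gamma> = \<delta>"
proof -
  obtain E1 e1 where e1: "e1 \<in> hom1 C E1 W" and eq1: "\<alpha> \<lhd> e1 = \<beta> \<lhd> e1"
    and fac1: "\<And>V x. \<lbrakk>x \<in> hom1 C V W; \<alpha> \<lhd> x = \<beta> \<lhd> x\<rbrakk> \<Longrightarrow> \<exists>u \<in> hom1 C V E1. e1 \<cdot> u = x"
    and mono1: "\<And>V u v. \<lbrakk>u \<in> hom1 C V E1; v \<in> hom1 C V E1; e1 \<cdot> u = e1 \<cdot> v\<rbrakk> \<Longrightarrow> u = v"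
    and full1: "\<And>V u v \<gamma>. \<lbrakk>u \<in> hom1 C V E1; v \<in> hom1 C V E1; \<gamma> \<in> hom2 C (e1 \<cdot> u) (e1 \<cdot> v)\<rbrakk>
      \<Longrightarrow> \<exists>\<delta> \<in> hom2 C u v. e1 \<rhd> \<delta> = \<gamma>"
    and faithful1: "\<And>V u v \<gamma> \<delta>. \<lbrakk>u \<in> hom1 C V E1; v \<in> hom1 C V E1; \<gamma> \<in> hom2 C u v; \<delta> \<in> hom2 C u v;
      e1 \<rhd> \<gamma> = e1 \<rhd> \<delta>\<rbrakk> \<Longrightarrow> \<gamma> = \<delta>"
    by (rule equifier_exists [OF fc a b \<alpha> \<beta>], rule that)
  note ty1 = hom1D [OF a] hom1D [OF b] hom2D [OF \<alpha>] hom2D [OF \<beta>] hom1D [OF a'] hom1D [OF b']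
    hom2D [OF \<alpha>'] hom2D [OF \<beta>'] hom1D [OF e1]
  have e1_cells: "a' \<cdot> e1 \<in> hom1 C E1 Z'" "b' \<cdot> e1 \<in> hom1 C E1 Z'" "\<alpha>' \<lhd> e1 \<in> hom2 C (a' \<cdot> e1) (b' \<cdot> e1)"
     "\<beta>' \<lhd> e1 \<in> hom2 C (a' \<cdot> e1) (b' \<cdot> e1)"
    by (auto simp: hom1_iff hom2_iff ty1)
  obtain E2 e2 where e2: "e2 \<in> hom1 C E2 E1" and eq2: "(\<alpha>' \<lhd> e1) \<lhd> e2 = (\<beta>' \<lhd> e1) \<lhd> e2"
    and fac2: "\<And>V x. \<lbrakk>x \<in> hom1 C V E1; (\<alpha>' \<lhd> e1) \<lhd> x = (\<beta>' \<lhd> e1) \<lhd> x\<rbrakk> \<Longrightarrow> \<exists>u \<in> hom1 C V E2. e2 \<cdot> u = x"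
    and mono2: "\<And>V u v. \<lbrakk>u \<in> hom1 C V E2; v \<in> hom1 C V E2; e2 \<cdot> u = e2 \<cdot> v\<rbrakk> \<Longrightarrow> u = v"
    and full2: "\<And>V u v \<gamma>. \<lbrakk>u \<in> hom1 C V E2; v \<in> hom1 C V E2; \<gamma> \<in> hom2 C (e2 \<cdot> u) (e2 \<cdot> v)\<rbrakk>
      \<Longrightarrow> \<exists>\<delta> \<in> hom2 C u v. e2 \<rhd> \<delta> = \<gamma>"
    and faithful2: "\<And>V u v \<gamma> \<delta>. \<lbrakk>u \<in> hom1 C V E2; v \<in> hom1 C V E2; \<gamma> \<in> hom2 C u v; \<delta> \<in> hom2 C u v;
      e2 \<rhd> \<gamma> = e2 \<rhd> \<delta>\<rbrakk> \<Longrightarrow> \<gamma> = \<delta>"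
    by (rule equifier_exists [OF fc e1_cells], rule that)
  note ty = ty1 hom1D [OF e2]
  have e2u: "e2 \<cdot> u \<in> hom1 C V E1" if u: "u \<in> hom1 C V E2" for V u
    by (simp add: hom1_iff ty hom1D [OF u])
  show ?thesis
  proof (rule that [of "e1 \<cdot> e2" E2])
    show "e1 \<cdot> e2 \<in> hom1 C E2 W" by (simp add: hom1_iff ty)
    show "\<alpha> \<lhd> (e1 \<cdot> e2) = \<beta> \<lhd> (e1 \<cdot> e2)"
      using arg_cong [OF eq1, of "\<lambda>\<gamma>. \<gamma> \<lhd> e2"] by (simp add: ty)
    show "\<alpha>' \<lhd> (e1 \<cdot> e2) = \<beta>' \<lhd> (e1 \<cdot> e2)"
      using eq2 by (simp add: ty)
  next
    fix V x assume x: "x \<in> hom1 C V W" and eq: "\<alpha> \<lhd> x = \<beta> \<lhd> x" "\<alpha>' \<lhd> x = \<beta>' \<lhd> x"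
    obtain y where y: "y \<in> hom1 C V E1" "e1 \<cdot> y = x" using fac1 [OF x eq(1)] by blast
    have "(\<alpha>' \<lhd> e1) \<lhd> y = (\<beta>' \<lhd> e1) \<lhd> y" using eq(2) y(2) by (simp add: ty hom1D [OF y(1)])
    from fac2 [OF y(1) this] obtain u where "u \<in> hom1 C V E2" "e2 \<cdot> u = y" by blast
    then show "\<exists>u \<in> hom1 C V E2. (e1 \<cdot> e2) \<cdot> u = x"
      using y by (auto simp: ty hom1_iff intro!: bexI [of _ u])
  next
    fix V u v assume u: "u \<in> hom1 C V E2" and v: "v \<in> hom1 C V E2" and eq: "(e1 \<cdot> e2) \<cdot> u = (e1 \<cdot> e2) \<cdot> v"
    then have "e2 \<cdot> u = e2 \<cdot> v"
      by (intro mono1 [OF e2u [OF u] e2u [OF v]]) (simp add: ty hom1D [OF u] hom1D [OF v])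
    then show "u = v" by (rule mono2 [OF u v])
  next
    fix V u v \<gamma> assume u: "u \<in> hom1 C V E2" and v: "v \<in> hom1 C V E2"
      and \<gamma>: "\<gamma> \<in> hom2 C ((e1 \<cdot> e2) \<cdot> u) ((e1 \<cdot> e2) \<cdot> v)"
    then have "\<gamma> \<in> hom2 C (e1 \<cdot> (e2 \<cdot> u)) (e1 \<cdot> (e2 \<cdot> v))" by (simp add: ty hom1D [OF u] hom1D [OF v])
    then obtain \<delta> where \<delta>: "\<delta> \<in> hom2 C (e2 \<cdot> u) (e2 \<cdot> v)" "e1 \<rhd> \<delta> = \<gamma>"
      using full1 [OF e2u [OF u] e2u [OF v]] by blast
    from full2 [OF u v \<delta>(1)] obtain \<epsilon> where \<epsilon>: "\<epsilon> \<in> hom2 C u v" "e2 \<rhd> \<epsilon> = \<delta>" by blast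
    have "(e1 \<cdot> e2) \<rhd> \<epsilon> = \<gamma>"
      by (simp add: ty hom1D [OF u] hom2D [OF \<epsilon>(1)] \<epsilon>(2) \<delta>(2))
    with \<epsilon>(1) show "\<exists>\<delta> \<in> hom2 C u v. (e1 \<cdot> e2) \<rhd> \<delta> = \<gamma>" by blast
  next
    fix V u v \<gamma> \<delta> assume u: "u \<in> hom1 C V E2" and v: "v \<in> hom1 C V E2"
      and \<gamma>: "\<gamma> \<in> hom2 C u v" and \<delta>: "\<delta> \<in> hom2 C u v" and eq: "(e1 \<cdot> e2) \<rhd> \<gamma> = (e1 \<cdot> e2) \<rhd> \<delta>"
    note ty2 = ty hom1D [OF u] hom1D [OF v] hom2D [OF \<gamma>] hom2D [OF \<delta>]
    have "e2 \<rhd> \<gamma> = e2 \<rhd> \<delta>"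
      by (rule faithful1 [OF e2u [OF u] e2u [OF v]]) (use eq in \<open>auto simp: ty2 hom2_iff\<close>)
    then show "\<gamma> = \<delta>" by (rule faithful2 [OF u v \<gamma> \<delta>])
  qed
qed

text \<open>An invertible 2-cell is a pair of opposite 2-cells with both composites equal to
  identities. The pair is classified by the comma objects of \<open>f\<close>, \<open>g\<close> and
  of \<open>g\<close>, \<open>f\<close>, glued along their projections; the two equations are
  imposed by equifiers.\<close>

lemma isocomma_square_exists:
  assumes fc: "finitely_complete C" and f: "f \<in> hom1 C X Z" and g: "g \<in> hom1 C Y Z"
  shows "\<exists>P p q \<theta>. p \<in> hom1 C P X \<and> q \<in> hom1 C P Y \<and> isocomma_square C p q f g \<theta>"
proof -
  obtain D1 p1 q1 \<theta>1 where p1: "p1 \<in> hom1 C D1 X" and q1: "q1 \<in> hom1 C D1 Y"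
    and c1: "universal_square (\<lambda>\<theta>. True) C p1 q1 f g \<theta>1"
    using comma_square_exists [OF fc f g] unfolding comma_square_def by blast
  obtain D2 p2 q2 \<theta>2 where q2: "q2 \<in> hom1 C D2 Y" and p2: "p2 \<in> hom1 C D2 X"
    and c2: "universal_square (\<lambda>\<theta>. True) C q2 p2 g f \<theta>2"
    using comma_square_exists [OF fc g f] unfolding comma_square_def by blast
  note \<theta>1 = universal_square_cell [OF c1 f g p1] and \<theta>2 = universal_square_cell [OF c2 g f q2]
  note ty0 = hom1D [OF f] hom1D [OF g] hom1D [OF p1] hom1D [OF q1] hom1D [OF p2] hom1D [OF q2]
    hom2D [OF \<theta>1] hom2D [OF \<theta>2]
  define I :: "nat set" where "I = {0,1,2,3}"
  define D where "D = (!) [X,Y,D1,D2]"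
  define E :: "(nat \<times> 'a \<times> nat) set" where "E = {(2,p1,0),(2,q1,1),(3,p2,0),(3,q2,1)}"
  have "finite_diagram C I D E"
    unfolding finite_diagram_def I_def D_def E_def by (auto simp: hom1_iff ty0)
  then obtain L \<pi> where lim: "conical_limit C I D E L \<pi>"
    using fc unfolding finitely_complete_def by blast
  define p where "p = \<pi> 0"
  define q where "q = \<pi> 1"
  define r1 where "r1 = \<pi> 2"
  define r2 where "r2 = \<pi> 3"
  have \<pi>: "\<pi> 0 = p" "\<pi> 1 = q" "\<pi> (Suc 0) = q" "\<pi> 2 = r1" "\<pi> 3 = r2"
    by (simp_all add: p_def q_def r1_def r2_def)
  have p: "p \<in> hom1 C L X" and q: "q \<in> hom1 C L Y" and r1: "r1 \<in> hom1 C L D1" and r2: "r2 \<in> hom1 C L D2"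
    and pr: "p1 \<cdot> r1 = p" "q1 \<cdot> r1 = q" "p2 \<cdot> r2 = p" "q2 \<cdot> r2 = q"
    using conical_limit_cone [OF lim] unfolding cone_def I_def D_def E_def by (auto simp: \<pi>)
  note ty1 = ty0 hom1D [OF p] hom1D [OF q] hom1D [OF r1] hom1D [OF r2] pr
  have pru: "p1 \<cdot> r1 \<cdot> u = p \<cdot> u" "q1 \<cdot> r1 \<cdot> u = q \<cdot> u" "p2 \<cdot> r2 \<cdot> u = p \<cdot> u" "q2 \<cdot> r2 \<cdot> u = q \<cdot> u"
    if "u \<in> Arr C" "cod1 C u = L" for u
    using that arg_cong [OF pr(1), of "\<lambda>f. f \<cdot> u"] arg_cong [OF pr(2), of "\<lambda>f. f \<cdot> u"]
      arg_cong [OF pr(3), of "\<lambda>f. f \<cdot> u"] arg_cong [OF pr(4), of "\<lambda>f. f \<cdot> u"]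
      ty0 hom1D [OF r1] hom1D [OF r2] by simp_all
  have pr\<gamma>: "p1 \<rhd> (r1 \<rhd> \<gamma>) = p \<rhd> \<gamma>" "q1 \<rhd> (r1 \<rhd> \<gamma>) = q \<rhd> \<gamma>" "p2 \<rhd> (r2 \<rhd> \<gamma>) = p \<rhd> \<gamma>" "q2 \<rhd> (r2 \<rhd> \<gamma>) = q \<rhd> \<gamma>"
    if "\<gamma> \<in> Cell C" "cod1 C (src C \<gamma>) = L" for \<gamma>
    using that arg_cong [OF pr(1), of "\<lambda>f. f \<rhd> \<gamma>"] arg_cong [OF pr(2), of "\<lambda>f. f \<rhd> \<gamma>"]
      arg_cong [OF pr(3), of "\<lambda>f. f \<rhd> \<gamma>"] arg_cong [OF pr(4), of "\<lambda>f. f \<rhd> \<gamma>"]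
      ty0 hom1D [OF r1] hom1D [OF r2] by simp_all
  \<comment> \<open>The endocells of \<open>f \<cdot> p\<close> and \<open>g \<cdot> q\<close> that
    have to become identities.\<close>
  define A where "A = (\<theta>2 \<lhd> r2) \<bullet> (\<theta>1 \<lhd> r1)"
  define B where "B = (\<theta>1 \<lhd> r1) \<bullet> (\<theta>2 \<lhd> r2)"
  have AB: "A \<in> hom2 C (f \<cdot> p) (f \<cdot> p)" "B \<in> hom2 C (g \<cdot> q) (g \<cdot> q)"
    by (auto simp: A_def B_def hom2_iff ty1)
  have ids: "id2 C (f \<cdot> p) \<in> hom2 C (f \<cdot> p) (f \<cdot> p)" "id2 C (g \<cdot> q) \<in> hom2 C (g \<cdot> q) (g \<cdot> q)"
    "f \<cdot> p \<in> hom1 C L Z" "g \<cdot> q \<in> hom1 C L Z"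
    by (auto simp: hom1_iff hom2_iff ty1)
  obtain K e where e: "e \<in> hom1 C K L" and eq: "A \<lhd> e = id2 C (f \<cdot> p) \<lhd> e" "B \<lhd> e = id2 C (g \<cdot> q) \<lhd> e"
    and fac: "\<And>V x. \<lbrakk>x \<in> hom1 C V L; A \<lhd> x = id2 C (f \<cdot> p) \<lhd> x; B \<lhd> x = id2 C (g \<cdot> q) \<lhd> x\<rbrakk>
      \<Longrightarrow> \<exists>u \<in> hom1 C V K. e \<cdot> u = x"
    and mono: "\<And>V u v. \<lbrakk>u \<in> hom1 C V K; v \<in> hom1 C V K; e \<cdot> u = e \<cdot> v\<rbrakk> \<Longrightarrow> u = v"
    and full: "\<And>V u v \<gamma>. \<lbrakk>u \<in> hom1 C V K; v \<in> hom1 C V K; \<gamma> \<in> hom2 C (e \<cdot> u) (e \<cdot> v)\<rbrakk>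
      \<Longrightarrow> \<exists>\<delta> \<in> hom2 C u v. e \<rhd> \<delta> = \<gamma>"
    and faithful: "\<And>V u v \<gamma> \<delta>. \<lbrakk>u \<in> hom1 C V K; v \<in> hom1 C V K; \<gamma> \<in> hom2 C u v; \<delta> \<in> hom2 C u v;
      e \<rhd> \<gamma> = e \<rhd> \<delta>\<rbrakk> \<Longrightarrow> \<gamma> = \<delta>"
    by (rule double_equifier_exists [OF fc ids(3,3) AB(1) ids(1) ids(4,4) AB(2) ids(2)], rule that)
  note ty2 = ty1 hom1D [OF e]
  have inv: "(\<theta>2 \<lhd> (r2 \<cdot> (e \<cdot> u))) \<bullet> (\<theta>1 \<lhd> (r1 \<cdot> (e \<cdot> u))) = id2 C (f \<cdot> (p \<cdot> (e \<cdot> u)))"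
    "(\<theta>1 \<lhd> (r1 \<cdot> (e \<cdot> u))) \<bullet> (\<theta>2 \<lhd> (r2 \<cdot> (e \<cdot> u))) = id2 C (g \<cdot> (q \<cdot> (e \<cdot> u)))"
    if "u \<in> Arr C" "cod1 C u = K" for u
    using that arg_cong [OF eq(1), of "\<lambda>\<gamma>. \<gamma> \<lhd> u"] arg_cong [OF eq(2), of "\<lambda>\<gamma>. \<gamma> \<lhd> u"]
    by (simp_all add: A_def B_def ty2 pru)
  have inv_e: "(\<theta>2 \<lhd> (r2 \<cdot> e)) \<bullet> (\<theta>1 \<lhd> (r1 \<cdot> e)) = id2 C (f \<cdot> (p \<cdot> e))"
    "(\<theta>1 \<lhd> (r1 \<cdot> e)) \<bullet> (\<theta>2 \<lhd> (r2 \<cdot> e)) = id2 C (g \<cdot> (q \<cdot> e))"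
    using eq by (simp_all add: A_def B_def ty2)
  have cells: "\<theta>1 \<lhd> (r1 \<cdot> (e \<cdot> u)) \<in> hom2 C (f \<cdot> (p \<cdot> (e \<cdot> u))) (g \<cdot> (q \<cdot> (e \<cdot> u)))"
    "\<theta>2 \<lhd> (r2 \<cdot> (e \<cdot> u)) \<in> hom2 C (g \<cdot> (q \<cdot> (e \<cdot> u))) (f \<cdot> (p \<cdot> (e \<cdot> u)))"
    if "u \<in> hom1 C V K" for V u
    by (auto simp: hom2_iff ty2 hom1D [OF that] pru)
  \<comment> \<open>On \<open>L\<close> the projections \<open>p\<close> and \<open>q\<close> alone
    are jointly faithful, since they determine the components in \<open>D1\<close> and
    \<open>D2\<close>.\<close>
  have lift: "\<gamma> = \<delta>" if u: "u \<in> hom1 C V L" and v: "v \<in> hom1 C V L" and \<gamma>: "\<gamma> \<in> hom2 C u v"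
    and \<delta>: "\<delta> \<in> hom2 C u v" and eq: "p \<rhd> \<gamma> = p \<rhd> \<delta>" "q \<rhd> \<gamma> = q \<rhd> \<delta>" for V u v \<gamma> \<delta>
  proof -
    note ty3 = ty1 hom1D [OF u] hom1D [OF v] hom2D [OF \<gamma>] hom2D [OF \<delta>]
    have "r1 \<rhd> \<gamma> = r1 \<rhd> \<delta>"
      by (rule universal_square_cell_eq [OF c1 f g p1, of "r1 \<cdot> u" V "r1 \<cdot> v"])
        (use eq in \<open>auto simp: ty3 hom1_iff hom2_iff pr\<gamma>\<close>)
    moreover have "r2 \<rhd> \<gamma> = r2 \<rhd> \<delta>"
      by (rule universal_square_cell_eq [OF c2 g f q2, of "r2 \<cdot> u" V "r2 \<cdot> v"])
        (use eq in \<open>auto simp: ty3 hom1_iff hom2_iff pr\<gamma>\<close>)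
    ultimately show ?thesis
      by (intro conical_limit_cell_eq [OF lim u v \<gamma> \<delta>])
        (use eq in \<open>auto simp: I_def E_def \<pi> ty3 pr\<gamma>\<close>)
  qed
  have "universal_square (invertible2 C) C (p \<cdot> e) (q \<cdot> e) f g (\<theta>1 \<lhd> (r1 \<cdot> e))"
  proof (rule universal_squareI [OF f g])
    show "p \<cdot> e \<in> hom1 C K X" "q \<cdot> e \<in> hom1 C K Y" by (auto simp: hom1_iff ty2)
    show "\<theta>1 \<lhd> (r1 \<cdot> e) \<in> hom2 C (f \<cdot> p \<cdot> e) (g \<cdot> q \<cdot> e)" by (auto simp: hom2_iff ty2 pru)
    show "invertible2 C (\<theta>1 \<lhd> (r1 \<cdot> e))"
      unfolding invertible2_def
      by (intro conjI bexI [of _ "\<theta>2 \<lhd> (r2 \<cdot> e)"]) (auto simp: hom2_iff ty2 pru inv_e)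
  next
    fix W x y \<psi>
    assume x: "x \<in> hom1 C W X" and y: "y \<in> hom1 C W Y" and \<psi>: "\<psi> \<in> hom2 C (f \<cdot> x) (g \<cdot> y)"
      and "invertible2 C \<psi>"
    then obtain \<psi>' where \<psi>': "\<psi>' \<in> hom2 C (g \<cdot> y) (f \<cdot> x)" "\<psi>' \<bullet> \<psi> = id2 C (f \<cdot> x)" "\<psi> \<bullet> \<psi>' = id2 C (g \<cdot> y)"
      unfolding invertible2_def by (auto simp: hom2D [OF \<psi>])
    obtain u1 where u1: "u1 \<in> hom1 C W D1" "p1 \<cdot> u1 = x" "q1 \<cdot> u1 = y" "\<theta>1 \<lhd> u1 = \<psi>"
      using universal_square_factor [OF c1 f g p1 x y \<psi>] by blast
    obtain u2 where u2: "u2 \<in> hom1 C W D2" "q2 \<cdot> u2 = y" "p2 \<cdot> u2 = x" "\<theta>2 \<lhd> u2 = \<psi>'"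
      using universal_square_factor [OF c2 g f q2 y x \<psi>'(1)] by blast
    have "cone C I D E W ((!) [x, y, u1, u2])"
      unfolding cone_def I_def D_def E_def using u1(1) u2(1) x y
      by (auto simp: hom1_iff u1(2,3) u2(2,3) hom1D(4) [OF x])
    then obtain k where "k \<in> hom1 C W L" "\<forall>i\<in>I. \<pi> i \<cdot> k = [x, y, u1, u2] ! i"
      using conical_limit_factor [OF lim] by blast
    then have k: "k \<in> hom1 C W L" "p \<cdot> k = x" "q \<cdot> k = y" "r1 \<cdot> k = u1" "r2 \<cdot> k = u2"
      by (auto simp: I_def \<pi>)
    have "\<exists>u \<in> hom1 C W K. e \<cdot> u = k"
      by (rule fac [OF k(1)]) (simp_all add: A_def B_def ty2 hom1D [OF k(1)] k(2-) u1(4) u2(4) \<psi>'(2,3))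
    then obtain u where u: "u \<in> hom1 C W K" "e \<cdot> u = k" by blast
    have "(p \<cdot> e) \<cdot> u = x" "(q \<cdot> e) \<cdot> u = y" "(\<theta>1 \<lhd> (r1 \<cdot> e)) \<lhd> u = \<psi>"
      by (simp_all add: ty2 hom1D [OF u(1)] u(2) k(2-) u1(4))
    with u(1) show "\<exists>u. u \<in> hom1 C W K \<and> (p \<cdot> e) \<cdot> u = x \<and> (q \<cdot> e) \<cdot> u = y \<and> (\<theta>1 \<lhd> (r1 \<cdot> e)) \<lhd> u = \<psi>"
      by blast
  next
    fix W u v
    assume u: "u \<in> hom1 C W K" and v: "v \<in> hom1 C W K"
      and "(p \<cdot> e) \<cdot> u = (p \<cdot> e) \<cdot> v" "(q \<cdot> e) \<cdot> u = (q \<cdot> e) \<cdot> v"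
        "(\<theta>1 \<lhd> (r1 \<cdot> e)) \<lhd> u = (\<theta>1 \<lhd> (r1 \<cdot> e)) \<lhd> v"
    then have eq: "p \<cdot> (e \<cdot> u) = p \<cdot> (e \<cdot> v)" "q \<cdot> (e \<cdot> u) = q \<cdot> (e \<cdot> v)"
        "\<theta>1 \<lhd> (r1 \<cdot> (e \<cdot> u)) = \<theta>1 \<lhd> (r1 \<cdot> (e \<cdot> v))"
      by (simp_all add: ty2 hom1D [OF u] hom1D [OF v])
    note ty = ty2 hom1D [OF u] hom1D [OF v]
    have 1: "r1 \<cdot> (e \<cdot> u) = r1 \<cdot> (e \<cdot> v)"
      by (rule universal_square_factor_unique [OF c1 f g p1, of _ W])
        (use eq in \<open>auto simp: ty hom1_iff pru\<close>)
    \<comment> \<open>The two \<open>\<theta>2\<close> cells are inverse to the same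
      \<open>\<theta>1\<close> cell, so they agree. Identities are taken as the other two sides of
      the square.\<close>
    have "id2 C (f \<cdot> (p \<cdot> (e \<cdot> u))) \<bullet> (\<theta>2 \<lhd> (r2 \<cdot> (e \<cdot> u)))
        = (\<theta>2 \<lhd> (r2 \<cdot> (e \<cdot> v))) \<bullet> id2 C (g \<cdot> (q \<cdot> (e \<cdot> u)))"
    proof (rule inverse_square [OF cells(1) [OF u] cells(2) [OF u] cells [OF v]])
      show "(\<theta>1 \<lhd> (r1 \<cdot> (e \<cdot> u))) \<bullet> (\<theta>2 \<lhd> (r2 \<cdot> (e \<cdot> u))) = id2 C (g \<cdot> (q \<cdot> (e \<cdot> u)))"
        "(\<theta>2 \<lhd> (r2 \<cdot> (e \<cdot> v))) \<bullet> (\<theta>1 \<lhd> (r1 \<cdot> (e \<cdot> v))) = id2 C (f \<cdot> (p \<cdot> (e \<cdot> v)))"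
        by (rule inv; simp add: ty)+
      show "id2 C (g \<cdot> (q \<cdot> (e \<cdot> u))) \<bullet> (\<theta>1 \<lhd> (r1 \<cdot> (e \<cdot> u)))
          = (\<theta>1 \<lhd> (r1 \<cdot> (e \<cdot> v))) \<bullet> id2 C (f \<cdot> (p \<cdot> (e \<cdot> u)))"
        by (simp add: ty pru eq)
    qed (simp_all add: ty hom2_iff eq)
    then have \<theta>2_eq: "\<theta>2 \<lhd> (r2 \<cdot> (e \<cdot> u)) = \<theta>2 \<lhd> (r2 \<cdot> (e \<cdot> v))"
      using eq by (simp add: ty pru)
    have 2: "r2 \<cdot> (e \<cdot> u) = r2 \<cdot> (e \<cdot> v)"
      by (rule universal_square_factor_unique [OF c2 g f q2, of _ W])
        (use eq \<theta>2_eq in \<open>auto simp: ty hom1_iff pru\<close>)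
    have "e \<cdot> u = e \<cdot> v"
    proof (rule conical_limit_factor_unique [OF lim, of _ W])
      show "cone C I D E W (\<lambda>i. \<pi> i \<cdot> e \<cdot> v)"
        unfolding cone_def I_def D_def E_def by (auto simp: hom1_iff ty \<pi> pru)
      show "\<forall>i\<in>I. \<pi> i \<cdot> e \<cdot> u = \<pi> i \<cdot> e \<cdot> v"
        using eq 1 2 by (auto simp: I_def \<pi>)
    qed (auto simp: ty hom1_iff)
    then show "u = v" by (rule mono [OF u v])
  next
    fix W u v \<alpha> \<beta>
    assume u: "u \<in> hom1 C W K" and v: "v \<in> hom1 C W K"
      and \<alpha>': "\<alpha> \<in> hom2 C ((p \<cdot> e) \<cdot> u) ((p \<cdot> e) \<cdot> v)" and \<beta>': "\<beta> \<in> hom2 C ((q \<cdot> e) \<cdot> u) ((q \<cdot> e) \<cdot> v)"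
      and eq': "(g \<rhd> \<beta>) \<bullet> (\<theta>1 \<lhd> (r1 \<cdot> e)) \<lhd> u = ((\<theta>1 \<lhd> (r1 \<cdot> e)) \<lhd> v) \<bullet> (f \<rhd> \<alpha>)"
    have \<alpha>: "\<alpha> \<in> hom2 C (p \<cdot> (e \<cdot> u)) (p \<cdot> (e \<cdot> v))" and \<beta>: "\<beta> \<in> hom2 C (q \<cdot> (e \<cdot> u)) (q \<cdot> (e \<cdot> v))"
      and eq: "(g \<rhd> \<beta>) \<bullet> (\<theta>1 \<lhd> (r1 \<cdot> (e \<cdot> u))) = (\<theta>1 \<lhd> (r1 \<cdot> (e \<cdot> v))) \<bullet> (f \<rhd> \<alpha>)"
      using \<alpha>' \<beta>' eq' by (simp_all add: ty2 hom1D [OF u] hom1D [OF v])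
    note ty = ty2 hom1D [OF u] hom1D [OF v] hom2D [OF \<alpha>] hom2D [OF \<beta>]
    \<comment> \<open>Compatibility with \<open>\<theta>1\<close> passes to its inverse, so the same
      \<open>\<alpha>\<close> and \<open>\<beta>\<close> lift to the second comma object
      too.\<close>
    have eq2: "(f \<rhd> \<alpha>) \<bullet> (\<theta>2 \<lhd> (r2 \<cdot> (e \<cdot> u))) = (\<theta>2 \<lhd> (r2 \<cdot> (e \<cdot> v))) \<bullet> (g \<rhd> \<beta>)"
      by (rule inverse_square [OF cells(1) [OF u] cells(2) [OF u] cells [OF v]])
        (use eq in \<open>auto simp: ty hom2_iff inv pru\<close>)
    have "\<exists>\<gamma> \<in> hom2 C (r1 \<cdot> (e \<cdot> u)) (r1 \<cdot> (e \<cdot> v)). p1 \<rhd> \<gamma> = \<alpha> \<and> q1 \<rhd> \<gamma> = \<beta>"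
      by (rule universal_square_lift2 [OF c1 f g p1, of _ W])
        (use eq in \<open>auto simp: ty hom1_iff hom2_iff pru\<close>)
    then obtain \<gamma>1 where \<gamma>1: "\<gamma>1 \<in> hom2 C (r1 \<cdot> (e \<cdot> u)) (r1 \<cdot> (e \<cdot> v))" "p1 \<rhd> \<gamma>1 = \<alpha>" "q1 \<rhd> \<gamma>1 = \<beta>"
      by blast
    have "\<exists>\<gamma> \<in> hom2 C (r2 \<cdot> (e \<cdot> u)) (r2 \<cdot> (e \<cdot> v)). q2 \<rhd> \<gamma> = \<beta> \<and> p2 \<rhd> \<gamma> = \<alpha>"
      by (rule universal_square_lift2 [OF c2 g f q2, of _ W])
        (use eq2 in \<open>auto simp: ty hom1_iff hom2_iff pru\<close>)
    then obtain \<gamma>2 where \<gamma>2: "\<gamma>2 \<in> hom2 C (r2 \<cdot> (e \<cdot> u)) (r2 \<cdot> (e \<cdot> v))" "q2 \<rhd> \<gamma>2 = \<beta>" "p2 \<rhd> \<gamma>2 = \<alpha>"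
      by blast
    have "\<exists>\<gamma> \<in> hom2 C (e \<cdot> u) (e \<cdot> v). \<forall>i \<in> I. \<pi> i \<rhd> \<gamma> = [\<alpha>, \<beta>, \<gamma>1, \<gamma>2] ! i"
      by (rule conical_limit_lift2 [OF lim, of _ W])
        (use \<gamma>1 \<gamma>2 in \<open>auto simp: ty hom1_iff hom2_iff I_def E_def \<pi>\<close>)
    then obtain \<gamma> where \<gamma>: "\<gamma> \<in> hom2 C (e \<cdot> u) (e \<cdot> v)" "p \<rhd> \<gamma> = \<alpha>" "q \<rhd> \<gamma> = \<beta>"
      by (auto simp: I_def \<pi>)
    from full [OF u v \<gamma>(1)] obtain \<delta> where \<delta>: "\<delta> \<in> hom2 C u v" "e \<rhd> \<delta> = \<gamma>" by blast
    have "(p \<cdot> e) \<rhd> \<delta> = \<alpha>" "(q \<cdot> e) \<rhd> \<delta> = \<beta>"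
      using \<gamma>(2,3) by (simp_all add: ty hom2D [OF \<delta>(1)] \<delta>(2))
    with \<delta>(1) show "\<exists>\<delta>. \<delta> \<in> hom2 C u v \<and> (p \<cdot> e) \<rhd> \<delta> = \<alpha> \<and> (q \<cdot> e) \<rhd> \<delta> = \<beta>" by blast
  next
    fix W u v \<gamma> \<delta>
    assume u: "u \<in> hom1 C W K" and v: "v \<in> hom1 C W K"
      and \<gamma>: "\<gamma> \<in> hom2 C u v" and \<delta>: "\<delta> \<in> hom2 C u v"
      and eq: "(p \<cdot> e) \<rhd> \<gamma> = (p \<cdot> e) \<rhd> \<delta>" "(q \<cdot> e) \<rhd> \<gamma> = (q \<cdot> e) \<rhd> \<delta>"
    note ty = ty2 hom1D [OF u] hom1D [OF v] hom2D [OF \<gamma>] hom2D [OF \<delta>]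
    have "e \<rhd> \<gamma> = e \<rhd> \<delta>"
      by (rule lift [of "e \<cdot> u" W "e \<cdot> v"]) (use eq in \<open>auto simp: ty hom1_iff hom2_iff\<close>)
    then show "\<gamma> = \<delta>" by (rule faithful [OF u v \<gamma> \<delta>])
  qed
  moreover have "p \<cdot> e \<in> hom1 C K X" "q \<cdot> e \<in> hom1 C K Y" by (auto simp: hom1_iff ty2)
  ultimately show ?thesis unfolding isocomma_square_def by blast
qed

text \<open>The inverses of the two projected cells again satisfy the compatibility condition, so
  they lift to a 2-cell \<open>v \<Rightarrow> u\<close>; joint faithfulness turns the projected
  inverse equations into actual ones.\<close>

lemma universal_square_invertible:
  assumes us: "universal_square Q C p q f g \<theta>"
    and f: "f \<in> hom1 C X Z" and g: "g \<in> hom1 C Y Z" and p: "p \<in> hom1 C P X"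
    and u: "u \<in> hom1 C W P" and v: "v \<in> hom1 C W P" and \<gamma>: "\<gamma> \<in> hom2 C u v"
    and inv: "invertible2 C (p \<rhd> \<gamma>)" "invertible2 C (q \<rhd> \<gamma>)"
  shows "invertible2 C \<gamma>"
proof -
  note q = universal_square_q [OF us f g p] and \<theta> = universal_square_cell [OF us f g p]
  note ty0 = hom1D [OF f] hom1D [OF g] hom1D [OF p] hom1D [OF q] hom2D [OF \<theta>] hom1D [OF u] hom1D [OF v]
    hom2D [OF \<gamma>]
  have p\<gamma>: "p \<rhd> \<gamma> \<in> hom2 C (p \<cdot> u) (p \<cdot> v)" and q\<gamma>: "q \<rhd> \<gamma> \<in> hom2 C (q \<cdot> u) (q \<cdot> v)"
    by (simp_all add: hom2_iff ty0)
  obtain \<alpha> where \<alpha>: "\<alpha> \<in> hom2 C (p \<cdot> v) (p \<cdot> u)" "\<alpha> \<bullet> (p \<rhd> \<gamma>) = id2 C (p \<cdot> u)" "(p \<rhd> \<gamma>) \<bullet> \<alpha> = id2 C (p \<cdot> v)"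
    using invertible2E [OF inv(1) p\<gamma>] .
  obtain \<beta> where \<beta>: "\<beta> \<in> hom2 C (q \<cdot> v) (q \<cdot> u)" "\<beta> \<bullet> (q \<rhd> \<gamma>) = id2 C (q \<cdot> u)" "(q \<rhd> \<gamma>) \<bullet> \<beta> = id2 C (q \<cdot> v)"
    using invertible2E [OF inv(2) q\<gamma>] .
  note ty = ty0 hom2D [OF \<alpha>(1)] hom2D [OF \<beta>(1)]
  have "(\<theta> \<lhd> u) \<bullet> (f \<rhd> \<alpha>) = (g \<rhd> \<beta>) \<bullet> (\<theta> \<lhd> v)"
  proof (rule inverse_square)
    show "f \<rhd> (p \<rhd> \<gamma>) \<in> hom2 C (f \<cdot> p \<cdot> u) (f \<cdot> p \<cdot> v)" "f \<rhd> \<alpha> \<in> hom2 C (f \<cdot> p \<cdot> v) (f \<cdot> p \<cdot> u)"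
      "g \<rhd> (q \<rhd> \<gamma>) \<in> hom2 C (g \<cdot> q \<cdot> u) (g \<cdot> q \<cdot> v)" "g \<rhd> \<beta> \<in> hom2 C (g \<cdot> q \<cdot> v) (g \<cdot> q \<cdot> u)"
      "\<theta> \<lhd> u \<in> hom2 C (f \<cdot> p \<cdot> u) (g \<cdot> q \<cdot> u)" "\<theta> \<lhd> v \<in> hom2 C (f \<cdot> p \<cdot> v) (g \<cdot> q \<cdot> v)"
      by (simp_all add: hom2_iff ty)
    show "(f \<rhd> (p \<rhd> \<gamma>)) \<bullet> (f \<rhd> \<alpha>) = id2 C (f \<cdot> p \<cdot> v)"
      using arg_cong [OF \<alpha>(3), of "\<lambda>x. f \<rhd> x"] by (simp add: ty)
    show "(g \<rhd> \<beta>) \<bullet> (g \<rhd> (q \<rhd> \<gamma>)) = id2 C (g \<cdot> q \<cdot> u)"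
      using arg_cong [OF \<beta>(2), of "\<lambda>x. g \<rhd> x"] by (simp add: ty)
    show "(\<theta> \<lhd> v) \<bullet> (f \<rhd> (p \<rhd> \<gamma>)) = (g \<rhd> (q \<rhd> \<gamma>)) \<bullet> (\<theta> \<lhd> u)"
      using whisker_exchange [of \<gamma> \<theta>] by (simp add: ty)
  qed
  then obtain \<delta> where \<delta>: "\<delta> \<in> hom2 C v u" "p \<rhd> \<delta> = \<alpha>" "q \<rhd> \<delta> = \<beta>"
    using universal_square_lift2 [OF us f g p v u \<alpha>(1) \<beta>(1)] by auto
  note ty = ty hom2D [OF \<delta>(1)]
  show ?thesis
  proof (rule invertible2I [OF \<gamma> \<delta>(1)])
    show "\<delta> \<bullet> \<gamma> = id2 C u"
      by (rule universal_square_cell_eq [OF us f g p u u]) (simp_all add: ty hom2_iff \<delta> \<alpha> \<beta>)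
    show "\<gamma> \<bullet> \<delta> = id2 C v"
      by (rule universal_square_cell_eq [OF us f g p v v]) (simp_all add: ty hom2_iff \<delta> \<alpha> \<beta>)
  qed
qed

section \<open>Strict pullbacks\<close>

lemma
  assumes pb: "pullback C p q f g"
    and p: "p \<in> hom1 C P X" and q: "q \<in> hom1 C P Y" and f: "f \<in> hom1 C X Z" and g: "g \<in> hom1 C Y Z"
  shows pullback_commutes: "f \<cdot> p = g \<cdot> q"
    and pullback_factor: "\<And>W x y. \<lbrakk>x \<in> hom1 C W X; y \<in> hom1 C W Y; f \<cdot> x = g \<cdot> y\<rbrakk>
      \<Longrightarrow> \<exists>u \<in> hom1 C W P. p \<cdot> u = x \<and> q \<cdot> u = y"
    and pullback_lift2: "\<And>W u v \<alpha> \<beta>. \<lbrakk>u \<in> hom1 C W P; v \<in> hom1 C W P;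
        \<alpha> \<in> hom2 C (p \<cdot> u) (p \<cdot> v); \<beta> \<in> hom2 C (q \<cdot> u) (q \<cdot> v); f \<rhd> \<alpha> = g \<rhd> \<beta>\<rbrakk>
      \<Longrightarrow> \<exists>\<gamma> \<in> hom2 C u v. p \<rhd> \<gamma> = \<alpha> \<and> q \<rhd> \<gamma> = \<beta>"
    and pullback_cell_eq: "\<And>W u v \<gamma> \<delta>. \<lbrakk>u \<in> hom1 C W P; v \<in> hom1 C W P;
        \<gamma> \<in> hom2 C u v; \<delta> \<in> hom2 C u v; p \<rhd> \<gamma> = p \<rhd> \<delta>; q \<rhd> \<gamma> = q \<rhd> \<delta>\<rbrakk> \<Longrightarrow> \<gamma> = \<delta>"
proof -
  obtain P' X' Y' Z' where
    *: "p \<in> hom1 C P' X'" "q \<in> hom1 C P' Y'" "f \<in> hom1 C X' Z'" and comm: "f \<cdot> p = g \<cdot> q"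
    and fac': "\<forall>W \<in> Obj C. \<forall>x \<in> hom1 C W X'. \<forall>y \<in> hom1 C W Y'. f \<cdot> x = g \<cdot> y \<longrightarrow>
           (\<exists>!u. u \<in> hom1 C W P' \<and> p \<cdot> u = x \<and> q \<cdot> u = y)"
    and two': "\<forall>W \<in> Obj C. \<forall>u \<in> hom1 C W P'. \<forall>v \<in> hom1 C W P'.
           \<forall>\<alpha> \<in> hom2 C (p \<cdot> u) (p \<cdot> v). \<forall>\<beta> \<in> hom2 C (q \<cdot> u) (q \<cdot> v).
           f \<rhd> \<alpha> = g \<rhd> \<beta> \<longrightarrow> (\<exists>!\<gamma>. \<gamma> \<in> hom2 C u v \<and> p \<rhd> \<gamma> = \<alpha> \<and> q \<rhd> \<gamma> = \<beta>)"
    using pb unfolding pullback_def by blast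
  have eqs: "P' = P" "X' = X" "Y' = Y"
    using * p q f by (simp_all add: hom1_iff)
  have fac: "\<exists>!u. u \<in> hom1 C W P \<and> p \<cdot> u = x \<and> q \<cdot> u = y"
    if "x \<in> hom1 C W X" "y \<in> hom1 C W Y" "f \<cdot> x = g \<cdot> y" for W x y
    using fac' that hom1D(4) [OF that(1)] unfolding eqs by blast
  have two: "\<exists>!\<gamma>. \<gamma> \<in> hom2 C u v \<and> p \<rhd> \<gamma> = \<alpha> \<and> q \<rhd> \<gamma> = \<beta>"
    if "u \<in> hom1 C W P" "v \<in> hom1 C W P" "\<alpha> \<in> hom2 C (p \<cdot> u) (p \<cdot> v)"
      "\<beta> \<in> hom2 C (q \<cdot> u) (q \<cdot> v)" "f \<rhd> \<alpha> = g \<rhd> \<beta>" for W u v \<alpha> \<beta>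
    using two' that hom1D(4) [OF that(1)] unfolding eqs by blast
  show "f \<cdot> p = g \<cdot> q" by fact
  show "\<exists>u \<in> hom1 C W P. p \<cdot> u = x \<and> q \<cdot> u = y"
    if "x \<in> hom1 C W X" "y \<in> hom1 C W Y" "f \<cdot> x = g \<cdot> y" for W x y
    using fac [OF that] by blast
  show "\<exists>\<gamma> \<in> hom2 C u v. p \<rhd> \<gamma> = \<alpha> \<and> q \<rhd> \<gamma> = \<beta>"
    if "u \<in> hom1 C W P" "v \<in> hom1 C W P" "\<alpha> \<in> hom2 C (p \<cdot> u) (p \<cdot> v)"
      "\<beta> \<in> hom2 C (q \<cdot> u) (q \<cdot> v)" "f \<rhd> \<alpha> = g \<rhd> \<beta>" for W u v \<alpha> \<beta>
    using two [OF that] by blast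
  show "\<gamma> = \<delta>" if "u \<in> hom1 C W P" "v \<in> hom1 C W P" "\<gamma> \<in> hom2 C u v" "\<delta> \<in> hom2 C u v"
      "p \<rhd> \<gamma> = p \<rhd> \<delta>" "q \<rhd> \<gamma> = q \<rhd> \<delta>" for W u v \<gamma> \<delta>
  proof -
    note ty = hom1D [OF p] hom1D [OF q] hom1D [OF f] hom1D [OF g]
      hom1D [OF that(1)] hom1D [OF that(2)] hom2D [OF that(4)]
    have "\<exists>!\<gamma>. \<gamma> \<in> hom2 C u v \<and> p \<rhd> \<gamma> = p \<rhd> \<delta> \<and> q \<rhd> \<gamma> = q \<rhd> \<delta>"
    proof (rule two [OF that(1,2)])
      show "f \<rhd> (p \<rhd> \<delta>) = g \<rhd> (q \<rhd> \<delta>)"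
        by (rule whisker_eq_assoc [OF comm]) (simp_all add: ty)
    qed (simp_all add: hom2_iff ty)
    then show ?thesis using that by blast
  qed
qed

text \<open>The commuting square is read as a lax square with identity 2-cell, so that
  \<open>inverse_square\<close> yields \<open>f \<rhd> \<alpha> = g \<rhd> \<beta>\<close> for the
  inverses of the projected cells, and these lift.\<close>

lemma pullback_invertible:
  assumes pb: "pullback C p q f g"
    and p: "p \<in> hom1 C P X" and q: "q \<in> hom1 C P Y" and f: "f \<in> hom1 C X Z" and g: "g \<in> hom1 C Y Z"
    and u: "u \<in> hom1 C W P" and v: "v \<in> hom1 C W P" and \<gamma>: "\<gamma> \<in> hom2 C u v"
    and inv: "invertible2 C (p \<rhd> \<gamma>)" "invertible2 C (q \<rhd> \<gamma>)"
  shows "invertible2 C \<gamma>"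
proof -
  note comm = pullback_commutes [OF pb p q f g]
  note ty0 = hom1D [OF f] hom1D [OF g] hom1D [OF p] hom1D [OF q] hom1D [OF u] hom1D [OF v] hom2D [OF \<gamma>]
  have p\<gamma>: "p \<rhd> \<gamma> \<in> hom2 C (p \<cdot> u) (p \<cdot> v)" and q\<gamma>: "q \<rhd> \<gamma> \<in> hom2 C (q \<cdot> u) (q \<cdot> v)"
    by (simp_all add: hom2_iff ty0)
  obtain \<alpha> where \<alpha>: "\<alpha> \<in> hom2 C (p \<cdot> v) (p \<cdot> u)" "\<alpha> \<bullet> (p \<rhd> \<gamma>) = id2 C (p \<cdot> u)" "(p \<rhd> \<gamma>) \<bullet> \<alpha> = id2 C (p \<cdot> v)"
    using invertible2E [OF inv(1) p\<gamma>] .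
  obtain \<beta> where \<beta>: "\<beta> \<in> hom2 C (q \<cdot> v) (q \<cdot> u)" "\<beta> \<bullet> (q \<rhd> \<gamma>) = id2 C (q \<cdot> u)" "(q \<rhd> \<gamma>) \<bullet> \<beta> = id2 C (q \<cdot> v)"
    using invertible2E [OF inv(2) q\<gamma>] .
  note ty = ty0 hom2D [OF \<alpha>(1)] hom2D [OF \<beta>(1)]
  have comm': "f \<cdot> p \<cdot> u = g \<cdot> q \<cdot> u" "f \<cdot> p \<cdot> v = g \<cdot> q \<cdot> v" "f \<rhd> (p \<rhd> \<gamma>) = g \<rhd> (q \<rhd> \<gamma>)"
    by (rule comp1_eq_assoc [OF comm] whisker_eq_assoc [OF comm]; simp add: ty)+
  have "id2 C (g \<cdot> q \<cdot> u) \<bullet> (f \<rhd> \<alpha>) = (g \<rhd> \<beta>) \<bullet> id2 C (g \<cdot> q \<cdot> v)"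
  proof (rule inverse_square)
    show "f \<rhd> (p \<rhd> \<gamma>) \<in> hom2 C (f \<cdot> p \<cdot> u) (f \<cdot> p \<cdot> v)" "f \<rhd> \<alpha> \<in> hom2 C (f \<cdot> p \<cdot> v) (f \<cdot> p \<cdot> u)"
      "g \<rhd> (q \<rhd> \<gamma>) \<in> hom2 C (g \<cdot> q \<cdot> u) (g \<cdot> q \<cdot> v)" "g \<rhd> \<beta> \<in> hom2 C (g \<cdot> q \<cdot> v) (g \<cdot> q \<cdot> u)"
      "id2 C (g \<cdot> q \<cdot> u) \<in> hom2 C (f \<cdot> p \<cdot> u) (g \<cdot> q \<cdot> u)" "id2 C (g \<cdot> q \<cdot> v) \<in> hom2 C (f \<cdot> p \<cdot> v) (g \<cdot> q \<cdot> v)"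
      by (simp_all add: hom2_iff ty comm')
    show "(f \<rhd> (p \<rhd> \<gamma>)) \<bullet> (f \<rhd> \<alpha>) = id2 C (f \<cdot> p \<cdot> v)"
      using arg_cong [OF \<alpha>(3), of "\<lambda>x. f \<rhd> x"] by (simp add: ty)
    show "(g \<rhd> \<beta>) \<bullet> (g \<rhd> (q \<rhd> \<gamma>)) = id2 C (g \<cdot> q \<cdot> u)"
      using arg_cong [OF \<beta>(2), of "\<lambda>x. g \<rhd> x"] by (simp add: ty)
    show "id2 C (g \<cdot> q \<cdot> v) \<bullet> (f \<rhd> (p \<rhd> \<gamma>)) = (g \<rhd> (q \<rhd> \<gamma>)) \<bullet> id2 C (g \<cdot> q \<cdot> u)"
      by (simp add: ty comm')
  qed
  then have "f \<rhd> \<alpha> = g \<rhd> \<beta>" by (simp add: ty comm')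
  then obtain \<delta> where \<delta>: "\<delta> \<in> hom2 C v u" "p \<rhd> \<delta> = \<alpha>" "q \<rhd> \<delta> = \<beta>"
    using pullback_lift2 [OF pb p q f g v u \<alpha>(1) \<beta>(1)] by auto
  note ty = ty hom2D [OF \<delta>(1)]
  show ?thesis
  proof (rule invertible2I [OF \<gamma> \<delta>(1)])
    show "\<delta> \<bullet> \<gamma> = id2 C u"
      by (rule pullback_cell_eq [OF pb p q f g u u]) (simp_all add: ty hom2_iff \<delta> \<alpha> \<beta>)
    show "\<gamma> \<bullet> \<delta> = id2 C v"
      by (rule pullback_cell_eq [OF pb p q f g v v]) (simp_all add: ty hom2_iff \<delta> \<alpha> \<beta>)
  qed
qed


section \<open>Transfer of left Kan extensions\<close>

text \<open>The bijection required along \<open>t \<cdot> v\<close> is the one for \<open>l\<close>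
  along \<open>t\<close> followed by restriction along \<open>v\<close>. The transfer thus reduces
  to the second map.\<close>

lemma left_kan_restrict_bij:
  assumes v: "v \<in> hom1 C D D'" and t: "t \<in> hom1 C D' Z" and e: "e \<in> hom1 C D' K"
    and kan: "left_kan C t e l \<eta>"
    and bij: "\<And>k. k \<in> hom1 C Z K \<Longrightarrow>
      bij_betw (\<lambda>\<xi>. \<xi> \<lhd> v) (hom2 C e (k \<cdot> t)) (hom2 C (e \<cdot> v) (k \<cdot> (t \<cdot> v)))"
  shows "left_kan C (t \<cdot> v) (e \<cdot> v) l (\<eta> \<lhd> v)"
proof -
  have l: "l \<in> hom1 C Z K" and \<eta>: "\<eta> \<in> hom2 C e (l \<cdot> t)"
    and univ: "\<And>k. k \<in> hom1 C Z K \<Longrightarrow>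
      bij_betw (\<lambda>\<delta>. (\<delta> \<lhd> t) \<bullet> \<eta>) (hom2 C l k) (hom2 C e (k \<cdot> t))"
    using kan t e unfolding left_kan_def by (auto simp: hom1_def)
  note ty = hom1D [OF v] hom1D [OF t] hom1D [OF e] hom1D [OF l] hom2D [OF \<eta>]
  show ?thesis
    unfolding left_kan_def
  proof (intro exI conjI ballI)
    show "t \<cdot> v \<in> hom1 C D Z" "e \<cdot> v \<in> hom1 C D K" "\<eta> \<lhd> v \<in> hom2 C (e \<cdot> v) (l \<cdot> t \<cdot> v)"
      by (auto simp: hom1_iff hom2_iff ty)
    show "l \<in> hom1 C Z K" by fact
    fix k assume k: "k \<in> hom1 C Z K"
    have "bij_betw ((\<lambda>\<xi>. \<xi> \<lhd> v) \<circ> (\<lambda>\<delta>. (\<delta> \<lhd> t) \<bullet> \<eta>)) (hom2 C l k) (hom2 C (e \<cdot> v) (k \<cdot> t \<cdot> v))"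
      using bij_betw_trans [OF univ [OF k] bij [OF k]] .
    then show "bij_betw (\<lambda>\<delta>. (\<delta> \<lhd> (t \<cdot> v)) \<bullet> (\<eta> \<lhd> v)) (hom2 C l k) (hom2 C (e \<cdot> v) (k \<cdot> t \<cdot> v))"
      by (rule bij_betw_cong [THEN iffD1, rotated]) (auto simp: hom2_iff ty hom1D [OF k])
  qed
qed

text \<open>
  Restriction along \<open>v\<close> is a bijection from 2-cells \<open>e \<Rightarrow> k \<cdot> t\<close> to 2-cells \<open>e \<cdot> v \<Rightarrow> k \<cdot> t \<cdot> v\<close>, with
  inverse \<open>\<zeta> \<mapsto> (\<zeta> \<lhd> r) \<bullet> (e \<rhd> n)\<close>; no counit \<open>r \<cdot> v \<Rightarrow> 1\<close> is involved, so \<open>r\<close> need not be adjoint to \<open>v\<close>.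
\<close>

lemma left_kan_restrict:
  assumes v: "v \<in> hom1 C D D'" and r: "r \<in> hom1 C D' D"
    and n: "n \<in> hom2 C (id1 C D') (v \<cdot> r)" and b: "b \<in> hom2 C (id1 C D) (r \<cdot> v)"
    and vb: "v \<rhd> b = n \<lhd> v" and tn: "t \<rhd> n = id2 C t"
    and t: "t \<in> hom1 C D' Z" and e: "e \<in> hom1 C D' K" and kan: "left_kan C t e l \<eta>"
  shows "left_kan C (t \<cdot> v) (e \<cdot> v) l (\<eta> \<lhd> v)"
proof (rule left_kan_restrict_bij [OF v t e kan])
  fix k assume k: "k \<in> hom1 C Z K"
  note ty = hom1D [OF v] hom1D [OF t] hom1D [OF e] hom1D [OF r] hom2D [OF n] hom2D [OF b] hom1D [OF k]
  \<comment> \<open>An identity 2-cell has equal source and target, so \<open>tn\<close> contains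
    the equation \<open>t \<cdot> (v \<cdot> r) = t\<close> of 1-cells, by which
    \<open>\<zeta> \<lhd> r\<close> ends at \<open>k \<cdot> t\<close>.\<close>
  have "tgt C (t \<rhd> n) = tgt C (id2 C t)" by (simp add: tn)
  then have tvr: "t \<cdot> (v \<cdot> r) = t" by (simp add: ty)
  have tvr': "t \<cdot> (v \<cdot> (r \<cdot> v)) = t \<cdot> v"
    using arg_cong [OF tvr, of "\<lambda>f. f \<cdot> v"] by (simp add: ty)
  show "bij_betw (\<lambda>\<xi>. \<xi> \<lhd> v) (hom2 C e (k \<cdot> t)) (hom2 C (e \<cdot> v) (k \<cdot> (t \<cdot> v)))"
  proof (rule bij_betw_byWitness [where f' = "\<lambda>\<zeta>. (\<zeta> \<lhd> r) \<bullet> (e \<rhd> n)"])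
    show "\<forall>\<xi> \<in> hom2 C e (k \<cdot> t). ((\<xi> \<lhd> v) \<lhd> r) \<bullet> (e \<rhd> n) = \<xi>"
    proof
      fix \<xi> assume \<xi>: "\<xi> \<in> hom2 C e (k \<cdot> t)"
      show "((\<xi> \<lhd> v) \<lhd> r) \<bullet> (e \<rhd> n) = \<xi>"
        using whisker_exchange [of n \<xi>] by (simp add: ty hom2D [OF \<xi>] tn tvr)
    qed
    show "\<forall>\<zeta> \<in> hom2 C (e \<cdot> v) (k \<cdot> (t \<cdot> v)). ((\<zeta> \<lhd> r) \<bullet> (e \<rhd> n)) \<lhd> v = \<zeta>"
    proof
      fix \<zeta> assume \<zeta>: "\<zeta> \<in> hom2 C (e \<cdot> v) (k \<cdot> (t \<cdot> v))"
      \<comment> \<open>By \<open>vb\<close> the cell \<open>e \<rhd> (n \<lhd> v)\<close> is a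
        whiskering of \<open>b\<close>, so the exchange law moves \<open>\<zeta>\<close> past
        \<open>b\<close>. What remains besides \<open>\<zeta>\<close> is
        \<open>k \<rhd> (t \<rhd> (n \<lhd> v))\<close>, an identity.\<close>
      have "t \<rhd> (n \<lhd> v) = id2 C (t \<cdot> v)"
        using arg_cong [OF tn, of "\<lambda>\<alpha>. \<alpha> \<lhd> v"] by (simp add: ty)
      then show "((\<zeta> \<lhd> r) \<bullet> (e \<rhd> n)) \<lhd> v = \<zeta>"
        using whisker_exchange [of b \<zeta>] by (simp add: ty hom2D [OF \<zeta>] vb)
    qed
  qed (auto simp: hom2_iff ty tvr)
qed

text \<open>Here \<open>c\<close> plays the part of the counit of a coreflection onto
  \<open>D\<close>, and it is \<open>e\<close> rather than \<open>t\<close> that sends the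
  structural cell to an identity. The inverse of restriction is \<open>\<zeta> \<mapsto> ((k \<cdot>
  t) \<rhd> c) \<bullet> (\<zeta> \<lhd> m)\<close>.\<close>

lemma left_kan_restrict_coreflection:
  assumes v: "v \<in> hom1 C D D'" and m: "m \<in> hom1 C D' D"
    and mv: "m \<cdot> v = id1 C D" and c: "c \<in> hom2 C (v \<cdot> m) (id1 C D')"
    and cv: "c \<lhd> v = id2 C v" and ec: "e \<rhd> c = id2 C e"
    and t: "t \<in> hom1 C D' Z" and e: "e \<in> hom1 C D' K" and kan: "left_kan C t e l \<eta>"
  shows "left_kan C (t \<cdot> v) (e \<cdot> v) l (\<eta> \<lhd> v)"
proof (rule left_kan_restrict_bij [OF v t e kan])
  fix k assume k: "k \<in> hom1 C Z K"
  note ty = hom1D [OF v] hom1D [OF t] hom1D [OF e] hom1D [OF m] hom2D [OF c] hom1D [OF k]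
  have "src C (e \<rhd> c) = src C (id2 C e)" by (simp add: ec)
  then have evm: "e \<cdot> (v \<cdot> m) = e" by (simp add: ty)
  show "bij_betw (\<lambda>\<xi>. \<xi> \<lhd> v) (hom2 C e (k \<cdot> t)) (hom2 C (e \<cdot> v) (k \<cdot> (t \<cdot> v)))"
  proof (rule bij_betw_byWitness [where f' = "\<lambda>\<zeta>. ((k \<cdot> t) \<rhd> c) \<bullet> (\<zeta> \<lhd> m)"])
    show "\<forall>\<xi> \<in> hom2 C e (k \<cdot> t). ((k \<cdot> t) \<rhd> c) \<bullet> ((\<xi> \<lhd> v) \<lhd> m) = \<xi>"
    proof
      fix \<xi> assume \<xi>: "\<xi> \<in> hom2 C e (k \<cdot> t)"
      show "((k \<cdot> t) \<rhd> c) \<bullet> ((\<xi> \<lhd> v) \<lhd> m) = \<xi>"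
        using whisker_exchange [of c \<xi>] by (simp add: ty hom2D [OF \<xi>] ec)
    qed
    show "\<forall>\<zeta> \<in> hom2 C (e \<cdot> v) (k \<cdot> (t \<cdot> v)). (((k \<cdot> t) \<rhd> c) \<bullet> (\<zeta> \<lhd> m)) \<lhd> v = \<zeta>"
    proof
      fix \<zeta> assume \<zeta>: "\<zeta> \<in> hom2 C (e \<cdot> v) (k \<cdot> (t \<cdot> v))"
      show "(((k \<cdot> t) \<rhd> c) \<bullet> (\<zeta> \<lhd> m)) \<lhd> v = \<zeta>"
        by (simp add: ty hom2D [OF \<zeta>] cv mv)
    qed
  qed (auto simp: hom2_iff ty evm)
qed

text \<open>The identity square at \<open>q\<close> embeds \<open>P\<close> into the comma object
  \<open>D\<close> by a 1-cell \<open>i\<close> that is left adjoint to the projection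
  \<open>d\<close>. Restricting the given extension along \<open>i\<close> returns the plain
  extension along \<open>q\<close>.\<close>

lemma left_kan_of_comma_id:
  assumes q: "q \<in> hom1 C P Y" and h: "h \<in> hom1 C P K" and l: "l \<in> hom1 C Y K" and \<psi>: "\<psi> \<in> hom2 C h (l \<cdot> q)"
    and d: "d \<in> hom1 C D P" and cs: "comma_square C d z q (id1 C Y) \<mu>"
    and kan: "left_kan C z (h \<cdot> d) (l \<cdot> id1 C Y) ((l \<rhd> \<mu>) \<bullet> (\<psi> \<lhd> d))"
  shows "left_kan C q h l \<psi>"
proof -
  note us = cs [unfolded comma_square_def]
  have one: "id1 C Y \<in> hom1 C Y Y" using hom1D [OF l] by (simp add: hom1_iff)
  note z = universal_square_q [OF us q one d] and \<mu> = universal_square_cell [OF us q one d]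
  have "\<mu> \<in> hom2 C (q \<cdot> d) z" using \<mu> hom1D [OF z] hom1D [OF l] by simp
  note ty0 = hom1D [OF q] hom1D [OF h] hom1D [OF l] hom2D [OF \<psi>] hom1D [OF d] hom1D [OF z] hom2D [OF this]
  have "\<exists>i \<in> hom1 C P D. d \<cdot> i = id1 C P \<and> z \<cdot> i = q \<and> \<mu> \<lhd> i = id2 C q"
    by (rule universal_square_factor [OF us q one d]) (simp_all add: hom1_iff hom2_iff ty0)
  then obtain i where i: "i \<in> hom1 C P D" "d \<cdot> i = id1 C P" "z \<cdot> i = q" "\<mu> \<lhd> i = id2 C q"
    by blast
  have i': "d \<cdot> i \<cdot> d = d" "z \<cdot> i \<cdot> d = q \<cdot> d" "\<mu> \<lhd> (i \<cdot> d) = id2 C (q \<cdot> d)"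
    using arg_cong [OF i(2), of "\<lambda>f. f \<cdot> d"] arg_cong [OF i(3), of "\<lambda>f. f \<cdot> d"]
      arg_cong [OF i(4), of "\<lambda>\<gamma>. \<gamma> \<lhd> d"] by (simp_all add: ty0 hom1D [OF i(1)])
  note ty1 = ty0 hom1D [OF i(1)] i(2-4) i'
  \<comment> \<open>A generic object of \<open>D\<close> is the 2-cell \<open>\<mu>\<close> out of
    \<open>q \<cdot> d\<close>; the square from the identity of \<open>q \<cdot> d\<close> to
    \<open>\<mu>\<close> has an identity and \<open>\<mu>\<close> itself as components.\<close>
  have "\<exists>c \<in> hom2 C (i \<cdot> d) (id1 C D). d \<rhd> c = id2 C d \<and> z \<rhd> c = \<mu>"
    by (rule universal_square_lift2 [OF us q one d, of _ D]) (simp_all add: hom1_iff hom2_iff ty1)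
  then obtain c where c: "c \<in> hom2 C (i \<cdot> d) (id1 C D)" "d \<rhd> c = id2 C d" "z \<rhd> c = \<mu>"
    by blast
  note ty = ty1 hom2D [OF c(1)]
  have c': "d \<rhd> (c \<lhd> i) = id2 C (d \<cdot> i)" "z \<rhd> (c \<lhd> i) = id2 C (z \<cdot> i)"
    using arg_cong [OF c(2), of "\<lambda>\<gamma>. \<gamma> \<lhd> i"] arg_cong [OF c(3), of "\<lambda>\<gamma>. \<gamma> \<lhd> i"] by (simp_all add: ty)
  have ci: "c \<lhd> i = id2 C i"
    by (rule universal_square_cell_eq [OF us q one d i(1) i(1)])
      (use c' in \<open>simp_all add: hom2_iff ty\<close>)
  have "left_kan C (z \<cdot> i) ((h \<cdot> d) \<cdot> i) (l \<cdot> id1 C Y) (((l \<rhd> \<mu>) \<bullet> (\<psi> \<lhd> d)) \<lhd> i)"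
    by (rule left_kan_restrict_coreflection [OF i(1) d i(2) c(1) ci _ z _ kan])
      (simp_all add: hom1_iff ty c)
  then show ?thesis by (simp add: ty)
qed

text \<open>
  The comma object \<open>D\<close> of \<open>q\<close> and \<open>k\<close> maps to the comma object \<open>D'\<close> of \<open>f\<close> and \<open>g \<cdot> k\<close>; left extensions
  along \<open>D' \<rightarrow> V\<close> restrict along this map to left extensions along \<open>D \<rightarrow> V\<close>.
\<close>

lemma exact_squareI:
  assumes fc: "finitely_complete C"
    and p: "p \<in> hom1 C P X" and q: "q \<in> hom1 C P Y" and f: "f \<in> hom1 C X Z" and g: "g \<in> hom1 C Y Z"
    and \<phi>: "\<phi> \<in> hom2 C (f \<cdot> p) (g \<cdot> q)"
    and comparison: "\<And>V k D d z \<mu> D' x z' \<theta>. \<lbrakk>k \<in> hom1 C V Y;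
        d \<in> hom1 C D P; z \<in> hom1 C D V; comma_square C d z q k \<mu>;
        x \<in> hom1 C D' X; z' \<in> hom1 C D' V; comma_square C x z' f (g \<cdot> k) \<theta>\<rbrakk>
      \<Longrightarrow> \<exists>v r n b. v \<in> hom1 C D D' \<and> r \<in> hom1 C D' D \<and>
        n \<in> hom2 C (id1 C D') (v \<cdot> r) \<and> b \<in> hom2 C (id1 C D) (r \<cdot> v) \<and>
        x \<cdot> v = p \<cdot> d \<and> z' \<cdot> v = z \<and> \<theta> \<lhd> v = (g \<rhd> \<mu>) \<bullet> (\<phi> \<lhd> d) \<and>
        v \<rhd> b = n \<lhd> v \<and> z' \<rhd> n = id2 C z'"
  shows "exact_square C p q f g \<phi>"
  unfolding exact_square_def
proof (intro conjI allI impI)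
  show "lax_square C p q f g \<phi>"
    unfolding lax_square_def using p q f g \<phi> by blast
  fix h l \<psi>
  assume pw: "pointwise_left_kan C f h l \<psi>"
  then obtain K where h: "h \<in> hom1 C X K" and l: "l \<in> hom1 C Z K" and \<psi>: "\<psi> \<in> hom2 C h (l \<cdot> f)"
    using f unfolding pointwise_left_kan_def left_kan_def by (auto simp: hom1_iff)
  note ty0 = hom1D [OF p] hom1D [OF q] hom1D [OF f] hom1D [OF g] hom2D [OF \<phi>] hom1D [OF h] hom1D [OF l]
    hom2D [OF \<psi>]
  let ?\<psi> = "(l \<rhd> \<phi>) \<bullet> (\<psi> \<lhd> p)"
  have *: "left_kan C z ((h \<cdot> p) \<cdot> d) ((l \<cdot> g) \<cdot> k) (((l \<cdot> g) \<rhd> \<mu>) \<bullet> (?\<psi> \<lhd> d))"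
    if k: "k \<in> hom1 C V Y" and d: "d \<in> hom1 C D P" and z: "z \<in> hom1 C D V"
      and cs: "comma_square C d z q k \<mu>" for k V d D z \<mu>
  proof -
    note \<mu> = universal_square_cell [OF cs [unfolded comma_square_def] q k d]
    have gk: "g \<cdot> k \<in> hom1 C V Z" using hom1D [OF g] hom1D [OF k] by (simp add: hom1_iff)
    obtain D' x z' \<theta> where x: "x \<in> hom1 C D' X" and z': "z' \<in> hom1 C D' V"
      and cs': "comma_square C x z' f (g \<cdot> k) \<theta>"
      using comma_square_exists [OF fc f gk] by blast
    note \<theta> = universal_square_cell [OF cs' [unfolded comma_square_def] f gk x]
    obtain v r n b where v: "v \<in> hom1 C D D'" and r: "r \<in> hom1 C D' D"
      and n: "n \<in> hom2 C (id1 C D') (v \<cdot> r)" and b: "b \<in> hom2 C (id1 C D) (r \<cdot> v)"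
      and vx: "x \<cdot> v = p \<cdot> d" and vz: "z' \<cdot> v = z" and v\<theta>: "\<theta> \<lhd> v = (g \<rhd> \<mu>) \<bullet> (\<phi> \<lhd> d)"
      and vb: "v \<rhd> b = n \<lhd> v" and zn: "z' \<rhd> n = id2 C z'"
      using comparison [OF k d z cs x z' cs'] by blast
    note ty = ty0 hom1D [OF k] hom1D [OF d] hom1D [OF z] hom2D [OF \<mu>] hom1D [OF x] hom1D [OF z']
      hom2D [OF \<theta>] hom1D [OF v]
    have kan: "left_kan C z' (h \<cdot> x) (l \<cdot> (g \<cdot> k)) ((l \<rhd> \<theta>) \<bullet> (\<psi> \<lhd> x))"
      using pw cs' unfolding pointwise_left_kan_def by blast
    have "h \<cdot> x \<in> hom1 C D' K" by (simp add: hom1_iff ty)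
    from left_kan_restrict [OF v r n b vb zn z' this kan] show ?thesis
      by (simp add: ty vx vz v\<theta>)
  qed
  show "pointwise_left_kan C q (h \<cdot> p) (l \<cdot> g) ?\<psi>"
    unfolding pointwise_left_kan_def
  proof (intro conjI allI impI)
    \<comment> \<open>The plain extension along \<open>q\<close> is the case where \<open>k\<close>
      is the identity of \<open>Y\<close>.\<close>
    have one: "id1 C Y \<in> hom1 C Y Y" using hom1D [OF q] by (simp add: hom1_iff)
    obtain D d z \<mu> where d: "d \<in> hom1 C D P" and z: "z \<in> hom1 C D Y"
      and cs: "comma_square C d z q (id1 C Y) \<mu>"
      using comma_square_exists [OF fc q one] by blast
    show "left_kan C q (h \<cdot> p) (l \<cdot> g) ?\<psi>"
      by (rule left_kan_of_comma_id [OF q _ _ _ d cs * [OF one d z cs]])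
        (simp_all add: hom1_iff hom2_iff ty0)
  next
    fix k d z \<mu>
    assume cs: "comma_square C d z q k \<mu>"
    then obtain D P' Y' V where "d \<in> hom1 C D P'" "z \<in> hom1 C D V" "q \<in> hom1 C P' Y'" "k \<in> hom1 C V Y'"
      unfolding comma_square_def universal_square_def lax_square_def by blast
    moreover from this q have "P' = P" "Y' = Y" by (simp_all add: hom1_iff)
    ultimately show "left_kan C z ((h \<cdot> p) \<cdot> d) ((l \<cdot> g) \<cdot> k) (((l \<cdot> g) \<rhd> \<mu>) \<bullet> (?\<psi> \<lhd> d))"
      using * cs by blast
  qed
qed

end


section \<open>Isofibrations over a groupoidal object\<close>

text \<open>The representable notion: composition with \<open>p\<close> is an isofibration of
  hom-categories from each object. Lifts are merely asked to exist, as no choice of them has to be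
  respected.\<close>

definition isofibration :: "('o, 'a, 'c) two_cat \<Rightarrow> 'a \<Rightarrow> bool" where
  "isofibration C p \<longleftrightarrow> p \<in> Arr C \<and>
     (\<forall>x \<in> Arr C. \<forall>\<beta> \<in> Cell C.
        cod1 C x = dom1 C p \<and> src C \<beta> = p \<cdot>\<^bsub>C\<^esub> x \<and> invertible2 C \<beta> \<longrightarrow>
        (\<exists>\<chi> \<in> Cell C. src C \<chi> = x \<and> invertible2 C \<chi> \<and> p \<rhd>\<^bsub>C\<^esub> \<chi> = \<beta>))"

text \<open>Factoring \<open>id2 C x\<close> through the opcartesian lift over the inverse of
  \<open>\<beta>\<close> gives a left inverse \<open>\<delta>\<close>. It is also a right inverse:
  the lift composed with \<open>\<delta>\<close> and the identity both factor the lift through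
  itself over an identity.\<close>

lemma (in two_category) split_opfibration_isofibration:
  assumes "split_opfibration C p \<kappa>"
  shows "isofibration C p"
  unfolding isofibration_def
proof (intro conjI ballI impI)
  show p: "p \<in> Arr C" using assms unfolding split_opfibration_def by blast
  fix x \<beta>
  assume x: "x \<in> Arr C" and \<beta>: "\<beta> \<in> Cell C"
    and *: "cod1 C x = dom1 C p \<and> src C \<beta> = p \<cdot> x \<and> invertible2 C \<beta>"
  let ?\<chi> = "\<kappa> x \<beta>"
  have "opliftable C p x \<beta>" using x \<beta> * by (simp add: opliftable_def)
  then have src: "src C ?\<chi> = x" and p\<chi>: "p \<rhd> ?\<chi> = \<beta>" and opc: "opcartesian C p ?\<chi>"
    using assms unfolding split_opfibration_def by blast+
  have \<chi>: "?\<chi> \<in> Cell C" using opc unfolding opcartesian_def by blast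
  have univ: "\<exists>!\<delta>. \<delta> \<in> hom2 C (tgt C ?\<chi>) b \<and> p \<rhd> \<delta> = \<beta>' \<and> \<delta> \<bullet> ?\<chi> = \<gamma>"
    if "\<gamma> \<in> hom2 C x b" "\<beta>' \<in> hom2 C (p \<cdot> tgt C ?\<chi>) (p \<cdot> b)" "\<beta>' \<bullet> \<beta> = p \<rhd> \<gamma>" for b \<gamma> \<beta>'
    using opc that unfolding opcartesian_def src p\<chi> by blast
  note ty = p x \<beta> * \<chi> src p\<chi> Cell_typing(2-4) [OF \<chi>]
  have tgt: "tgt C \<beta> = p \<cdot> tgt C ?\<chi>"
    using arg_cong [OF p\<chi>, of "tgt C"] by (simp add: ty del: p\<chi>)
  obtain \<beta>' where \<beta>': "\<beta>' \<in> hom2 C (p \<cdot> tgt C ?\<chi>) (p \<cdot> x)" "\<beta>' \<bullet> \<beta> = id2 C (p \<cdot> x)"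
    "\<beta> \<bullet> \<beta>' = id2 C (p \<cdot> tgt C ?\<chi>)"
    by (rule invertible2E [of \<beta> "p \<cdot> x" "p \<cdot> tgt C ?\<chi>"]) (use * \<beta> tgt in \<open>auto simp: hom2_iff\<close>)
  have "\<exists>!\<delta>. \<delta> \<in> hom2 C (tgt C ?\<chi>) x \<and> p \<rhd> \<delta> = \<beta>' \<and> \<delta> \<bullet> ?\<chi> = id2 C x"
    by (rule univ) (simp_all add: ty \<beta>' hom2_iff hom2D [OF \<beta>'(1)])
  then obtain \<delta> where \<delta>: "\<delta> \<in> hom2 C (tgt C ?\<chi>) x" "p \<rhd> \<delta> = \<beta>'" "\<delta> \<bullet> ?\<chi> = id2 C x" by blast
  have "\<exists>!\<epsilon>. \<epsilon> \<in> hom2 C (tgt C ?\<chi>) (tgt C ?\<chi>) \<and> p \<rhd> \<epsilon> = id2 C (p \<cdot> tgt C ?\<chi>) \<and> \<epsilon> \<bullet> ?\<chi> = ?\<chi>"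
    by (rule univ) (simp_all add: ty hom2_iff tgt)
  moreover have "?\<chi> \<bullet> \<delta> \<in> hom2 C (tgt C ?\<chi>) (tgt C ?\<chi>)" "p \<rhd> (?\<chi> \<bullet> \<delta>) = id2 C (p \<cdot> tgt C ?\<chi>)"
    "(?\<chi> \<bullet> \<delta>) \<bullet> ?\<chi> = ?\<chi>"
    by (simp_all add: ty hom2_iff hom2D [OF \<delta>(1)] \<delta>(2,3) \<beta>')
  moreover have "id2 C (tgt C ?\<chi>) \<in> hom2 C (tgt C ?\<chi>) (tgt C ?\<chi>)"
    "p \<rhd> id2 C (tgt C ?\<chi>) = id2 C (p \<cdot> tgt C ?\<chi>)" "id2 C (tgt C ?\<chi>) \<bullet> ?\<chi> = ?\<chi>"
    by (simp_all add: ty hom2_iff)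
  ultimately have \<chi>\<delta>: "?\<chi> \<bullet> \<delta> = id2 C (tgt C ?\<chi>)" by blast
  have "invertible2 C ?\<chi>"
    by (rule invertible2I [OF _ \<delta>(1) \<delta>(3) \<chi>\<delta>]) (simp add: hom2_iff ty)
  then show "\<exists>\<chi> \<in> Cell C. src C \<chi> = x \<and> invertible2 C \<chi> \<and> p \<rhd> \<chi> = \<beta>"
    using \<chi> src p\<chi> by blast
qed

text \<open>
  For \<open>f : X \<rightarrow> Y\<close> in \<open>A\<close> this is used with \<open>p = T t\<^sub>X\<close>, \<open>p' = T t\<^sub>Y\<close>, \<open>F = T f\<close>, \<open>g = \<phi>\<^sub>1\<close>, \<open>a = \<phi>\<^sub>X\<close>,
  \<open>a' = \<phi>\<^sub>Y\<close>, \<open>c = S t\<^sub>X\<close>, \<open>c' = S t\<^sub>Y\<close> and \<open>s = S f\<close>.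
\<close>

locale isofibration_pullback_square = two_category C for C :: "('o, 'a, 'c) two_cat" (structure) +
  fixes E E' P P' G H :: 'o and p p' F g a c a' c' s :: 'a
  assumes p: "p \<in> hom1 C E G" and p': "p' \<in> hom1 C E' G" and F: "F \<in> hom1 C E E'"
    and g: "g \<in> hom1 C H G" and a: "a \<in> hom1 C P E" and c: "c \<in> hom1 C P H"
    and a': "a' \<in> hom1 C P' E'" and c': "c' \<in> hom1 C P' H" and s: "s \<in> hom1 C P P'"
    and p'_F: "p' \<cdot> F = p" and a'_s: "a' \<cdot> s = F \<cdot> a" and c'_s: "c' \<cdot> s = c"
    and isofibration_p: "isofibration C p" and groupoidal_G: "groupoidal C G"
    and pb: "pullback C a c p g" and pb': "pullback C a' c' p' g"
begin

section \<open>Equations of the configuration over \<open>G\<close>\<close>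

lemmas p_a = pullback_commutes [OF pb a c p g]
lemmas p'_a' = pullback_commutes [OF pb' a' c' p' g]

lemmas typing = hom1D [OF p] hom1D [OF p'] hom1D [OF F] hom1D [OF g] hom1D [OF a] hom1D [OF c]
  hom1D [OF a'] hom1D [OF c'] hom1D [OF s]

lemmas square_eqs = p_a p'_a' p'_F a'_s c'_s

lemma square_assoc:
  "\<lbrakk>u \<in> Arr C; cod1 C u = P\<rbrakk> \<Longrightarrow> p \<cdot> (a \<cdot> u) = g \<cdot> (c \<cdot> u)"
  "\<lbrakk>u \<in> Arr C; cod1 C u = P'\<rbrakk> \<Longrightarrow> p' \<cdot> (a' \<cdot> u) = g \<cdot> (c' \<cdot> u)"
  "\<lbrakk>u \<in> Arr C; cod1 C u = E\<rbrakk> \<Longrightarrow> p' \<cdot> (F \<cdot> u) = p \<cdot> u"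
  "\<lbrakk>u \<in> Arr C; cod1 C u = P\<rbrakk> \<Longrightarrow> a' \<cdot> (s \<cdot> u) = F \<cdot> (a \<cdot> u)"
  "\<lbrakk>u \<in> Arr C; cod1 C u = P\<rbrakk> \<Longrightarrow> c' \<cdot> (s \<cdot> u) = c \<cdot> u"
  "\<lbrakk>\<alpha> \<in> Cell C; cod1 C (src C \<alpha>) = P\<rbrakk> \<Longrightarrow> p \<rhd> (a \<rhd> \<alpha>) = g \<rhd> (c \<rhd> \<alpha>)"
  "\<lbrakk>\<alpha> \<in> Cell C; cod1 C (src C \<alpha>) = P'\<rbrakk> \<Longrightarrow> p' \<rhd> (a' \<rhd> \<alpha>) = g \<rhd> (c' \<rhd> \<alpha>)"
  "\<lbrakk>\<alpha> \<in> Cell C; cod1 C (src C \<alpha>) = E\<rbrakk> \<Longrightarrow> p' \<rhd> (F \<rhd> \<alpha>) = p \<rhd> \<alpha>"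
  "\<lbrakk>\<alpha> \<in> Cell C; cod1 C (src C \<alpha>) = P\<rbrakk> \<Longrightarrow> a' \<rhd> (s \<rhd> \<alpha>) = F \<rhd> (a \<rhd> \<alpha>)"
  "\<lbrakk>\<alpha> \<in> Cell C; cod1 C (src C \<alpha>) = P\<rbrakk> \<Longrightarrow> c' \<rhd> (s \<rhd> \<alpha>) = c \<rhd> \<alpha>"
  using comp1_eqD [OF p_a] comp1_eqD [OF p'_a'] comp1_eqD [OF p'_F] comp1_eqD [OF a'_s] comp1_eqD [OF c'_s]
  by (simp_all add: typing)

lemmas square_simps = typing square_eqs square_assoc

text \<open>The target of the lift of \<open>\<beta>\<close> agrees with \<open>h\<close> over
  \<open>G\<close>, so the two together are a 1-cell \<open>w\<close> into the pullback
  \<open>P\<close>.\<close>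

lemma lift_invertible:
  assumes x: "x \<in> hom1 C W E" and h: "h \<in> hom1 C W H"
    and \<beta>: "\<beta> \<in> hom2 C (p \<cdot> x) (g \<cdot> h)" and inv: "invertible2 C \<beta>"
  obtains w \<chi> \<chi>' where "w \<in> hom1 C W P" "\<chi> \<in> hom2 C x (a \<cdot> w)" "\<chi>' \<in> hom2 C (a \<cdot> w) x"
    "\<chi>' \<bullet> \<chi> = id2 C x" "\<chi> \<bullet> \<chi>' = id2 C (a \<cdot> w)" "p \<rhd> \<chi> = \<beta>" "c \<cdot> w = h"
proof -
  note ty = typing hom1D [OF x] hom1D [OF h] hom2D [OF \<beta>]
  have "x \<in> Arr C" "\<beta> \<in> Cell C" "cod1 C x = dom1 C p" "src C \<beta> = p \<cdot> x" by (simp_all add: ty)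
  then obtain \<chi> where \<chi>: "\<chi> \<in> Cell C" "src C \<chi> = x" "invertible2 C \<chi>" "p \<rhd> \<chi> = \<beta>"
    using isofibration_p inv unfolding isofibration_def by blast
  have "tgt C (p \<rhd> \<chi>) = tgt C \<beta>" by (simp add: \<chi>)
  then have tgt: "p \<cdot> tgt C \<chi> = g \<cdot> h" by (simp add: ty \<chi>(1,2))
  have "tgt C \<chi> \<in> hom1 C W E" using \<chi>(1,2) by (simp add: hom1_iff ty)
  then obtain w where w: "w \<in> hom1 C W P" "a \<cdot> w = tgt C \<chi>" "c \<cdot> w = h"
    using pullback_factor [OF pb a c p g _ h tgt] by blast
  have \<chi>_hom: "\<chi> \<in> hom2 C x (a \<cdot> w)" using \<chi> w by (simp add: hom2_iff)
  obtain \<chi>' where \<chi>': "\<chi>' \<in> hom2 C (a \<cdot> w) x" "\<chi>' \<bullet> \<chi> = id2 C x" "\<chi> \<bullet> \<chi>' = id2 C (a \<cdot> w)"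
    using invertible2E [OF \<chi>(3) \<chi>_hom] .
  show ?thesis by (rule that [OF w(1) \<chi>_hom \<chi>' \<chi>(4) w(3)])
qed

lemma invertible_over_G:
  assumes \<beta>: "\<beta> \<in> hom2 C k h" and k: "k \<in> hom1 C W G" and h: "h \<in> hom1 C W G"
  shows "invertible2 C \<beta>"
  using groupoidal_G assms hom1D(4) [OF k] unfolding groupoidal_def by blast

text \<open>
  Since \<open>G\<close> is groupoidal, an arbitrary 2-cell \<open>\<theta> : F \<cdot> x \<Rightarrow> a' \<cdot> y\<close> becomes invertible over \<open>G\<close>. Lifting
  it to \<open>\<chi>\<close> moves \<open>x\<close> within its isomorphism class so that what remains of \<open>\<theta>\<close> lies over an identity,
  and such a cell comes from the pullback \<open>P'\<close>.
\<close>

lemma lift_cell_to_P':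
  assumes x: "x \<in> hom1 C W E" and y: "y \<in> hom1 C W P'" and \<theta>: "\<theta> \<in> hom2 C (F \<cdot> x) (a' \<cdot> y)"
  obtains w \<chi> \<chi>' \<sigma> where "w \<in> hom1 C W P" "\<chi> \<in> hom2 C x (a \<cdot> w)" "\<chi>' \<in> hom2 C (a \<cdot> w) x"
    "\<chi>' \<bullet> \<chi> = id2 C x" "\<chi> \<bullet> \<chi>' = id2 C (a \<cdot> w)" "p \<rhd> \<chi> = p' \<rhd> \<theta>" "c \<cdot> w = c' \<cdot> y"
    "\<sigma> \<in> hom2 C (s \<cdot> w) y" "a' \<rhd> \<sigma> = \<theta> \<bullet> (F \<rhd> \<chi>')" "c' \<rhd> \<sigma> = id2 C (c' \<cdot> y)"
proof -
  note ty = square_simps hom1D [OF x] hom1D [OF y] hom2D [OF \<theta>]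
  have c'y: "c' \<cdot> y \<in> hom1 C W H" by (simp add: hom1_iff ty)
  have p'\<theta>: "p' \<rhd> \<theta> \<in> hom2 C (p \<cdot> x) (g \<cdot> (c' \<cdot> y))" by (simp add: hom2_iff ty)
  have "invertible2 C (p' \<rhd> \<theta>)"
    by (rule invertible_over_G [OF p'\<theta>, of W]) (simp_all add: hom1_iff ty)
  then obtain w \<chi> \<chi>' where w: "w \<in> hom1 C W P" and \<chi>: "\<chi> \<in> hom2 C x (a \<cdot> w)" and \<chi>': "\<chi>' \<in> hom2 C (a \<cdot> w) x"
    and eqs: "\<chi>' \<bullet> \<chi> = id2 C x" "\<chi> \<bullet> \<chi>' = id2 C (a \<cdot> w)" "p \<rhd> \<chi> = p' \<rhd> \<theta>" "c \<cdot> w = c' \<cdot> y"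
    by (rule lift_invertible [OF x c'y p'\<theta>])
  note ty = ty hom1D [OF w] hom2D [OF \<chi>] hom2D [OF \<chi>']
  \<comment> \<open>Since \<open>p' \<cdot> F = p\<close>, this composite is the image under
    \<open>p'\<close> of \<open>\<theta> \<bullet> (F \<rhd> \<chi>')\<close>. As an identity it
    matches the identity of \<open>c' \<cdot> y\<close>, which gives \<open>\<sigma>\<close> by the
    pullback \<open>P'\<close>.\<close>
  have "(p' \<rhd> \<theta>) \<bullet> (p \<rhd> \<chi>') = p \<rhd> (\<chi> \<bullet> \<chi>')" by (simp add: ty eqs(3))
  also have "\<dots> = id2 C (g \<cdot> (c' \<cdot> y))" by (simp add: ty eqs(2,4))
  finally have over_id: "(p' \<rhd> \<theta>) \<bullet> (p \<rhd> \<chi>') = id2 C (g \<cdot> (c' \<cdot> y))" .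
  have "\<exists>\<sigma> \<in> hom2 C (s \<cdot> w) y. a' \<rhd> \<sigma> = \<theta> \<bullet> (F \<rhd> \<chi>') \<and> c' \<rhd> \<sigma> = id2 C (c' \<cdot> y)"
    by (rule pullback_lift2 [OF pb' a' c' p' g, of _ W])
      (simp_all add: hom1_iff hom2_iff ty eqs(4) over_id)
  then show ?thesis using that [OF w \<chi> \<chi>' eqs] by blast
qed

text \<open>Now \<open>p' \<rhd> \<theta>\<close> ends at \<open>p \<cdot> x\<close>, where lifts
  must start. So its inverse \<open>\<tau>\<close> is lifted, and \<open>\<chi>\<close> itself, not
  \<open>\<chi>'\<close>, corrects \<open>\<theta>\<close> to a cell over an identity.\<close>

lemma lift_cell_from_P':
  assumes x: "x \<in> hom1 C W E" and y: "y \<in> hom1 C W P'" and \<theta>: "\<theta> \<in> hom2 C (a' \<cdot> y) (F \<cdot> x)"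
  obtains w \<chi> \<chi>' \<sigma> where "w \<in> hom1 C W P" "\<chi> \<in> hom2 C x (a \<cdot> w)" "\<chi>' \<in> hom2 C (a \<cdot> w) x"
    "\<chi>' \<bullet> \<chi> = id2 C x" "\<chi> \<bullet> \<chi>' = id2 C (a \<cdot> w)" "(p \<rhd> \<chi>) \<bullet> (p' \<rhd> \<theta>) = id2 C (g \<cdot> (c' \<cdot> y))"
    "c \<cdot> w = c' \<cdot> y" "\<sigma> \<in> hom2 C y (s \<cdot> w)" "a' \<rhd> \<sigma> = (F \<rhd> \<chi>) \<bullet> \<theta>" "c' \<rhd> \<sigma> = id2 C (c' \<cdot> y)"
proof -
  note ty = square_simps hom1D [OF x] hom1D [OF y] hom2D [OF \<theta>]
  have c'y: "c' \<cdot> y \<in> hom1 C W H" by (simp add: hom1_iff ty)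
  have p'\<theta>: "p' \<rhd> \<theta> \<in> hom2 C (g \<cdot> (c' \<cdot> y)) (p \<cdot> x)" by (simp add: hom2_iff ty)
  have "invertible2 C (p' \<rhd> \<theta>)"
    by (rule invertible_over_G [OF p'\<theta>, of W]) (simp_all add: hom1_iff ty)
  from invertible2E [OF this p'\<theta>] obtain \<tau> where \<tau>: "\<tau> \<in> hom2 C (p \<cdot> x) (g \<cdot> (c' \<cdot> y))"
    "\<tau> \<bullet> (p' \<rhd> \<theta>) = id2 C (g \<cdot> (c' \<cdot> y))" by metis
  have "invertible2 C \<tau>"
    by (rule invertible_over_G [OF \<tau>(1), of W]) (simp_all add: hom1_iff ty)
  then obtain w \<chi> \<chi>' where w: "w \<in> hom1 C W P" and \<chi>: "\<chi> \<in> hom2 C x (a \<cdot> w)" and \<chi>': "\<chi>' \<in> hom2 C (a \<cdot> w) x"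
    and eqs: "\<chi>' \<bullet> \<chi> = id2 C x" "\<chi> \<bullet> \<chi>' = id2 C (a \<cdot> w)" "p \<rhd> \<chi> = \<tau>" "c \<cdot> w = c' \<cdot> y"
    by (rule lift_invertible [OF x c'y \<tau>(1)])
  note ty = ty hom1D [OF w] hom2D [OF \<chi>] hom2D [OF \<chi>']
  have over_id: "(p \<rhd> \<chi>) \<bullet> (p' \<rhd> \<theta>) = id2 C (g \<cdot> (c' \<cdot> y))" by (simp add: eqs(3) \<tau>(2))
  have "\<exists>\<sigma> \<in> hom2 C y (s \<cdot> w). a' \<rhd> \<sigma> = (F \<rhd> \<chi>) \<bullet> \<theta> \<and> c' \<rhd> \<sigma> = id2 C (c' \<cdot> y)"
    by (rule pullback_lift2 [OF pb' a' c' p' g, of _ W])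
      (simp_all add: hom1_iff hom2_iff ty eqs(4) over_id)
  then show ?thesis using that [OF w \<chi> \<chi>' eqs(1,2) over_id eqs(4)] by blast
qed

text \<open>The isomorphism \<open>n : u \<cdot> w \<Rightarrow> 1\<close> is assembled from
  \<open>\<chi>'\<close> and \<open>\<sigma>\<close> in the isocomma object, and
  \<open>m : 1 \<Rightarrow> w \<cdot> u\<close> from \<open>\<chi> \<lhd> u\<close> and an identity
  in the pullback \<open>P\<close>. Each is invertible because its projections are.\<close>

lemma bipullback_square:
  assumes fc: "finitely_complete C"
  shows "bipullback C a s F a' (id2 C (F \<cdot> a))"
proof -
  obtain D x y \<theta> where x: "x \<in> hom1 C D E" and y: "y \<in> hom1 C D P'" and ic: "isocomma_square C x y F a' \<theta>"
    using isocomma_square_exists [OF fc F a'] by blast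
  note us = ic [unfolded isocomma_square_def]
  note \<theta> = universal_square_cell [OF us F a' x] and \<theta>_inv = universal_square_Q [OF us F a' x]
  have id_inv: "invertible2 C (id2 C (F \<cdot> a))" by (rule invertible2_id2) (simp add: typing)
  note ty0 = square_simps hom1D [OF x] hom1D [OF y] hom2D [OF \<theta>]
  have "\<exists>u \<in> hom1 C P D. x \<cdot> u = a \<and> y \<cdot> u = s \<and> \<theta> \<lhd> u = id2 C (F \<cdot> a)"
    by (rule universal_square_factor [OF us F a' x a s _ id_inv]) (simp add: hom2_iff ty0)
  then obtain u where u: "u \<in> hom1 C P D" "x \<cdot> u = a" "y \<cdot> u = s" "\<theta> \<lhd> u = id2 C (F \<cdot> a)" by blast
  obtain w \<chi> \<chi>' \<sigma> where w: "w \<in> hom1 C D P" and \<chi>: "\<chi> \<in> hom2 C x (a \<cdot> w)" and \<chi>': "\<chi>' \<in> hom2 C (a \<cdot> w) x"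
    and \<chi>_inv: "\<chi>' \<bullet> \<chi> = id2 C x" "\<chi> \<bullet> \<chi>' = id2 C (a \<cdot> w)" and p\<chi>: "p \<rhd> \<chi> = p' \<rhd> \<theta>" and cw: "c \<cdot> w = c' \<cdot> y"
    and \<sigma>: "\<sigma> \<in> hom2 C (s \<cdot> w) y" and a'\<sigma>: "a' \<rhd> \<sigma> = \<theta> \<bullet> (F \<rhd> \<chi>')" and c'\<sigma>: "c' \<rhd> \<sigma> = id2 C (c' \<cdot> y)"
    by (rule lift_cell_to_P' [OF x y \<theta>])
  note ty1 = ty0 hom1D [OF u(1)] hom1D [OF w] hom2D [OF \<chi>] hom2D [OF \<chi>'] hom2D [OF \<sigma>]
  have ue: "x \<cdot> u \<cdot> k = a \<cdot> k" "y \<cdot> u \<cdot> k = s \<cdot> k" "\<theta> \<lhd> (u \<cdot> k) = id2 C (F \<cdot> a) \<lhd> k"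
    if "k \<in> Arr C" "cod1 C k = P" for k
    using that comp1_eqD(1) [OF u(2)] comp1_eqD(1) [OF u(3)] whisker_right_eqD [OF u(4)] by (simp_all add: ty1)
  have we: "c \<cdot> w \<cdot> k = c' \<cdot> y \<cdot> k" if "k \<in> Arr C" "cod1 C k = D" for k
    using that comp1_eq_assoc [OF cw] by (simp add: ty1)
  note ty = ty1 ue we u(2,3,4) cw
  have \<chi>_invertible: "invertible2 C \<chi>" and \<chi>'_invertible: "invertible2 C \<chi>'"
    using invertible2I [OF \<chi> \<chi>'] invertible2I [OF \<chi>' \<chi>] \<chi>_inv by blast+
  have \<sigma>_invertible: "invertible2 C \<sigma>"
  proof (rule pullback_invertible [OF pb' a' c' p' g, of _ D])
    show "invertible2 C (a' \<rhd> \<sigma>)"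
      unfolding a'\<sigma>
    proof (rule invertible2_vcomp [OF _ _ \<theta> \<theta>_inv])
      show "F \<rhd> \<chi>' \<in> hom2 C (F \<cdot> (a \<cdot> w)) (F \<cdot> x)" by (simp add: hom2_iff ty1)
      show "invertible2 C (F \<rhd> \<chi>')"
        by (rule invertible2_whisker_left [OF \<chi>' \<chi>'_invertible _ F]) (simp add: hom1_iff ty1)
    qed
    show "invertible2 C (c' \<rhd> \<sigma>)" unfolding c'\<sigma> by (rule invertible2_id2) (simp add: ty1)
  qed (simp_all add: hom1_iff hom2_iff ty1)
  have "\<exists>n \<in> hom2 C (u \<cdot> w) (id1 C D). x \<rhd> n = \<chi>' \<and> y \<rhd> n = \<sigma>"
    by (rule universal_square_lift2 [OF us F a' x, of _ D])
      (simp_all add: hom1_iff hom2_iff ty a'\<sigma>)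
  then obtain n where n: "n \<in> hom2 C (u \<cdot> w) (id1 C D)" "x \<rhd> n = \<chi>'" "y \<rhd> n = \<sigma>" by blast
  have "invertible2 C n"
    by (rule universal_square_invertible [OF us F a' x _ _ n(1), of D])
      (simp_all add: hom1_iff ty1 n \<chi>'_invertible \<sigma>_invertible)
  with n(1) have uw: "isomorphic1 C (u \<cdot> w) (id1 C D)" unfolding isomorphic1_def by blast
  \<comment> \<open>The comparison \<open>u\<close> sends \<open>\<theta>\<close> to an identity, so
    \<open>\<chi> \<lhd> u\<close> lies over an identity and can be paired with
    \<open>id2 C c\<close>.\<close>
  have p\<chi>u: "p \<rhd> (\<chi> \<lhd> u) = id2 C (g \<cdot> c)"
    using arg_cong [OF p\<chi>, of "\<lambda>\<gamma>. \<gamma> \<lhd> u"] by (simp add: ty)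
  have "\<exists>m \<in> hom2 C (id1 C P) (w \<cdot> u). a \<rhd> m = \<chi> \<lhd> u \<and> c \<rhd> m = id2 C c"
    by (rule pullback_lift2 [OF pb a c p g, of _ P])
      (simp_all add: hom1_iff hom2_iff ty p\<chi>u)
  then obtain m where m: "m \<in> hom2 C (id1 C P) (w \<cdot> u)" "a \<rhd> m = \<chi> \<lhd> u" "c \<rhd> m = id2 C c" by blast
  have "invertible2 C m"
  proof (rule pullback_invertible [OF pb a c p g _ _ m(1)])
    show "invertible2 C (a \<rhd> m)" unfolding m(2)
      by (rule invertible2_whisker_right [OF \<chi> \<chi>_invertible x u(1)])
    show "invertible2 C (c \<rhd> m)" unfolding m(3) by (rule invertible2_id2) (simp add: typing)
  qed (simp_all add: hom1_iff ty1)
  then obtain m' where "m' \<in> hom2 C (w \<cdot> u) (id1 C P)" "m' \<bullet> m = id2 C (id1 C P)" "m \<bullet> m' = id2 C (w \<cdot> u)"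
    using invertible2E m(1) by metis
  then have "isomorphic1 C (w \<cdot> u) (id1 C P)"
    using invertible2I m(1) unfolding isomorphic1_def by blast
  with uw have "equivalence1 C u"
    unfolding equivalence1_def using w by (auto simp: ty1)
  moreover have "lax_square C a s F a' (id2 C (F \<cdot> a))"
    unfolding lax_square_iff [OF F a'] using a s by (auto simp: hom2_iff square_simps)
  ultimately show ?thesis
    unfolding bipullback_def using ic u id_inv hom1D(2) [OF a] hom1D(2) [OF x] by auto
qed

text \<open>The 1-cell \<open>r\<close> replaces the generic \<open>(x, z', \<theta>)\<close> of
  \<open>D'\<close> by \<open>(w, z', \<sigma>)\<close>. The cell \<open>n\<close> has components
  \<open>\<chi>\<close> and an identity; \<open>b\<close> has components
  \<open>\<epsilon> : d \<Rightarrow> w \<cdot> v\<close> and an identity.\<close>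

lemma exact_square_over_F:
  assumes fc: "finitely_complete C"
  shows "exact_square C a s F a' (id2 C (F \<cdot> a))"
proof (rule exact_squareI [OF fc a s F a'])
  show "id2 C (F \<cdot> a) \<in> hom2 C (F \<cdot> a) (a' \<cdot> s)" by (simp add: hom2_iff square_simps)
  fix V k D d z \<mu> D' x z' \<theta>
  assume k: "k \<in> hom1 C V P'" and d: "d \<in> hom1 C D P" and z: "z \<in> hom1 C D V"
    and cs: "comma_square C d z s k \<mu>" and x: "x \<in> hom1 C D' E" and z': "z' \<in> hom1 C D' V"
    and cs': "comma_square C x z' F (a' \<cdot> k) \<theta>"
  have a'k: "a' \<cdot> k \<in> hom1 C V E'" using hom1D [OF k] by (simp add: hom1_iff typing)
  note us = cs [unfolded comma_square_def] and us' = cs' [unfolded comma_square_def]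
  note \<mu> = universal_square_cell [OF us s k d] and \<theta>' = universal_square_cell [OF us' F a'k x]
  have \<theta>: "\<theta> \<in> hom2 C (F \<cdot> x) (a' \<cdot> (k \<cdot> z'))" using \<theta>' hom1D [OF k] hom1D [OF z'] by (simp add: typing)
  note ty0 = square_simps hom1D [OF k] hom1D [OF d] hom1D [OF z] hom1D [OF x] hom1D [OF z']
    hom2D [OF \<mu>] hom2D [OF \<theta>]
  have "\<exists>v \<in> hom1 C D D'. x \<cdot> v = a \<cdot> d \<and> z' \<cdot> v = z \<and> \<theta> \<lhd> v = a' \<rhd> \<mu>"
    by (rule universal_square_factor [OF us' F a'k x]) (simp_all add: hom1_iff hom2_iff ty0)
  then obtain v where v: "v \<in> hom1 C D D'" "x \<cdot> v = a \<cdot> d" "z' \<cdot> v = z" "\<theta> \<lhd> v = a' \<rhd> \<mu>" by blast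
  have kz': "k \<cdot> z' \<in> hom1 C D' P'" by (simp add: hom1_iff ty0)
  obtain w \<chi> \<chi>' \<sigma> where w: "w \<in> hom1 C D' P" and \<chi>: "\<chi> \<in> hom2 C x (a \<cdot> w)" and \<chi>': "\<chi>' \<in> hom2 C (a \<cdot> w) x"
    and \<chi>_inv: "\<chi>' \<bullet> \<chi> = id2 C x" "\<chi> \<bullet> \<chi>' = id2 C (a \<cdot> w)" and p\<chi>: "p \<rhd> \<chi> = p' \<rhd> \<theta>"
    and cw: "c \<cdot> w = c' \<cdot> (k \<cdot> z')" and \<sigma>: "\<sigma> \<in> hom2 C (s \<cdot> w) (k \<cdot> z')"
    and a'\<sigma>: "a' \<rhd> \<sigma> = \<theta> \<bullet> (F \<rhd> \<chi>')" and c'\<sigma>: "c' \<rhd> \<sigma> = id2 C (c' \<cdot> (k \<cdot> z'))"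
    by (rule lift_cell_to_P' [OF x kz' \<theta>])
  have "\<exists>r \<in> hom1 C D' D. d \<cdot> r = w \<and> z \<cdot> r = z' \<and> \<mu> \<lhd> r = \<sigma>"
    by (rule universal_square_factor [OF us s k d w z' \<sigma>]) simp
  then obtain r where r: "r \<in> hom1 C D' D" "d \<cdot> r = w" "z \<cdot> r = z'" "\<mu> \<lhd> r = \<sigma>" by blast
  note ty1 = ty0 hom1D [OF v(1)] hom1D [OF w] hom1D [OF r(1)] hom2D [OF \<chi>] hom2D [OF \<chi>'] hom2D [OF \<sigma>]
  have assoc: "x \<cdot> v \<cdot> f = a \<cdot> d \<cdot> f" "z' \<cdot> v \<cdot> f = z \<cdot> f" "\<theta> \<lhd> (v \<cdot> f) = a' \<rhd> (\<mu> \<lhd> f)"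
    if "f \<in> Arr C" "cod1 C f = D" for f
    using that comp1_eq_assoc [OF v(2)] comp1_eqD(1) [OF v(3)] whisker_right_eqD [OF v(4)]
    by (simp_all add: ty1)
  have assoc': "d \<cdot> r \<cdot> f = w \<cdot> f" "z \<cdot> r \<cdot> f = z' \<cdot> f" "\<mu> \<lhd> (r \<cdot> f) = \<sigma> \<lhd> f"
    "c \<cdot> w \<cdot> f = c' \<cdot> k \<cdot> z' \<cdot> f"
    if "f \<in> Arr C" "cod1 C f = D'" for f
    using that comp1_eqD(1) [OF r(2)] comp1_eqD(1) [OF r(3)] whisker_right_eqD [OF r(4)]
      comp1_eqD(1) [OF cw]
    by (simp_all add: ty1)
  have cells: "x \<rhd> (v \<rhd> \<gamma>) = a \<rhd> (d \<rhd> \<gamma>)" "z' \<rhd> (v \<rhd> \<gamma>) = z \<rhd> \<gamma>"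
    if "\<gamma> \<in> Cell C" "cod1 C (src C \<gamma>) = D" for \<gamma>
    using that whisker_eq_assoc [OF v(2)] comp1_eqD(2) [OF v(3)] by (simp_all add: ty1)
  have pv: "p \<rhd> (\<chi> \<lhd> v) = g \<rhd> (c' \<rhd> \<mu>)"
    using arg_cong [OF p\<chi>, of "\<lambda>\<gamma>. \<gamma> \<lhd> v"] by (simp add: ty1 v)
  have \<sigma>F: "(a' \<rhd> \<sigma>) \<bullet> (F \<rhd> \<chi>) = \<theta>"
    using arg_cong [OF \<chi>_inv(1), of "\<lambda>\<gamma>. F \<rhd> \<gamma>"] by (simp add: ty1 a'\<sigma>)
  have \<sigma>Fv: "(a' \<rhd> (\<sigma> \<lhd> v)) \<bullet> (F \<rhd> (\<chi> \<lhd> v)) = a' \<rhd> \<mu>"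
    using arg_cong [OF \<sigma>F, of "\<lambda>\<gamma>. \<gamma> \<lhd> v"] by (simp add: ty1 v)
  have c'\<sigma>v: "c' \<rhd> (\<sigma> \<lhd> v) = id2 C (c' \<cdot> (k \<cdot> z))"
    using arg_cong [OF c'\<sigma>, of "\<lambda>\<gamma>. \<gamma> \<lhd> v"] by (simp add: ty1 v)
  note ty2 = ty1 assoc assoc' cells v(2-) r(2-) cw
  have "\<exists>n \<in> hom2 C (id1 C D') (v \<cdot> r). x \<rhd> n = \<chi> \<and> z' \<rhd> n = id2 C z'"
    by (rule universal_square_lift2 [OF us' F a'k x, of _ D'])
      (simp_all add: hom1_iff hom2_iff ty2 \<sigma>F)
  then obtain n where n: "n \<in> hom2 C (id1 C D') (v \<cdot> r)" "x \<rhd> n = \<chi>" "z' \<rhd> n = id2 C z'" by blast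
  \<comment> \<open>By \<open>pv\<close> the cell \<open>\<chi> \<lhd> v\<close> lies over
    \<open>g \<rhd> (c' \<rhd> \<mu>)\<close>, which dictates the component of
    \<open>\<epsilon>\<close> in \<open>H\<close>.\<close>
  have "\<exists>\<epsilon> \<in> hom2 C d (w \<cdot> v). a \<rhd> \<epsilon> = \<chi> \<lhd> v \<and> c \<rhd> \<epsilon> = c' \<rhd> \<mu>"
    by (rule pullback_lift2 [OF pb a c p g, of _ D])
      (simp_all add: hom1_iff hom2_iff ty2 pv)
  then obtain \<epsilon> where \<epsilon>: "\<epsilon> \<in> hom2 C d (w \<cdot> v)" "a \<rhd> \<epsilon> = \<chi> \<lhd> v" "c \<rhd> \<epsilon> = c' \<rhd> \<mu>" by blast
  note ty3 = ty2 hom2D [OF \<epsilon>(1)]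
  \<comment> \<open>This is the compatibility condition for \<open>b\<close>. It is an equation of
    cells into \<open>P'\<close>, tested on \<open>a'\<close> by \<open>\<sigma>Fv\<close> and on
    \<open>c'\<close> by the component of \<open>\<epsilon>\<close> in \<open>H\<close>.\<close>
  have \<mu>_eq: "(\<sigma> \<lhd> v) \<bullet> (s \<rhd> \<epsilon>) = \<mu>"
    by (rule pullback_cell_eq [OF pb' a' c' p' g, of "s \<cdot> d" D "k \<cdot> z"])
      (simp_all add: hom1_iff hom2_iff ty3 \<epsilon>(2,3) \<sigma>Fv c'\<sigma>v)
  have "\<exists>b \<in> hom2 C (id1 C D) (r \<cdot> v). d \<rhd> b = \<epsilon> \<and> z \<rhd> b = id2 C z"
    by (rule universal_square_lift2 [OF us s k d, of _ D])
      (simp_all add: hom1_iff hom2_iff ty3 \<mu>_eq)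
  then obtain b where b: "b \<in> hom2 C (id1 C D) (r \<cdot> v)" "d \<rhd> b = \<epsilon>" "z \<rhd> b = id2 C z" by blast
  note ty4 = ty3 hom2D [OF n(1)] hom2D [OF b(1)]
  have nv: "x \<rhd> (n \<lhd> v) = \<chi> \<lhd> v" "z' \<rhd> (n \<lhd> v) = id2 C z"
    using arg_cong [OF n(2), of "\<lambda>\<gamma>. \<gamma> \<lhd> v"] arg_cong [OF n(3), of "\<lambda>\<gamma>. \<gamma> \<lhd> v"] by (simp_all add: ty4)
  have "v \<rhd> b = n \<lhd> v"
    by (rule universal_square_cell_eq [OF us' F a'k x, of v D "v \<cdot> (r \<cdot> v)"])
      (simp_all add: hom1_iff hom2_iff ty4 nv b(2,3) \<epsilon>(2))
  moreover have "(a' \<rhd> \<mu>) \<bullet> (id2 C (F \<cdot> a) \<lhd> d) = a' \<rhd> \<mu>" by (simp add: ty0)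
  ultimately show "\<exists>v r n b. v \<in> hom1 C D D' \<and> r \<in> hom1 C D' D \<and>
        n \<in> hom2 C (id1 C D') (v \<cdot> r) \<and> b \<in> hom2 C (id1 C D) (r \<cdot> v) \<and>
        x \<cdot> v = a \<cdot> d \<and> z' \<cdot> v = z \<and> \<theta> \<lhd> v = (a' \<rhd> \<mu>) \<bullet> (id2 C (F \<cdot> a) \<lhd> d) \<and>
        v \<rhd> b = n \<lhd> v \<and> z' \<rhd> n = id2 C z'"
    using v r(1) n b(1) by auto
qed

text \<open>Here the isomorphism moves \<open>k \<cdot> z'\<close>, not a projection of the comma
  object, so \<open>\<chi>'\<close> becomes the 2-cell of the new triple
  \<open>(w, z', \<chi>')\<close> defining \<open>r\<close>. The cell \<open>\<sigma>\<close> is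
  left over as the component of \<open>n\<close> at \<open>y\<close>.\<close>

lemma exact_square_over_a':
  assumes fc: "finitely_complete C"
  shows "exact_square C s a a' F (id2 C (a' \<cdot> s))"
proof (rule exact_squareI [OF fc s a a' F])
  show "id2 C (a' \<cdot> s) \<in> hom2 C (a' \<cdot> s) (F \<cdot> a)" by (simp add: hom2_iff square_simps)
  fix V k D d z \<mu> D' y z' \<theta>
  assume k: "k \<in> hom1 C V E" and d: "d \<in> hom1 C D P" and z: "z \<in> hom1 C D V"
    and cs: "comma_square C d z a k \<mu>" and y: "y \<in> hom1 C D' P'" and z': "z' \<in> hom1 C D' V"
    and cs': "comma_square C y z' a' (F \<cdot> k) \<theta>"
  have Fk: "F \<cdot> k \<in> hom1 C V E'" using hom1D [OF k] by (simp add: hom1_iff typing)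
  note us = cs [unfolded comma_square_def] and us' = cs' [unfolded comma_square_def]
  note \<mu> = universal_square_cell [OF us a k d] and \<theta>' = universal_square_cell [OF us' a' Fk y]
  have \<theta>: "\<theta> \<in> hom2 C (a' \<cdot> y) (F \<cdot> (k \<cdot> z'))" using \<theta>' hom1D [OF k] hom1D [OF z'] by (simp add: typing)
  note ty0 = square_simps hom1D [OF k] hom1D [OF d] hom1D [OF z] hom1D [OF y] hom1D [OF z']
    hom2D [OF \<mu>] hom2D [OF \<theta>]
  have "\<exists>v \<in> hom1 C D D'. y \<cdot> v = s \<cdot> d \<and> z' \<cdot> v = z \<and> \<theta> \<lhd> v = F \<rhd> \<mu>"
    by (rule universal_square_factor [OF us' a' Fk y]) (simp_all add: hom1_iff hom2_iff ty0)
  then obtain v where v: "v \<in> hom1 C D D'" "y \<cdot> v = s \<cdot> d" "z' \<cdot> v = z" "\<theta> \<lhd> v = F \<rhd> \<mu>" by blast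
  have kz': "k \<cdot> z' \<in> hom1 C D' E" by (simp add: hom1_iff ty0)
  obtain w \<chi> \<chi>' \<sigma> where w: "w \<in> hom1 C D' P" and \<chi>: "\<chi> \<in> hom2 C (k \<cdot> z') (a \<cdot> w)"
    and \<chi>': "\<chi>' \<in> hom2 C (a \<cdot> w) (k \<cdot> z')"
    and \<chi>_inv: "\<chi>' \<bullet> \<chi> = id2 C (k \<cdot> z')" "\<chi> \<bullet> \<chi>' = id2 C (a \<cdot> w)"
    and p\<chi>: "(p \<rhd> \<chi>) \<bullet> (p' \<rhd> \<theta>) = id2 C (g \<cdot> (c' \<cdot> y))"
    and cw: "c \<cdot> w = c' \<cdot> y" and \<sigma>: "\<sigma> \<in> hom2 C y (s \<cdot> w)"
    and a'\<sigma>: "a' \<rhd> \<sigma> = (F \<rhd> \<chi>) \<bullet> \<theta>" and c'\<sigma>: "c' \<rhd> \<sigma> = id2 C (c' \<cdot> y)"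
    by (rule lift_cell_from_P' [OF kz' y \<theta>])
  have "\<exists>r \<in> hom1 C D' D. d \<cdot> r = w \<and> z \<cdot> r = z' \<and> \<mu> \<lhd> r = \<chi>'"
    by (rule universal_square_factor [OF us a k d w z' \<chi>']) simp
  then obtain r where r: "r \<in> hom1 C D' D" "d \<cdot> r = w" "z \<cdot> r = z'" "\<mu> \<lhd> r = \<chi>'" by blast
  note ty1 = ty0 hom1D [OF v(1)] hom1D [OF w] hom1D [OF r(1)] hom2D [OF \<chi>] hom2D [OF \<chi>'] hom2D [OF \<sigma>]
  have assoc: "y \<cdot> v \<cdot> f = s \<cdot> d \<cdot> f" "z' \<cdot> v \<cdot> f = z \<cdot> f" "\<theta> \<lhd> (v \<cdot> f) = F \<rhd> (\<mu> \<lhd> f)"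
    if "f \<in> Arr C" "cod1 C f = D" for f
    using that comp1_eq_assoc [OF v(2)] comp1_eqD(1) [OF v(3)] whisker_right_eqD [OF v(4)]
    by (simp_all add: ty1)
  have assoc': "d \<cdot> r \<cdot> f = w \<cdot> f" "z \<cdot> r \<cdot> f = z' \<cdot> f" "\<mu> \<lhd> (r \<cdot> f) = \<chi>' \<lhd> f"
    "c \<cdot> w \<cdot> f = c' \<cdot> y \<cdot> f"
    if "f \<in> Arr C" "cod1 C f = D'" for f
    using that comp1_eqD(1) [OF r(2)] comp1_eqD(1) [OF r(3)] whisker_right_eqD [OF r(4)]
      comp1_eqD(1) [OF cw]
    by (simp_all add: ty1)
  have cells: "y \<rhd> (v \<rhd> \<gamma>) = s \<rhd> (d \<rhd> \<gamma>)" "z' \<rhd> (v \<rhd> \<gamma>) = z \<rhd> \<gamma>"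
    if "\<gamma> \<in> Cell C" "cod1 C (src C \<gamma>) = D" for \<gamma>
    using that whisker_eq_assoc [OF v(2)] comp1_eqD(2) [OF v(3)] by (simp_all add: ty1)
  have pv: "(p \<rhd> (\<chi> \<lhd> v)) \<bullet> (p \<rhd> \<mu>) = id2 C (g \<cdot> (c \<cdot> d))"
    using arg_cong [OF p\<chi>, of "\<lambda>\<gamma>. \<gamma> \<lhd> v"] by (simp add: ty1 v)
  have F\<chi>: "(F \<rhd> \<chi>') \<bullet> ((F \<rhd> \<chi>) \<bullet> \<theta>) = \<theta>"
  proof -
    have "(F \<rhd> \<chi>') \<bullet> ((F \<rhd> \<chi>) \<bullet> \<theta>) = (F \<rhd> (\<chi>' \<bullet> \<chi>)) \<bullet> \<theta>" by (simp add: ty1)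
    then show ?thesis by (simp add: ty1 \<chi>_inv)
  qed
  have \<chi>v: "(\<chi>' \<lhd> v) \<bullet> ((\<chi> \<lhd> v) \<bullet> \<mu>) = \<mu>"
  proof -
    have "(\<chi>' \<lhd> v) \<bullet> ((\<chi> \<lhd> v) \<bullet> \<mu>) = ((\<chi>' \<bullet> \<chi>) \<lhd> v) \<bullet> \<mu>" by (simp add: ty1 v)
    then show ?thesis by (simp add: ty1 \<chi>_inv v)
  qed
  have a'\<sigma>v: "a' \<rhd> (\<sigma> \<lhd> v) = (F \<rhd> (\<chi> \<lhd> v)) \<bullet> (F \<rhd> \<mu>)"
    using arg_cong [OF a'\<sigma>, of "\<lambda>\<gamma>. \<gamma> \<lhd> v"] by (simp add: ty1 v)
  have c'\<sigma>v: "c' \<rhd> (\<sigma> \<lhd> v) = id2 C (c \<cdot> d)"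
    using arg_cong [OF c'\<sigma>, of "\<lambda>\<gamma>. \<gamma> \<lhd> v"] by (simp add: ty1 v)
  note ty2 = ty1 assoc assoc' cells v(2-) r(2-) cw
  have "\<exists>n \<in> hom2 C (id1 C D') (v \<cdot> r). y \<rhd> n = \<sigma> \<and> z' \<rhd> n = id2 C z'"
    by (rule universal_square_lift2 [OF us' a' Fk y, of _ D'])
      (simp_all add: hom1_iff hom2_iff ty2 a'\<sigma> F\<chi>)
  then obtain n where n: "n \<in> hom2 C (id1 C D') (v \<cdot> r)" "y \<rhd> n = \<sigma>" "z' \<rhd> n = id2 C z'" by blast
  \<comment> \<open>By \<open>pv\<close> the cell \<open>(\<chi> \<lhd> v) \<bullet> \<mu>\<close>
    lies over an identity of \<open>G\<close>, hence the identity as component in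
    \<open>H\<close>.\<close>
  have "\<exists>\<epsilon> \<in> hom2 C d (w \<cdot> v). a \<rhd> \<epsilon> = (\<chi> \<lhd> v) \<bullet> \<mu> \<and> c \<rhd> \<epsilon> = id2 C (c \<cdot> d)"
    by (rule pullback_lift2 [OF pb a c p g, of _ D])
      (simp_all add: hom1_iff hom2_iff ty2 pv)
  then obtain \<epsilon> where \<epsilon>: "\<epsilon> \<in> hom2 C d (w \<cdot> v)" "a \<rhd> \<epsilon> = (\<chi> \<lhd> v) \<bullet> \<mu>" "c \<rhd> \<epsilon> = id2 C (c \<cdot> d)" by blast
  note ty3 = ty2 hom2D [OF \<epsilon>(1)]
  have "\<exists>b \<in> hom2 C (id1 C D) (r \<cdot> v). d \<rhd> b = \<epsilon> \<and> z \<rhd> b = id2 C z"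
    by (rule universal_square_lift2 [OF us a k d, of _ D])
      (simp_all add: hom1_iff hom2_iff ty3 \<epsilon>(2) \<chi>v)
  then obtain b where b: "b \<in> hom2 C (id1 C D) (r \<cdot> v)" "d \<rhd> b = \<epsilon>" "z \<rhd> b = id2 C z" by blast
  note ty4 = ty3 hom2D [OF n(1)] hom2D [OF b(1)]
  have nv: "y \<rhd> (n \<lhd> v) = \<sigma> \<lhd> v" "z' \<rhd> (n \<lhd> v) = id2 C z"
    using arg_cong [OF n(2), of "\<lambda>\<gamma>. \<gamma> \<lhd> v"] arg_cong [OF n(3), of "\<lambda>\<gamma>. \<gamma> \<lhd> v"] by (simp_all add: ty4)
  \<comment> \<open>Projected to \<open>E'\<close> both sides are
    \<open>F \<rhd> ((\<chi> \<lhd> v) \<bullet> \<mu>)\<close>, projected to \<open>H\<close> both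
    are identities. This makes \<open>v \<rhd> b\<close> and \<open>n \<lhd> v\<close> agree at
    \<open>y\<close>.\<close>
  have s\<epsilon>: "s \<rhd> \<epsilon> = \<sigma> \<lhd> v"
    by (rule pullback_cell_eq [OF pb' a' c' p' g, of "s \<cdot> d" D "s \<cdot> (w \<cdot> v)"])
      (simp_all add: hom1_iff hom2_iff ty3 \<epsilon>(2,3) a'\<sigma>v c'\<sigma>v)
  have "v \<rhd> b = n \<lhd> v"
    by (rule universal_square_cell_eq [OF us' a' Fk y, of v D "v \<cdot> (r \<cdot> v)"])
      (simp_all add: hom1_iff hom2_iff ty4 nv b(2,3) s\<epsilon>)
  moreover have "(F \<rhd> \<mu>) \<bullet> (id2 C (a' \<cdot> s) \<lhd> d) = F \<rhd> \<mu>" by (simp add: ty0)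
  ultimately show "\<exists>v r n b. v \<in> hom1 C D D' \<and> r \<in> hom1 C D' D \<and>
        n \<in> hom2 C (id1 C D') (v \<cdot> r) \<and> b \<in> hom2 C (id1 C D) (r \<cdot> v) \<and>
        y \<cdot> v = s \<cdot> d \<and> z' \<cdot> v = z \<and> \<theta> \<lhd> v = (F \<rhd> \<mu>) \<bullet> (id2 C (a' \<cdot> s) \<lhd> d) \<and>
        v \<rhd> b = n \<lhd> v \<and> z' \<rhd> n = id2 C z'"
    using v r(1) n b(1) by auto
qed

end

section \<open>The naturality squares of an opfamilial 2-functor\<close>

lemma to_terminal_hom:
  assumes "terminal A I" "X \<in> Obj A"
  shows "to_terminal A I X \<in> hom1 A X I"
proof -
  have "\<exists>!t. t \<in> hom1 A X I" using assms unfolding terminal_def by blast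
  then show ?thesis unfolding to_terminal_def by (rule theI')
qed

lemma to_terminal_unique:
  assumes "terminal A I" "X \<in> Obj A" "t \<in> hom1 A X I"
  shows "t = to_terminal A I X"
  using assms to_terminal_hom [OF assms(1,2)] unfolding terminal_def by blast

text \<open>The lifting \<open>L\<close> sends \<open>X\<close> to a pair whose first component is
  \<open>map1 T (to_terminal A I X)\<close> and whose second component splits it.\<close>

lemma opfamilial_isofibration:
  assumes "two_category B" and opf: "opfamilial A I B T" and X: "X \<in> Obj A"
  shows "isofibration B (map1 T (to_terminal A I X))"
proof -
  obtain L where L: "two_functor A (split_opfibrations B (map0 T I)) L"
    and eq: "two_fun_eq A (comp_two_fun forget_splitting L) (slice_at_terminal A I T)"
    using opf unfolding opfamilial_def by blast
  have "map0 L X \<in> Obj (split_opfibrations B (map0 T I))"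
    by (rule two_functor.map0_obj [OF L X])
  then have "split_opfibration B (fst (map0 L X)) (snd (map0 L X))"
    by (auto simp: split_opfibrations_def Let_def)
  moreover have "fst (map0 L X) = map1 T (to_terminal A I X)"
    using eq X by (simp add: two_fun_eq_def comp_two_fun_def forget_splitting_def slice_at_terminal_def)
  ultimately show ?thesis
    using two_category.split_opfibration_isofibration [OF assms(1)] by simp
qed

theorem proposition4p6p5:
  fixes A :: "('o, 'a, 'c) two_cat" and B :: "('p, 'b, 'd) two_cat"
    and S T :: "('o, 'a, 'c, 'p, 'b, 'd) two_fun"
    and \<phi> :: "'o \<Rightarrow> 'b" and I :: 'o
  assumes "two_category A" and "finitely_complete A"
    and "two_category B" and "finitely_complete B"
    and "two_functor A B S" and "two_functor A B T"
    and "two_natural A B S T \<phi>"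
    and "terminal A I"
    and "opfamilial A I B T"
    and "groupoidal B (map0 T I)"
    and "\<And>X Y f. f \<in> hom1 A X Y \<Longrightarrow> pullback B (\<phi> X) (map1 S f) (map1 T f) (\<phi> Y)"
  shows "(\<forall>X \<in> Obj A. \<forall>Y \<in> Obj A. \<forall>f \<in> hom1 A X Y.
            bipullback B (\<phi> X) (map1 S f) (map1 T f) (\<phi> Y) (id2 B (map1 T f \<cdot>\<^bsub>B\<^esub> \<phi> X)))
         \<and> diexact A B S T \<phi>"
proof -
  interpret S: two_functor A B S by fact
  interpret T: two_functor A B T by fact
  interpret \<phi>: two_natural A B S T \<phi> by fact
  have I: "I \<in> Obj A" using \<open>terminal A I\<close> unfolding terminal_def by blast
  have square: "isofibration_pullback_square B (map0 T X) (map0 T Y) (map0 S X) (map0 S Y)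
      (map0 T I) (map0 S I) (map1 T (to_terminal A I X)) (map1 T (to_terminal A I Y)) (map1 T f) (\<phi> I)
      (\<phi> X) (map1 S (to_terminal A I X)) (\<phi> Y) (map1 S (to_terminal A I Y)) (map1 S f)"
    if X: "X \<in> Obj A" and Y: "Y \<in> Obj A" and f: "f \<in> hom1 A X Y" for X Y f
  proof -
    note tX = to_terminal_hom [OF \<open>terminal A I\<close> X] and tY = to_terminal_hom [OF \<open>terminal A I\<close> Y]
    \<comment> \<open>The images of this triangle under \<open>T\<close> and \<open>S\<close> are
      the triangles over \<open>G\<close> and \<open>H\<close>.\<close>
    have tf: "to_terminal A I Y \<cdot>\<^bsub>A\<^esub> f = to_terminal A I X"
      by (rule to_terminal_unique [OF \<open>terminal A I\<close> X S.A.comp1_hom [OF f tY]])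
    show ?thesis
    proof unfold_locales
      show "map1 T (to_terminal A I Y) \<cdot>\<^bsub>B\<^esub> map1 T f = map1 T (to_terminal A I X)"
        using T.map1_comp [OF f tY] tf by simp
      show "map1 S (to_terminal A I Y) \<cdot>\<^bsub>B\<^esub> map1 S f = map1 S (to_terminal A I X)"
        using S.map1_comp [OF f tY] tf by simp
      show "\<phi> Y \<cdot>\<^bsub>B\<^esub> map1 S f = map1 T f \<cdot>\<^bsub>B\<^esub> \<phi> X"
        using \<phi>.naturality1 [OF f] by simp
      show "isofibration B (map1 T (to_terminal A I X))"
        by (rule opfamilial_isofibration [OF \<open>two_category B\<close> \<open>opfamilial A I B T\<close> X])
    \<comment> \<open>Besides typing and groupoidality, what remains are the two pullbacks: the
      naturality squares at the 1-cells from \<open>X\<close> and \<open>Y\<close> to the terminal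
      object.\<close>
    qed (use assms S.map1_hom T.map1_hom \<phi>.component_hom tX tY X Y I f in auto)
  qed
  show ?thesis
    unfolding diexact_def
    using isofibration_pullback_square.bipullback_square [OF square \<open>finitely_complete B\<close>]
      isofibration_pullback_square.exact_square_over_F [OF square \<open>finitely_complete B\<close>]
      isofibration_pullback_square.exact_square_over_a' [OF square \<open>finitely_complete B\<close>]
    by blast
qed

end
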